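(* There is an algorithm with the following guarantee. The input consists of integers $1\le m\le n$; a generalized cross-polytope $X\subseteq\mathbb{R}^m$ (given by the parameters of its recursive construction); a vector $b\in\mathbb{R}^n\setminus\mathbb{Z}^n$ with $-b\in\operatorname{int}(G)$, where $G=X\times\mathbb{R}^{n-m}$; normal vectors $a^1,\dots,a^{2^m}\in\mathbb{R}^m$ such that $b+G=\{x\in\mathbb{R}^n: a^i\cdot(x_1,\dots,x_m)\le1,\ i=1,\dots,2^m\}$; and a point $p\in\mathbb{R}^n$. The algorithm outputs the value $\widetilde{\psi_{b+G}}(p)$ of the trivial lifting at $p$ using $O(m2^m)$ elementary operations (arithmetic operations, comparisons and roundings of real numbers).
   Context: Generalized cross-polytopes are defined recursively. In $\mathbb{R}^1$ they are the intervals $I_a=[a,a+1]$ with $a\in\mathbb{Z}$. For $d\ge2$, given a generalized cross-polytope $B'\subseteq\mathbb{R}^{d-1}$, a point $c\in B'$, $\gamma\in\mathbb{R}$ and $\mu\in(0,1)$, the generalized cross-polytope in $\mathbb{R}^d$ built out of $B',c,\gamma,\mu$ is the convex hull of $$\Big(\tfrac1\mu(B'-c)+c\Big)\times\{\gamma\}\quad\text{and}\quad \{c\}\times\Big(\tfrac1{1-\mu}(I_{\lfloor\gamma\rfloor}-\gamma)+\gamma\Big).$$ If $-b\in\operatorname{int}(G)$ with $G=X\times\mathbb{R}^{n-m}$, then $b+G$ is a maximal closed convex set among those containing $0$ in the interior and having no point of $b+\mathbb{Z}^n$ in the interior, and it can be described by $2^m$ inequalities as in the claim. The gauge function of a convex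 set $B$ with $0\in\operatorname{int}(B)$ is $\psi_B(x)=\inf\{\lambda>0:x/\lambda\in B\}$, and the trivial lifting is $\widetilde{\psi_B}(x)=\min(1,\inf_{z\in\mathbb{Z}^n}\psi_B(x+z))$. The model of computation is unit-cost real arithmetic, in which additions, multiplications, divisions, comparisons, and floor/ceiling operations each cost one operation. *)

theory Defs
  imports "HOL-Analysis.Analysis" "HOL-Library.Function_Algebras"
begin

section \<open>Vectors whose dimension is a term\<close>

text \<open>
  The dimensions vary inside the statement, so the points of $\mathbb{R}^d$ are the functions in
  \<^term>\<open>topspace (Euclidean_space d)\<close>, that is, the functions
  \<^typ>\<open>nat \<Rightarrow> real\<close> vanishing at all indices \<open>\<ge> d\<close>. Coordinates are numbered from \<open>0\<close>.
  The pointwise vector space structure on functions makes the library's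
  \<^term>\<open>(hull)\<close> and \<^term>\<open>convex\<close> available.
\<close>

instantiation "fun" :: (type, real_vector) real_vector
begin

definition scaleR_fun :: "real \<Rightarrow> ('a \<Rightarrow> 'b) \<Rightarrow> 'a \<Rightarrow> 'b"
  where "scaleR_fun r f = (\<lambda>x. r *\<^sub>R f x)"

instance
  by standard (simp_all add: scaleR_fun_def fun_eq_iff scaleR_add_right scaleR_add_left)

end

lemma scaleR_fun_apply [simp]: "(r *\<^sub>R f) x = r *\<^sub>R f x"
  by (simp add: scaleR_fun_def)

abbreviation Rn :: "nat \<Rightarrow> (nat \<Rightarrow> real) set"
  where "Rn d \<equiv> topspace (Euclidean_space d)"

definition Zn :: "nat \<Rightarrow> (nat \<Rightarrow> real) set"
  where "Zn d = {z \<in> Rn d. \<forall>i<d. z i \<in> \<int>}"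


section \<open>Generalized cross-polytopes\<close>

text \<open>
  For \<open>x\<close> in $\mathbb{R}^d$, the function \<^term>\<open>x(d := t)\<close> is the point
  \<open>(x, t)\<close> of $\mathbb{R}^{d+1}$.
\<close>

definition cross_step ::
    "nat \<Rightarrow> (nat \<Rightarrow> real) set \<Rightarrow> (nat \<Rightarrow> real) \<Rightarrow> real \<Rightarrow> real \<Rightarrow> (nat \<Rightarrow> real) set"
  where "cross_step d B c \<gamma> \<mu> = convex hull
    ((\<lambda>x. ((1 / \<mu>) *\<^sub>R (x - c) + c)(d := \<gamma>)) ` B \<union>
     (\<lambda>t. c(d := (1 / (1 - \<mu>)) * (t - \<gamma>) + \<gamma>)) ` {of_int \<lfloor>\<gamma>\<rfloor> .. of_int \<lfloor>\<gamma>\<rfloor> + 1})"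

text \<open>
  \<open>gen_cross_polytope a c \<gamma> \<mu> d X\<close>: the set \<open>X\<close> is the generalized cross-polytope in
  $\mathbb{R}^d$ with parameters \<open>a\<close>, \<open>c\<close>, \<open>\<gamma>\<close>, \<open>\<mu>\<close>, where \<open>c d\<close>, \<open>\<gamma> d\<close>, \<open>\<mu> d\<close> are
  those used to pass from dimension \<open>d\<close> to dimension \<open>d + 1\<close>.
\<close>

inductive gen_cross_polytope ::
    "int \<Rightarrow> (nat \<Rightarrow> nat \<Rightarrow> real) \<Rightarrow> (nat \<Rightarrow> real) \<Rightarrow> (nat \<Rightarrow> real) \<Rightarrow>
     nat \<Rightarrow> (nat \<Rightarrow> real) set \<Rightarrow> bool"
  for a c \<gamma> \<mu>
  where
    base: "gen_cross_polytope a c \<gamma> \<mu> 1 {x \<in> Rn 1. x 0 \<in> {of_int a .. of_int a + 1}}"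
  | step: "\<lbrakk>gen_cross_polytope a c \<gamma> \<mu> d B; c d \<in> B; 0 < \<mu> d; \<mu> d < 1\<rbrakk> \<Longrightarrow>
      gen_cross_polytope a c \<gamma> \<mu> (Suc d) (cross_step d B (c d) (\<gamma> d) (\<mu> d))"

text \<open>The product of a subset \<open>X\<close> of $\mathbb{R}^m$ with $\mathbb{R}^{n-m}$.\<close>

definition cylinder :: "nat \<Rightarrow> nat \<Rightarrow> (nat \<Rightarrow> real) set \<Rightarrow> (nat \<Rightarrow> real) set"
  where "cylinder m n X = {x \<in> Rn n. (\<lambda>i. if i < m then x i else 0) \<in> X}"


section \<open>Gauge functions and trivial liftings\<close>

definition gauge_function :: "(nat \<Rightarrow> real) set \<Rightarrow> (nat \<Rightarrow> real) \<Rightarrow> real"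
  where "gauge_function B x = Inf {r. r > 0 \<and> (1 / r) *\<^sub>R x \<in> B}"

definition trivial_lifting :: "nat \<Rightarrow> (nat \<Rightarrow> real) set \<Rightarrow> (nat \<Rightarrow> real) \<Rightarrow> real"
  where "trivial_lifting n B x = min 1 (INF z\<in>Zn n. gauge_function B (x + z))"


section \<open>Algorithms in unit-cost real arithmetic\<close>

text \<open>
  The memory consists of arrays of real numbers: \<open>s k j\<close> is the content of cell \<open>j\<close> of
  array \<open>k\<close>. Programs name arrays by fixed numbers and compute cell indices, rounded to natural
  numbers, with the same real arithmetic that they apply to data. The only constants of a program
  are integers.

  Besides arithmetic operations, comparisons and roundings, every read and every write of a memory
  cell costs one unit too; this changes operation counts of a program by at most a constant factor
  and an additive constant. All index computations and loop tests are charged.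
\<close>

type_synonym memory = "nat \<Rightarrow> nat \<Rightarrow> real"

datatype expr =
    Const int
  | Read nat expr
  | Add expr expr
  | Sub expr expr
  | Mul expr expr
  | Div expr expr
  | Floor expr
  | Ceiling expr

definition index :: "real \<Rightarrow> nat"
  where "index r = nat \<lfloor>r\<rfloor>"

primrec val :: "memory \<Rightarrow> expr \<Rightarrow> real"
  where
    "val s (Const i) = of_int i"
  | "val s (Read k e) = s k (index (val s e))"
  | "val s (Add e f) = val s e + val s f"
  | "val s (Sub e f) = val s e - val s f"
  | "val s (Mul e f) = val s e * val s f"
  | "val s (Div e f) = val s e / val s f"
  | "val s (Floor e) = of_int \<lfloor>val s e\<rfloor>"
  | "val s (Ceiling e) = of_int \<lceil>val s e\<rceil>"

primrec expr_cost :: "expr \<Rightarrow> nat"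
  where
    "expr_cost (Const i) = 0"
  | "expr_cost (Read k e) = expr_cost e + 1"
  | "expr_cost (Add e f) = expr_cost e + expr_cost f + 1"
  | "expr_cost (Sub e f) = expr_cost e + expr_cost f + 1"
  | "expr_cost (Mul e f) = expr_cost e + expr_cost f + 1"
  | "expr_cost (Div e f) = expr_cost e + expr_cost f + 1"
  | "expr_cost (Floor e) = expr_cost e + 1"
  | "expr_cost (Ceiling e) = expr_cost e + 1"

datatype test = Less expr expr | LessEq expr expr

primrec holds :: "memory \<Rightarrow> test \<Rightarrow> bool"
  where
    "holds s (Less e f) \<longleftrightarrow> val s e < val s f"
  | "holds s (LessEq e f) \<longleftrightarrow> val s e \<le> val s f"

primrec test_cost :: "test \<Rightarrow> nat"
  where
    "test_cost (Less e f) = expr_cost e + expr_cost f + 1"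
  | "test_cost (LessEq e f) = expr_cost e + expr_cost f + 1"

text \<open>\<open>Write k e f\<close> stores the value of \<open>f\<close> in the cell of array \<open>k\<close> with index \<open>e\<close>.\<close>

datatype program =
    Skip
  | Write nat expr expr
  | Seq program program
  | Cond test program program
  | While test program

text \<open>
  \<open>run P s k t\<close>: started in memory \<open>s\<close>, the program \<open>P\<close> terminates in memory \<open>t\<close> after
  \<open>k\<close> elementary operations.
\<close>

inductive run :: "program \<Rightarrow> memory \<Rightarrow> nat \<Rightarrow> memory \<Rightarrow> bool"
  where
    Skip: "run Skip s 0 s"
  | Write: "run (Write k e f) s (expr_cost e + expr_cost f + 1)
      (s(k := (s k)(index (val s e) := val s f)))"
  | Seq: "\<lbrakk>run P s k t; run Q t l u\<rbrakk> \<Longrightarrow> run (Seq P Q) s (k + l) u"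
  | CondTrue: "\<lbrakk>holds s b; run P s k t\<rbrakk> \<Longrightarrow> run (Cond b P Q) s (test_cost b + k) t"
  | CondFalse: "\<lbrakk>\<not> holds s b; run Q s k t\<rbrakk> \<Longrightarrow> run (Cond b P Q) s (test_cost b + k) t"
  | WhileFalse: "\<not> holds s b \<Longrightarrow> run (While b P) s (test_cost b) s"
  | WhileTrue: "\<lbrakk>holds s b; run P s k t; run (While b P) t l u\<rbrakk> \<Longrightarrow>
      run (While b P) s (test_cost b + k + l) u"

lemma run_deterministic: "run P s k t \<Longrightarrow> run P s l u \<Longrightarrow> k = l \<and> t = u"
proof (induction arbitrary: l u rule: run.induct)
  case (Skip s)
  then show ?case by (auto elim: run.cases)
next
  case (Write k e f s)
  then show ?case by (auto elim: run.cases)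
next
  case (Seq P s k t Q l' u')
  from Seq.prems show ?case by (cases rule: run.cases) (use Seq.IH in blast)+
next
  case (CondTrue s b P k t Q)
  from CondTrue.prems show ?case
    by (cases rule: run.cases) (use CondTrue.IH CondTrue.hyps in blast)+
next
  case (CondFalse s b Q k t P)
  from CondFalse.prems show ?case
    by (cases rule: run.cases) (use CondFalse.IH CondFalse.hyps in blast)+
next
  case (WhileFalse s b P)
  from WhileFalse.prems show ?case
    by (cases rule: run.cases) (use WhileFalse.hyps in blast)+
next
  case (WhileTrue s b P k t l' u')
  from WhileTrue.prems show ?case
    by (cases rule: run.cases) (use WhileTrue.IH WhileTrue.hyps in blast)+
qed

text \<open>
  Layout of the input: array \<open>0\<close> holds \<open>m\<close>, \<open>n\<close> and the parameter \<open>a\<close> of the cross-polytope;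
  arrays \<open>1\<close> and \<open>2\<close> hold \<open>\<gamma> d\<close> and \<open>\<mu> d\<close> in cell \<open>d\<close>; array \<open>3\<close> holds coordinate \<open>j\<close> of
  \<open>c d\<close> in cell \<open>d * m + j\<close> (for \<open>1 \<le> d < m\<close>); array \<open>4\<close> holds \<open>b\<close>; array \<open>5\<close> holds
  coordinate \<open>j\<close> of the \<open>i\<close>-th normal vector in cell \<open>i * m + j\<close>; array \<open>6\<close> holds \<open>p\<close>.
  All other cells are \<open>0\<close>.
\<close>

definition input_memory ::
    "nat \<Rightarrow> nat \<Rightarrow> int \<Rightarrow> (nat \<Rightarrow> nat \<Rightarrow> real) \<Rightarrow> (nat \<Rightarrow> real) \<Rightarrow> (nat \<Rightarrow> real) \<Rightarrow>
     (nat \<Rightarrow> real) \<Rightarrow> (nat \<Rightarrow> nat \<Rightarrow> real) \<Rightarrow> (nat \<Rightarrow> real) \<Rightarrow> memory"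
  where "input_memory m n a c \<gamma> \<mu> b A p = (\<lambda>_ _. 0)
    (0 := (\<lambda>_. 0)(0 := real m, 1 := real n, 2 := of_int a),
     1 := (\<lambda>d. if 1 \<le> d \<and> d < m then \<gamma> d else 0),
     2 := (\<lambda>d. if 1 \<le> d \<and> d < m then \<mu> d else 0),
     3 := (\<lambda>l. if m \<le> l \<and> l < m * m then c (l div m) (l mod m) else 0),
     4 := (\<lambda>j. if j < n then b j else 0),
     5 := (\<lambda>l. if l < 2 ^ m * m then A (l div m) (l mod m) else 0),
     6 := (\<lambda>j. if j < n then p j else 0))"

definition result :: "memory \<Rightarrow> real"
  where "result s = s 7 0"

end

theory Submission
  imports Defs
begin

text \<open>
  Put \<open>f = - b\<close> and look for \<open>t\<close> in \<open>[0, 1]\<close> such that \<open>p + t f\<close> lies in \<open>t X + z\<close> and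
  \<open>- (p + t f)\<close> lies in \<open>(1 - t) X + z'\<close> for lattice points \<open>z\<close>, \<open>z'\<close>. As \<open>X\<close> is lattice-free and
  \<open>f\<close> is interior, such a \<open>t\<close> is unique, and it is the value of the lifting: the first condition
  bounds the lifting from above, and by convexity a translate with a smaller gauge would put a lattice
  point into the interior of \<open>X\<close>.

  Both conditions are inherited along the recursive construction when \<open>t = \<mu> \<tau> + (1 - \<mu>) \<phi>\<close>, where
  \<open>\<tau>\<close> solves the problem for the previous cross-polytope at the point shifted by \<open>- (t - \<tau>) c\<close>, and
  \<open>\<phi>\<close> solves it for the interval at the last coordinate. As a function of \<open>t\<close>, the value \<open>\<phi>\<close> is
  piecewise affine and periodic, so on each piece the problem reduces to one of the same kind in
  lower dimension. The number of pieces is not bounded in terms of \<open>m\<close>. However, solving the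
  problem along the line \<open>\<phi> = 0\<close> locates the solution within one period, which consists of two
  pieces. Which of them contains the solution is decided at their common end in \<open>O(d\<^sup>2)\<close> operations.
  Two recursive calls in each dimension result in \<open>O(2^m)\<close> operations altogether.
\<close>

section \<open>Homothetic slices and the lattice\<close>

text \<open>The relation \<open>t = \<mu> \<tau> + (1 - \<mu>) \<phi>\<close> arises from mixing
  with weight \<open>\<theta>\<close> on the enlarged previous polytope. Put
  \<open>\<tau> = t \<theta> / \<mu>\<close> and
  \<open>\<phi> = t (1 - \<theta>) / (1 - \<mu>)\<close>: the dilate by \<open>t\<close> then
  consists of the points \<open>(t - \<tau>) c + \<tau> y\<close> with last coordinate
  \<open>(t - \<phi>) \<gamma> + \<phi> q\<close>, where \<open>y\<close> and \<open>q\<close>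
  belong to the previous polytope and the interval; hence the shift. Complementing \<open>t\<close>,
  \<open>\<tau>\<close>, \<open>\<phi>\<close> to 1 and negating the point respects these formulas,
  so the same \<open>\<tau>\<close> and \<open>\<phi>\<close> serve both conditions. Pieces are not
  enumerated but compared. Where \<open>\<phi>\<close> vanishes, the line of a piece meets the line
  \<open>\<phi> = 0\<close>, so the solution on the latter tells on which side of this point the
  solution on the piece lies. Each comparison is an instance of uniqueness in lower dimension and
  needs an interior direction there; the slice of the polytope at the height of \<open>f\<close>
  supplies it. At the other end of a piece both \<open>t\<close> and \<open>\<phi> = 1\<close> are
  known, so only the side is asked for, and one descent without branching answers.\<close>

locale cross_parameters =
  fixes a :: int and c :: "nat \<Rightarrow> nat \<Rightarrow> real" and \<gamma> \<mu> :: "nat \<Rightarrow> real"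
begin

text \<open>Level \<open>d\<close> is dimension \<open>d + 1\<close>: its coordinates are \<open>0, \<dots>, d\<close>, and all others are ignored.\<close>

primrec inX :: "nat \<Rightarrow> (nat \<Rightarrow> real) \<Rightarrow> bool"
  where
    "inX 0 x \<longleftrightarrow> of_int a \<le> x 0 \<and> x 0 \<le> of_int a + 1"
  | "inX (Suc d) x \<longleftrightarrow> (\<exists>\<theta> b i. 0 \<le> \<theta> \<and> \<theta> \<le> 1 \<and> inX d b \<and>
      of_int \<lfloor>\<gamma> (Suc d)\<rfloor> \<le> i \<and> i \<le> of_int \<lfloor>\<gamma> (Suc d)\<rfloor> + 1 \<and>
      (\<forall>j\<le>d. x j = c (Suc d) j + \<theta> / \<mu> (Suc d) * (b j - c (Suc d) j)) \<and>
      x (Suc d) = \<gamma> (Suc d) + (1 - \<theta>) / (1 - \<mu> (Suc d)) * (i - \<gamma> (Suc d)))"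

declare inX.simps(2) [simp del]

definition valid :: "nat \<Rightarrow> bool"
  where "valid n \<longleftrightarrow> (\<forall>d<n. 0 < \<mu> (Suc d) \<and> \<mu> (Suc d) < 1 \<and> inX d (c (Suc d)))"

text \<open>Lattice translates of the dilate by \<open>\<tau>\<close>. The witness \<open>q\<close>
  replaces a division by \<open>\<tau>\<close>, so that at \<open>\<tau> = 0\<close> exactly the
  lattice points qualify.\<close>

definition low :: "nat \<Rightarrow> real \<Rightarrow> (nat \<Rightarrow> real) \<Rightarrow> bool"
  where "low d \<tau> x \<longleftrightarrow> (\<exists>q z. inX d q \<and> (\<forall>j\<le>d. z j \<in> \<int> \<and> x j = \<tau> * q j + z j))"

text \<open>
  \<open>LE d \<tau> x\<close> and \<open>GE d \<tau> x\<close>, for \<open>x\<close> on the line through the data at parameter \<open>\<tau>\<close>, say that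
  the solution on that line is at most, respectively at least, \<open>\<tau>\<close>. They are extended beyond
  \<open>[0, 1]\<close> since the recursion leaves this interval.
\<close>

definition LE :: "nat \<Rightarrow> real \<Rightarrow> (nat \<Rightarrow> real) \<Rightarrow> bool"
  where "LE d \<tau> x \<longleftrightarrow> 1 \<le> \<tau> \<or> 0 \<le> \<tau> \<and> low d \<tau> x"

abbreviation GE :: "nat \<Rightarrow> real \<Rightarrow> (nat \<Rightarrow> real) \<Rightarrow> bool"
  where "GE d \<tau> x \<equiv> LE d (1 - \<tau>) (\<lambda>j. - x j)"

text \<open>Algebraic interior: a witness in each direction is all that the convexity arguments use,
  and it survives homotheties and restriction to a slice without any topology.\<close>

definition core :: "nat \<Rightarrow> (nat \<Rightarrow> real) \<Rightarrow> bool"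
  where "core d f \<longleftrightarrow> (\<forall>v. \<exists>\<epsilon>>0. inX d (\<lambda>j. f j + \<epsilon> * v j))"

lemma inX_cong: "(\<And>j. j \<le> d \<Longrightarrow> x j = y j) \<Longrightarrow> inX d x \<longleftrightarrow> inX d y"
  by (cases d) (auto simp: inX.simps(2))

lemma core_inX: "core d f \<Longrightarrow> inX d f"
  unfolding core_def by (drule spec[of _ "\<lambda>_. 0"]) auto

lemma valid_Suc:
  assumes "valid (Suc d)"
  shows "valid d" "0 < \<mu> (Suc d)" "\<mu> (Suc d) < 1" "inX d (c (Suc d))"
  using assms by (auto simp: valid_def)

text \<open>The weights of the two representations mix to \<open>t = u * t1 + v * t2\<close>. The
  points of the previous polytope and those of the interval are averaged separately, with the shares
  of \<open>t\<close> and of \<open>1 - t\<close> that they contribute.\<close>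

lemma inX_convex:
  assumes "inX d x" "inX d y" "0 \<le> u" "0 \<le> v" "u + v = 1"
  shows "inX d (\<lambda>j. u * x j + v * y j)"
  using assms
proof (induction d arbitrary: x y u v)
  case 0
  have "convex {real_of_int a .. of_int a + 1}" by simp
  then show ?case
    using 0 convexD[of "{real_of_int a .. of_int a + 1}" "x 0" "y 0" u v] by simp
next
  case (Suc d)
  let ?C = "c (Suc d)" and ?g = "\<gamma> (Suc d)" and ?m = "\<mu> (Suc d)"
  let ?k = "real_of_int \<lfloor>\<gamma> (Suc d)\<rfloor>"
  obtain t1 b1 i1 where 1: "0 \<le> t1" "t1 \<le> 1" "inX d b1" "?k \<le> i1" "i1 \<le> ?k + 1"
    "\<And>j. j \<le> d \<Longrightarrow> x j = ?C j + t1 / ?m * (b1 j - ?C j)"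
    "x (Suc d) = ?g + (1 - t1) / (1 - ?m) * (i1 - ?g)"
    using Suc.prems(1) unfolding inX.simps(2) by blast
  obtain t2 b2 i2 where 2: "0 \<le> t2" "t2 \<le> 1" "inX d b2" "?k \<le> i2" "i2 \<le> ?k + 1"
    "\<And>j. j \<le> d \<Longrightarrow> y j = ?C j + t2 / ?m * (b2 j - ?C j)"
    "y (Suc d) = ?g + (1 - t2) / (1 - ?m) * (i2 - ?g)"
    using Suc.prems(2) unfolding inX.simps(2) by blast
  define t where "t = u * t1 + v * t2"
  have t: "0 \<le> t" "t \<le> 1"
    using 1 2 Suc.prems convexD[of "{0..1::real}" t1 t2 u v] unfolding t_def by auto
  \<comment> \<open>If the mixed weight is 0, both contributions vanish and any point of the
    previous polytope will do.\<close>
  have "\<exists>b. inX d b \<and> (\<forall>j. t * b j = u * t1 * b1 j + v * t2 * b2 j)"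
  proof (cases "t = 0")
    case True
    then have "u * t1 = 0" "v * t2 = 0"
      using 1 2 Suc.prems unfolding t_def by (simp_all add: add_nonneg_eq_0_iff)
    with True 1 show ?thesis by auto
  next
    case False
    have "inX d (\<lambda>j. (u * t1 / t) * b1 j + (v * t2 / t) * b2 j)"
      using False t 1 2 Suc.prems by (intro Suc.IH) (auto simp: t_def add_divide_distrib[symmetric])
    with False show ?thesis
      by (intro exI[of _ "\<lambda>j. (u * t1 / t) * b1 j + (v * t2 / t) * b2 j"])
        (simp add: field_simps)
  qed
  then obtain b where b: "inX d b" "\<And>j. t * b j = u * t1 * b1 j + v * t2 * b2 j" by blast
  define s where "s = u * (1 - t1) + v * (1 - t2)"
  have s: "1 - t = s" unfolding s_def t_def using Suc.prems by (simp add: algebra_simps)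
  have "\<exists>i. ?k \<le> i \<and> i \<le> ?k + 1 \<and> s * i = u * (1 - t1) * i1 + v * (1 - t2) * i2"
  proof (cases "s = 0")
    case True
    then have "u * (1 - t1) = 0" "v * (1 - t2) = 0"
      using 1 2 Suc.prems unfolding s_def by (simp_all add: add_nonneg_eq_0_iff)
    with True 1 show ?thesis by auto
  next
    case False
    have "(u * (1 - t1) / s) *\<^sub>R i1 + (v * (1 - t2) / s) *\<^sub>R i2 \<in> {?k .. ?k + 1}"
      using False s t 1 2 Suc.prems
      by (intro convexD) (auto simp: s_def add_divide_distrib[symmetric])
    with False show ?thesis
      by (intro exI[of _ "(u * (1 - t1) / s) *\<^sub>R i1 + (v * (1 - t2) / s) *\<^sub>R i2"])
        (auto simp: field_simps)
  qed
  then obtain i where i: "?k \<le> i" "i \<le> ?k + 1"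
    "s * i = u * (1 - t1) * i1 + v * (1 - t2) * i2" by blast
  have v: "v = 1 - u" using Suc.prems by simp
  have "u * x j + v * y j = ?C j + t / ?m * (b j - ?C j)" if "j \<le> d" for j
  proof -
    have "u * x j + v * y j
        = ?C j + (u * t1 * b1 j + v * t2 * b2 j) / ?m - (u * t1 + v * t2) / ?m * ?C j"
      unfolding 1(6)[OF that] 2(6)[OF that] v by (simp add: algebra_simps add_divide_distrib diff_divide_distrib)
    also have "\<dots> = ?C j + t / ?m * (b j - ?C j)"
      unfolding b(2)[symmetric] t_def[symmetric] by (simp add: algebra_simps diff_divide_distrib)
    finally show ?thesis .
  qed
  moreover have "u * x (Suc d) + v * y (Suc d) = ?g + (1 - t) / (1 - ?m) * (i - ?g)"
  proof -
    have "u * x (Suc d) + v * y (Suc d)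
        = ?g + (u * (1 - t1) * i1 + v * (1 - t2) * i2) / (1 - ?m) - s / (1 - ?m) * ?g"
      unfolding 1(7) 2(7) s_def v by (simp add: algebra_simps add_divide_distrib diff_divide_distrib)
    also have "\<dots> = ?g + (1 - t) / (1 - ?m) * (i - ?g)"
      unfolding i(3)[symmetric] s by (simp add: algebra_simps diff_divide_distrib)
    finally show ?thesis .
  qed
  ultimately show ?case
    using t b(1) i(1,2) unfolding inX.simps(2) by (intro exI[of _ t] exI[of _ b] exI[of _ i]) simp
qed

lemma inX_segment:
  assumes "inX d x" "inX d y" "0 \<le> u" "u \<le> 1"
  shows "inX d (\<lambda>j. x j + u * (y j - x j))"
proof -
  have "inX d (\<lambda>j. (1 - u) * x j + u * y j)" using assms by (intro inX_convex) auto
  then show ?thesis by (simp add: algebra_simps)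
qed

lemma inX_convex3:
  assumes "inX d x" "inX d y" "inX d w" "0 \<le> u" "0 \<le> v" "0 < r" "u + v + r = 1"
  shows "inX d (\<lambda>j. u * x j + v * y j + r * w j)"
proof (cases "u = 0")
  case True
  then show ?thesis using assms inX_convex[of d y w v r] by simp
next
  case False
  then have u: "0 < u" using assms by simp
  have "inX d (\<lambda>j. (u / (u + r)) * x j + (r / (u + r)) * w j)"
    using assms u by (intro inX_convex) (simp_all flip: add_divide_distrib)
  then have "inX d (\<lambda>j. v * y j + (u + r) * ((u / (u + r)) * x j + (r / (u + r)) * w j))"
    using assms u by (intro inX_convex[OF assms(2)]) auto
  moreover have "v * y j + (u + r) * ((u / (u + r)) * x j + (r / (u + r)) * w j)
      = u * x j + v * y j + r * w j" for j
    using u assms by (simp add: distrib_left)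
  ultimately show ?thesis by (simp add: add_ac)
qed

lemma inX_nonempty: "\<exists>x. inX d x"
proof (induction d)
  case 0
  show ?case by (intro exI[of _ "\<lambda>_. of_int a"]) simp
next
  case (Suc d)
  then obtain b where b: "inX d b" by blast
  let ?x = "\<lambda>j. if j \<le> d then c (Suc d) j + 1 / \<mu> (Suc d) * (b j - c (Suc d) j)
    else \<gamma> (Suc d)"
  have "inX (Suc d) ?x"
    unfolding inX.simps(2) using b
    by (intro exI[of _ "1::real"] exI[of _ b] exI[of _ "of_int \<lfloor>\<gamma> (Suc d)\<rfloor>"]) simp
  then show ?case by blast
qed

section \<open>Interior points and horizontal slices\<close>

lemma core_segment:
  assumes "inX d y" "core d f" "0 < u" "u \<le> 1"
  shows "core d (\<lambda>j. y j + u * (f j - y j))"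
  unfolding core_def
proof
  fix v :: "nat \<Rightarrow> real"
  obtain e where e: "e > 0" "inX d (\<lambda>j. f j + e * v j)" using assms(2) unfolding core_def by blast
  have "inX d (\<lambda>j. y j + u * ((f j + e * v j) - y j))"
    using assms e by (intro inX_segment) auto
  then show "\<exists>\<epsilon>>0. inX d (\<lambda>j. y j + u * (f j - y j) + \<epsilon> * v j)"
    using e assms by (intro exI[of _ "u * e"]) (auto simp: algebra_simps)
qed

text \<open>The slice of the cross-polytope at height \<open>x (Suc d)\<close> is homothetic to the previous one with
  centre \<open>c (Suc d)\<close>; the two ratios are the inverse widths of its upper and lower parts.\<close>

definition upper_ratio :: "nat \<Rightarrow> real \<Rightarrow> real"
  where "upper_ratio d h = \<mu> d * (1 - frac (\<gamma> d)) / (1 - frac (\<gamma> d) - (1 - \<mu> d) * (h - \<gamma> d))"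

definition lower_ratio :: "nat \<Rightarrow> real \<Rightarrow> real"
  where "lower_ratio d h = \<mu> d * frac (\<gamma> d) / (frac (\<gamma> d) + (1 - \<mu> d) * (h - \<gamma> d))"

text \<open>In a representation with weight \<open>t\<close>, the vertical part gives
  \<open>h = (1 - t) * (i - \<gamma>)\<close>, where \<open>i - \<gamma>\<close> ranges over
  \<open>[- g, 1 - g]\<close>. Each end of this range turns \<open>h\<close> into an upper bound on
  \<open>t\<close>. Multiplied by the matching ratio, the horizontal factor \<open>t / \<mu>\<close>
  is then at most 1, and \<open>inX_segment\<close> from \<open>c\<close> applies. The bound
  \<open>t \<le> 1\<close> alone yields the ratio \<open>\<mu>\<close>.\<close>

lemma inX_slices:
  assumes "valid (Suc d)" "inX (Suc d) x"
  defines "s \<equiv> (\<lambda>\<rho> j. c (Suc d) j + \<rho> * (x j - c (Suc d) j))"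
    and "h \<equiv> (1 - \<mu> (Suc d)) * (x (Suc d) - \<gamma> (Suc d))" and "g \<equiv> frac (\<gamma> (Suc d))"
  shows "h \<le> 1 - g" "- g \<le> h" "inX d (s (\<mu> (Suc d)))"
    "h < 1 - g \<Longrightarrow> inX d (s (upper_ratio (Suc d) (x (Suc d))))"
    "- g < h \<Longrightarrow> inX d (s (lower_ratio (Suc d) (x (Suc d))))"
proof -
  let ?C = "c (Suc d)" and ?g = "\<gamma> (Suc d)" and ?m = "\<mu> (Suc d)"
  let ?k = "real_of_int \<lfloor>\<gamma> (Suc d)\<rfloor>"
  note v = valid_Suc[OF assms(1)]
  obtain t b i where 1: "0 \<le> t" "t \<le> 1" "inX d b" "?k \<le> i" "i \<le> ?k + 1"
    "\<And>j. j \<le> d \<Longrightarrow> x j = ?C j + t / ?m * (b j - ?C j)"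
    "x (Suc d) = ?g + (1 - t) / (1 - ?m) * (i - ?g)"
    using assms(2) unfolding inX.simps(2) by blast
  have g: "0 \<le> g" "g < 1" by (auto simp: g_def frac_lt_1)
  have i: "- g \<le> i - ?g" "i - ?g \<le> 1 - g" using 1 by (auto simp: g_def frac_def)
  have h: "h = (1 - t) * (i - ?g)" unfolding h_def 1(7) using v by simp
  have h1: "h \<le> (1 - t) * (1 - g)" unfolding h using 1 i by (intro mult_left_mono) auto
  have h2: "(1 - t) * (- g) \<le> h" unfolding h using 1 i by (intro mult_left_mono) auto
  have *: "inX d (s \<rho>)" if "0 \<le> \<rho> * t / ?m" "\<rho> * t / ?m \<le> 1" for \<rho>
  proof -
    have "inX d (\<lambda>j. ?C j + (\<rho> * t / ?m) * (b j - ?C j))"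
      using that v 1 by (intro inX_segment) auto
    moreover have "?C j + (\<rho> * t / ?m) * (b j - ?C j) = s \<rho> j" if "j \<le> d" for j
      using 1(6)[OF that] by (simp add: s_def)
    ultimately show ?thesis by (rule inX_cong[THEN iffD1, rotated])
  qed
  have tg: "t * g \<ge> 0" "t * (1 - g) \<ge> 0" using 1 g by simp_all
  show "h \<le> 1 - g" "- g \<le> h" using h1 h2 tg by (simp_all add: algebra_simps)
  show "inX d (s ?m)" using v 1 by (intro *) auto
  show "inX d (s (upper_ratio (Suc d) (x (Suc d))))" if "h < 1 - g"
  proof (intro *)
    have u: "upper_ratio (Suc d) (x (Suc d)) = ?m * (1 - g) / (1 - g - h)"
      by (simp add: upper_ratio_def g_def h_def)
    show "0 \<le> upper_ratio (Suc d) (x (Suc d)) * t / ?m"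
      unfolding u using that v 1 g by simp
    have "upper_ratio (Suc d) (x (Suc d)) * t / ?m = (t * (1 - g)) / (1 - g - h)"
      unfolding u using v by (simp add: mult_ac)
    also have "\<dots> \<le> 1" using that h1 by (simp add: algebra_simps)
    finally show "upper_ratio (Suc d) (x (Suc d)) * t / ?m \<le> 1" .
  qed
  show "inX d (s (lower_ratio (Suc d) (x (Suc d))))" if "- g < h"
  proof (intro *)
    have u: "lower_ratio (Suc d) (x (Suc d)) = ?m * g / (g + h)"
      by (simp add: lower_ratio_def g_def h_def)
    show "0 \<le> lower_ratio (Suc d) (x (Suc d)) * t / ?m"
      unfolding u using that v 1 g by simp
    have "lower_ratio (Suc d) (x (Suc d)) * t / ?m = (t * g) / (g + h)"
      unfolding u using v by (simp add: mult_ac)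
    also have "\<dots> \<le> 1" using that h2 by (simp add: algebra_simps)
    finally show "lower_ratio (Suc d) (x (Suc d)) * t / ?m \<le> 1" .
  qed
qed

lemma core_height:
  assumes "valid (Suc d)" "core (Suc d) f"
  defines "h \<equiv> (1 - \<mu> (Suc d)) * (f (Suc d) - \<gamma> (Suc d))"
  shows "h < 1 - frac (\<gamma> (Suc d))" "- frac (\<gamma> (Suc d)) < h"
proof -
  let ?v = "\<lambda>r j. if j = Suc d then r else (0::real)"
  note v = valid_Suc[OF assms(1)]
  have shift: "(1 - \<mu> (Suc d)) * (f (Suc d) + r - \<gamma> (Suc d)) = h + (1 - \<mu> (Suc d)) * r" for r
    by (simp add: h_def algebra_simps)
  obtain e where e: "e > 0" "inX (Suc d) (\<lambda>j. f j + e * ?v 1 j)"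
    using assms(2)[unfolded core_def, rule_format, of "?v 1"] by auto
  have "0 < (1 - \<mu> (Suc d)) * e" using v e by simp
  then show "h < 1 - frac (\<gamma> (Suc d))"
    using inX_slices(1)[OF assms(1) e(2)] shift[of e] by simp
  obtain e where e: "e > 0" "inX (Suc d) (\<lambda>j. f j + e * ?v (-1) j)"
    using assms(2)[unfolded core_def, rule_format, of "?v (-1)"] by auto
  have "0 < (1 - \<mu> (Suc d)) * e" using v e by simp
  then show "- frac (\<gamma> (Suc d)) < h"
    using inX_slices(2)[OF assms(1) e(2)] shift[of "- e"] by simp
qed

text \<open>A perturbation that leaves the last coordinate alone stays in the slice, so the
  homothety carries interior points to interior points as long as its ratio is positive. For
  integral \<open>\<gamma>\<close> the lower ratio is 0 and would collapse the slice to
  \<open>c\<close>.\<close>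

lemma core_slices:
  assumes "valid (Suc d)" "core (Suc d) f"
  defines "s \<equiv> (\<lambda>\<rho> j. c (Suc d) j + \<rho> * (f j - c (Suc d) j))"
  shows "core d (s (\<mu> (Suc d)))" "core d (s (upper_ratio (Suc d) (f (Suc d))))"
    "0 < frac (\<gamma> (Suc d)) \<Longrightarrow> core d (s (lower_ratio (Suc d) (f (Suc d))))"
    "0 < upper_ratio (Suc d) (f (Suc d))"
    "0 < frac (\<gamma> (Suc d)) \<Longrightarrow> 0 < lower_ratio (Suc d) (f (Suc d))"
proof -
  note v = valid_Suc[OF assms(1)]
  note h = core_height[OF assms(1,2)]
  have *: "core d (s \<rho>)" if "\<rho> > 0"
    and \<rho>: "\<And>x. inX (Suc d) x \<Longrightarrow> x (Suc d) = f (Suc d) \<Longrightarrow>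
      inX d (\<lambda>j. c (Suc d) j + \<rho> * (x j - c (Suc d) j))" for \<rho>
    unfolding core_def
  proof
    fix w :: "nat \<Rightarrow> real"
    obtain e where e: "e > 0" "inX (Suc d) (\<lambda>j. f j + e * (w(Suc d := 0)) j)"
      using assms(2)[unfolded core_def, rule_format, of "w(Suc d := 0)"] by blast
    have "inX d (\<lambda>j. s \<rho> j + \<rho> * e * w j)"
      using \<rho>[OF e(2)] by (subst inX_cong) (auto simp: s_def algebra_simps)
    then show "\<exists>\<epsilon>>0. inX d (\<lambda>j. s \<rho> j + \<epsilon> * w j)"
      using e \<open>\<rho> > 0\<close> by (intro exI[of _ "\<rho> * e"]) auto
  qed
  show "core d (s (\<mu> (Suc d)))" using inX_slices(3)[OF assms(1)] v by (intro *) auto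
  show u: "0 < upper_ratio (Suc d) (f (Suc d))"
    using v h frac_lt_1[of "\<gamma> (Suc d)"] by (simp add: upper_ratio_def)
  show "core d (s (upper_ratio (Suc d) (f (Suc d))))"
    using u inX_slices(4)[OF assms(1)] h by (intro *) metis+
  show l: "0 < lower_ratio (Suc d) (f (Suc d))" if "0 < frac (\<gamma> (Suc d))"
    using v h that by (simp add: lower_ratio_def)
  show "core d (s (lower_ratio (Suc d) (f (Suc d))))" if "0 < frac (\<gamma> (Suc d))"
    using l[OF that] inX_slices(5)[OF assms(1)] h by (intro *) metis+
qed

lemma core_contract:
  assumes "inX d y" "core d (\<lambda>j. y j + \<rho> * (z j - y j))" "1 \<le> \<rho>"
  shows "core d z"
proof -
  have "core d (\<lambda>j. y j + (1 / \<rho>) * ((y j + \<rho> * (z j - y j)) - y j))"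
    using assms by (intro core_segment[OF assms(1,2)]) auto
  moreover have "\<rho> \<noteq> 0" using assms(3) by auto
  ultimately show ?thesis by simp
qed

text \<open>An integer height is at most \<open>\<lfloor>\<gamma>\<rfloor>\<close> or at least
  \<open>\<lfloor>\<gamma>\<rfloor> + 1\<close>. There the lower, respectively the upper, ratio is
  at least 1: the slice is no larger than the previous polytope, so dropping the last coordinate
  gives an interior lattice point one dimension lower.\<close>

lemma core_lattice_free:
  assumes "valid d" "core d z" "\<And>j. j \<le> d \<Longrightarrow> z j \<in> \<int>"
  shows False
  using assms
proof (induction d arbitrary: z)
  case 0
  obtain e where e: "e > 0" "inX 0 (\<lambda>j. z j + e * 1)"
    using 0(2) unfolding core_def by (drule_tac spec[of _ "\<lambda>_. 1"]) auto
  obtain e' where e': "e' > 0" "inX 0 (\<lambda>j. z j + e' * -1)"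
    using 0(2) unfolding core_def by (drule_tac spec[of _ "\<lambda>_. -1"]) auto
  obtain i where "z 0 = of_int i" using 0(3)[of 0] Ints_cases by auto
  with e e' have "real_of_int i < real_of_int (a + 1)" "real_of_int a < real_of_int i" by auto
  then show False unfolding of_int_less_iff by simp
next
  case (Suc d)
  note v = valid_Suc[OF Suc.prems(1)] and h = core_height[OF Suc.prems(1,2)]
    and s = core_slices[OF Suc.prems(1,2)]
  obtain i where i: "z (Suc d) = of_int i" using Suc.prems(3)[of "Suc d"] Ints_cases by auto
  let ?g = "frac (\<gamma> (Suc d))" and ?h = "z (Suc d) - \<gamma> (Suc d)" and ?m = "\<mu> (Suc d)"
  have "core d z"
  proof (cases "i \<le> \<lfloor>\<gamma> (Suc d)\<rfloor>")
    case True
    then have hg: "?h \<le> - ?g" using i by (simp add: frac_def)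
    \<comment> \<open>For integral \<open>\<gamma>\<close> every interior height exceeds
      \<open>\<gamma>\<close> strictly, which contradicts a height of at most
      \<open>\<lfloor>\<gamma>\<rfloor>\<close>.\<close>
    have g: "0 < ?g"
    proof (rule ccontr)
      assume "\<not> 0 < ?g"
      then have "?g = 0" using frac_ge_0[of "\<gamma> (Suc d)"] by linarith
      moreover have "0 < (1 - ?m) * ?h" using h(2) unfolding \<open>?g = 0\<close> by simp
      then have "0 < ?h" using v(3) by (simp add: zero_less_mult_iff)
      ultimately show False using hg by linarith
    qed
    have "(1 - ?m) * ?h \<le> (1 - ?m) * (- ?g)" using hg v by (intro mult_left_mono) auto
    then have "1 \<le> lower_ratio (Suc d) (z (Suc d))"
      using h by (simp add: lower_ratio_def algebra_simps)
    then show ?thesis by (rule core_contract[OF v(4) s(3)[OF g]])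
  next
    case False
    then have "of_int \<lfloor>\<gamma> (Suc d)\<rfloor> + 1 \<le> z (Suc d)" using i by linarith
    then have hg: "1 - ?g \<le> ?h" by (simp add: frac_def)
    have "(1 - ?m) * (1 - ?g) \<le> (1 - ?m) * ?h" using hg v by (intro mult_left_mono) auto
    then have "1 \<le> upper_ratio (Suc d) (z (Suc d))"
      using h by (simp add: upper_ratio_def algebra_simps)
    then show ?thesis by (rule core_contract[OF v(4) s(2)])
  qed
  with Suc.IH[of z] v(1) Suc.prems(3) show False by simp
qed

text \<open>Adding the two representations and \<open>(\<tau>' - \<tau>) * f\<close> cancels
  \<open>x\<close> and \<open>y\<close> and leaves the lattice point \<open>- (z + z')\<close> as a
  convex combination of two points of the polytope and \<open>f\<close>. If
  \<open>\<tau> < \<tau>'\<close>, the interior point \<open>f\<close> has positive weight, which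
  makes the lattice point interior.\<close>

lemma separation:
  assumes "valid d" "core d f" "low d \<tau> x" "low d (1 - \<tau>') (\<lambda>j. - y j)" "0 \<le> \<tau>" "\<tau>' \<le> 1"
    and xy: "\<And>j. j \<le> d \<Longrightarrow> y j - x j = (\<tau>' - \<tau>) * f j"
  shows "\<tau>' \<le> \<tau>"
proof (rule ccontr)
  assume "\<not> \<tau>' \<le> \<tau>"
  obtain q z where 1: "inX d q" "\<And>j. j \<le> d \<Longrightarrow> z j \<in> \<int>" "\<And>j. j \<le> d \<Longrightarrow> x j = \<tau> * q j + z j"
    using assms(3) unfolding low_def by auto
  obtain q' z' where 2: "inX d q'" "\<And>j. j \<le> d \<Longrightarrow> z' j \<in> \<int>"
    "\<And>j. j \<le> d \<Longrightarrow> - y j = (1 - \<tau>') * q' j + z' j"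
    using assms(4) unfolding low_def by auto
  have "core d (\<lambda>j. - (z j + z' j))"
    unfolding core_def
  proof
    fix v :: "nat \<Rightarrow> real"
    obtain e where e: "e > 0" "inX d (\<lambda>j. f j + e * v j)" using assms(2) unfolding core_def by blast
    have "inX d (\<lambda>j. \<tau> * q j + (1 - \<tau>') * q' j + (\<tau>' - \<tau>) * (f j + e * v j))"
      using assms(5,6) \<open>\<not> \<tau>' \<le> \<tau>\<close> by (intro inX_convex3[OF 1(1) 2(1) e(2)]) auto
    moreover have "\<tau> * q j + (1 - \<tau>') * q' j + (\<tau>' - \<tau>) * (f j + e * v j)
        = - (z j + z' j) + (\<tau>' - \<tau>) * e * v j" if "j \<le> d" for j
      using 1(3)[OF that] 2(3)[OF that] xy[OF that] unfolding distrib_left mult.assoc by linarith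
    ultimately have "inX d (\<lambda>j. - (z j + z' j) + (\<tau>' - \<tau>) * e * v j)"
      by (rule inX_cong[THEN iffD1, rotated])
    then show "\<exists>\<epsilon>>0. inX d (\<lambda>j. - (z j + z' j) + \<epsilon> * v j)"
      using e \<open>\<not> \<tau>' \<le> \<tau>\<close> by (intro exI[of _ "(\<tau>' - \<tau>) * e"]) auto
  qed
  then show False using core_lattice_free[OF assms(1)] 1(2) 2(2) by (meson Ints_add Ints_minus)
qed

lemma LE_GE_separation:
  assumes "valid d" "core d f" "LE d \<tau> (\<lambda>j. x j + \<tau> * f j)" "GE d \<tau>' (\<lambda>j. x j + \<tau>' * f j)"
    and "0 \<le> \<tau>" "\<tau>' \<le> 1"
  shows "\<tau>' \<le> \<tau>"
  using separation[OF assms(1,2), of \<tau> "\<lambda>j. x j + \<tau> * f j" \<tau>' "\<lambda>j. x j + \<tau>' * f j"] assms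
  by (auto simp: LE_def algebra_simps)

text \<open>By convexity the sum of the dilates by \<open>\<tau>\<close> and \<open>\<eta>\<close>
  is contained in the dilate by \<open>\<tau> + \<eta>\<close>; the lattice vector is kept.\<close>

lemma low_add:
  assumes "low d \<tau> x" "inX d f" "0 \<le> \<tau>" "0 \<le> \<eta>"
  shows "low d (\<tau> + \<eta>) (\<lambda>j. x j + \<eta> * f j)"
proof (cases "\<tau> + \<eta> = 0")
  case True
  then have "\<tau> = 0" "\<eta> = 0" using assms(3,4) by linarith+
  then show ?thesis using assms by simp
next
  case False
  obtain q z where 1: "inX d q" "\<And>j. j \<le> d \<Longrightarrow> z j \<in> \<int>" "\<And>j. j \<le> d \<Longrightarrow> x j = \<tau> * q j + z j"
    using assms(1) unfolding low_def by auto
  let ?q = "\<lambda>j. (\<tau> / (\<tau> + \<eta>)) * q j + (\<eta> / (\<tau> + \<eta>)) * f j"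
  have "inX d ?q"
    using assms 1 False by (intro inX_convex) (auto simp: add_divide_distrib[symmetric])
  moreover have "x j + \<eta> * f j = (\<tau> + \<eta>) * ?q j + z j" if "j \<le> d" for j
    using 1(3)[OF that] False by (simp add: distrib_left)
  ultimately show ?thesis unfolding low_def using 1(2) by blast
qed

lemma LE_mono:
  assumes "LE d \<tau> (\<lambda>j. x j + \<tau> * f j)" "inX d f" "\<tau> \<le> \<tau>'"
  shows "LE d \<tau>' (\<lambda>j. x j + \<tau>' * f j)"
  using low_add[of d \<tau> "\<lambda>j. x j + \<tau> * f j" f "\<tau>' - \<tau>"] assms
  by (auto simp: LE_def algebra_simps)

lemma GE_mono:
  assumes "GE d \<tau> (\<lambda>j. x j + \<tau> * f j)" "inX d f" "\<tau>' \<le> \<tau>"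
  shows "GE d \<tau>' (\<lambda>j. x j + \<tau>' * f j)"
  \<comment> \<open>Reflection reverses the line: \<open>- (x + \<tau> * f)\<close> is the point at
    parameter \<open>1 - \<tau>\<close> of the line from \<open>- x - f\<close> in direction
    \<open>f\<close>.\<close>
  using LE_mono[of d "1 - \<tau>" "\<lambda>j. - x j - f j" f "1 - \<tau>'"] assms
  by (simp add: algebra_simps)

section \<open>Raising the dimension by one\<close>

lemma lowI:
  assumes "inX d q" "\<And>j. j \<le> d \<Longrightarrow> z j \<in> \<int>" "\<And>j. j \<le> d \<Longrightarrow> x j = \<tau> * q j + z j"
  shows "low d \<tau> x"
  using assms unfolding low_def by blast

text \<open>The mixing weight is recovered as \<open>\<theta> = \<mu> * \<tau> / t\<close>, whose
  complement is \<open>(1 - \<mu>) * \<phi> / t\<close>; both are nonnegative, so they describe a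
  point of the polytope.\<close>

lemma low_step:
  assumes "valid (Suc d)" and \<tau>: "low d \<tau> (\<lambda>j. x j - (t - \<tau>) * c (Suc d) j)" "0 \<le> \<tau>" "0 \<le> \<phi>"
    and q: "of_int \<lfloor>\<gamma> (Suc d)\<rfloor> \<le> q" "q \<le> of_int \<lfloor>\<gamma> (Suc d)\<rfloor> + 1" "z \<in> \<int>"
    and x: "x (Suc d) - (t - \<phi>) * \<gamma> (Suc d) = \<phi> * q + z"
    and t: "t = \<mu> (Suc d) * \<tau> + (1 - \<mu> (Suc d)) * \<phi>"
  shows "low (Suc d) t x"
proof (cases "t = 0")
  case True
  note v = valid_Suc[OF assms(1)]
  \<comment> \<open>The weight is undefined for \<open>t = 0\<close>, but then both parts vanish and
    \<open>x\<close> itself is a lattice vector.\<close>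
  have "\<mu> (Suc d) * \<tau> = 0 \<and> (1 - \<mu> (Suc d)) * \<phi> = 0"
    using True t v \<tau> by (subst add_nonneg_eq_0_iff[symmetric]) auto
  then have 0: "\<tau> = 0" "\<phi> = 0" using v by auto
  obtain z' where z': "\<And>j. j \<le> d \<Longrightarrow> z' j \<in> \<int>" "\<And>j. j \<le> d \<Longrightarrow> x j = z' j"
    using \<tau> 0 True unfolding low_def by auto
  obtain w where "inX (Suc d) w" using inX_nonempty by blast
  then show ?thesis
    using True x 0 q z' by (intro lowI[where q = w and z = x]) (auto simp: le_Suc_eq)
next
  case False
  note v = valid_Suc[OF assms(1)]
  obtain b z' where b: "inX d b" "\<And>j. j \<le> d \<Longrightarrow> z' j \<in> \<int>"
    "\<And>j. j \<le> d \<Longrightarrow> x j - (t - \<tau>) * c (Suc d) j = \<tau> * b j + z' j"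
    using \<tau> unfolding low_def by auto
  have t0: "0 \<le> t" unfolding t using v \<tau> by simp
  define \<theta> where "\<theta> = \<mu> (Suc d) * \<tau> / t"
  have \<theta>: "0 \<le> \<theta>" unfolding \<theta>_def using v \<tau> t0 by simp
  have \<theta>1: "1 - \<theta> = (1 - \<mu> (Suc d)) * \<phi> / t"
    unfolding \<theta>_def using False t by (simp add: field_simps)
  moreover have "0 \<le> (1 - \<mu> (Suc d)) * \<phi> / t" using v \<tau> t0 by simp
  ultimately have "\<theta> \<le> 1" by linarith
  define w where "w j = (if j \<le> d then c (Suc d) j + \<theta> / \<mu> (Suc d) * (b j - c (Suc d) j)
      else \<gamma> (Suc d) + (1 - \<theta>) / (1 - \<mu> (Suc d)) * (q - \<gamma> (Suc d)))" for j
  have "inX (Suc d) w"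
    unfolding inX.simps(2) using \<theta> \<open>\<theta> \<le> 1\<close> b(1) q
    by (intro exI[of _ \<theta>] exI[of _ b] exI[of _ q]) (simp add: w_def)
  moreover have "x j = t * w j + (z'(Suc d := z)) j" if "j \<le> Suc d" for j
  proof (cases "j \<le> d")
    case True
    have "t * w j = t * c (Suc d) j + \<tau> * (b j - c (Suc d) j)"
      using True False v by (simp add: w_def \<theta>_def distrib_left)
    then show ?thesis using b(3)[OF True] True by (simp add: algebra_simps)
  next
    case j: False
    have "t * w (Suc d) = t * \<gamma> (Suc d) + \<phi> * (q - \<gamma> (Suc d))"
      using False v by (simp add: w_def \<theta>1 distrib_left)
    then show ?thesis using x j that by (simp add: algebra_simps le_Suc_eq)
  qed
  ultimately show ?thesis
    using b(2) q(3) by (intro lowI[where q = w and z = "z'(Suc d := z)"]) (auto simp: le_Suc_eq)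
qed

text \<open>The lattice translates of the polytope cover the space:
  \<open>\<tau> = \<phi> = t = 1\<close> makes both shifts disappear, and an interval of length 1
  represents every real modulo 1.\<close>

lemma low_1: "valid d \<Longrightarrow> low d 1 x"
proof (induction d arbitrary: x)
  case 0
  show ?case
    by (rule lowI[where q = "\<lambda>_. of_int a + frac (x 0)" and z = "\<lambda>_. of_int (\<lfloor>x 0\<rfloor> - a)"])
      (simp_all add: frac_lt_1 less_imp_le, simp add: frac_def)
next
  case (Suc d)
  have *: "x (Suc d) - (1 - 1) * \<gamma> (Suc d)
      = 1 * (of_int \<lfloor>\<gamma> (Suc d)\<rfloor> + frac (x (Suc d)))
        + of_int (\<lfloor>x (Suc d)\<rfloor> - \<lfloor>\<gamma> (Suc d)\<rfloor>)"
    by (simp add: frac_def)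
  have "low d 1 (\<lambda>j. x j - (1 - 1) * c (Suc d) j)" by (rule Suc.IH[OF valid_Suc(1)[OF Suc.prems]])
  then show ?case
    by (rule low_step[where x = x and t = 1 and \<phi> = 1, OF Suc.prems _ _ _ _ _ _ *]) (simp_all add: frac_lt_1 less_imp_le)
qed

text \<open>For \<open>\<tau> \<ge> 1\<close> the hypothesis \<open>LE\<close> carries no
  information about \<open>x\<close>. In this case \<open>\<tau>\<close> is lowered to 1, where
  \<open>low_1\<close> applies, and \<open>\<phi>\<close> is raised so as to keep
  \<open>t\<close>.\<close>

lemma LE_step:
  assumes "valid (Suc d)" and \<tau>: "LE d \<tau> (\<lambda>j. x j - (t - \<tau>) * c (Suc d) j)" "0 \<le> \<phi>" "\<phi> \<le> 1"
    and q: "of_int \<lfloor>\<gamma> (Suc d)\<rfloor> \<le> q" "q \<le> of_int \<lfloor>\<gamma> (Suc d)\<rfloor> + 1" "z \<in> \<int>"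
    and x: "x (Suc d) - (t - \<phi>) * \<gamma> (Suc d) = \<phi> * q + z"
    and t: "t = \<mu> (Suc d) * \<tau> + (1 - \<mu> (Suc d)) * \<phi>"
  shows "LE (Suc d) t x"
proof (cases "1 \<le> \<tau>")
  case False
  note v = valid_Suc[OF assms(1)]
  have "0 \<le> t" unfolding t using \<tau> v False by (simp add: LE_def)
  then show ?thesis
    using False \<tau>(1) low_step[where x = x and t = t and \<phi> = \<phi>, OF assms(1) _ _ \<tau>(2) q x t]
    unfolding LE_def by blast
next
  case True
  note v = valid_Suc[OF assms(1)]
  show ?thesis
  proof (cases "1 \<le> t")
    case False
    \<comment> \<open>This solves \<open>t = \<mu> * 1 + (1 - \<mu>) * \<psi>\<close>. As
      \<open>\<psi> \<ge> \<phi>\<close>, the point \<open>q\<close> can be moved towards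
      \<open>\<gamma>\<close> by the factor \<open>\<phi> / \<psi>\<close> without leaving the
      interval.\<close>
    define \<psi> where "\<psi> = (t - \<mu> (Suc d)) / (1 - \<mu> (Suc d))"
    have "\<mu> (Suc d) * 1 \<le> \<mu> (Suc d) * \<tau>" using True v by (intro mult_left_mono) auto
    then have \<psi>: "\<phi> \<le> \<psi>" unfolding \<psi>_def using v by (simp add: field_simps t)
    let ?q = "if \<psi> = 0 then q else \<gamma> (Suc d) + (\<phi> / \<psi>) * (q - \<gamma> (Suc d))"
    have "\<gamma> (Suc d) + (\<phi> / \<psi>) * (q - \<gamma> (Suc d)) \<in> {of_int \<lfloor>\<gamma> (Suc d)\<rfloor> .. of_int \<lfloor>\<gamma> (Suc d)\<rfloor> + 1}"
      if "\<psi> \<noteq> 0"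
    proof -
      have "0 \<le> \<phi> / \<psi>" "\<phi> / \<psi> \<le> 1" using \<psi> \<tau> that by (auto simp: divide_le_eq)
      then have "(1 - \<phi> / \<psi>) *\<^sub>R \<gamma> (Suc d) + (\<phi> / \<psi>) *\<^sub>R q
          \<in> {of_int \<lfloor>\<gamma> (Suc d)\<rfloor> .. of_int \<lfloor>\<gamma> (Suc d)\<rfloor> + 1}"
        using q by (intro convexD) (auto simp: less_imp_le)
      then show ?thesis by (simp add: algebra_simps)
    qed
    then have q': "of_int \<lfloor>\<gamma> (Suc d)\<rfloor> \<le> ?q" "?q \<le> of_int \<lfloor>\<gamma> (Suc d)\<rfloor> + 1"
      using q by auto
    have x': "x (Suc d) - (t - \<psi>) * \<gamma> (Suc d) = \<psi> * ?q + z"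
      using x \<psi> \<tau>(2) by (auto simp: algebra_simps)
    have "t = \<mu> (Suc d) * 1 + (1 - \<mu> (Suc d)) * \<psi>" using v by (simp add: \<psi>_def)
    then have "low (Suc d) t x"
      using \<psi> \<tau> by (intro low_step[where \<tau> = 1 and x = x and t = t and \<phi> = \<psi>,
            OF assms(1) low_1[OF v(1)] _ _ q' q(3) x']) auto
    moreover have "0 \<le> t"
      unfolding \<open>t = \<mu> (Suc d) * 1 + (1 - \<mu> (Suc d)) * \<psi>\<close> using v \<psi> \<tau> by simp
    ultimately show ?thesis by (simp add: LE_def)
  qed (simp add: LE_def)
qed

text \<open>An integer end \<open>q\<close> represents \<open>y\<close> for \<open>\<phi>\<close>
  and, with the lattice vector changed by \<open>q\<close>, also \<open>- y\<close> for
  \<open>1 - \<phi>\<close>. Thus \<open>\<phi>\<close> solves the one-dimensional problem from both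
  sides.\<close>

definition on_lattice :: "nat \<Rightarrow> real \<Rightarrow> real \<Rightarrow> bool"
  where "on_lattice d \<phi> y \<longleftrightarrow> 0 \<le> \<phi> \<and> \<phi> \<le> 1 \<and>
    (\<exists>q\<in>{\<lfloor>\<gamma> d\<rfloor>, \<lfloor>\<gamma> d\<rfloor> + 1}. y - \<phi> * of_int q \<in> \<int>)"

lemma LE_step_lattice:
  assumes "valid (Suc d)" "LE d \<tau> (\<lambda>j. x j - (t - \<tau>) * c (Suc d) j)"
    and "on_lattice (Suc d) \<phi> (x (Suc d) - (t - \<phi>) * \<gamma> (Suc d))"
    and "t = \<mu> (Suc d) * \<tau> + (1 - \<mu> (Suc d)) * \<phi>"
  shows "LE (Suc d) t x"
proof -
  obtain q :: int where q: "q \<in> {\<lfloor>\<gamma> (Suc d)\<rfloor>, \<lfloor>\<gamma> (Suc d)\<rfloor> + 1}"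
    "x (Suc d) - (t - \<phi>) * \<gamma> (Suc d) - \<phi> * of_int q \<in> \<int>" "0 \<le> \<phi>" "\<phi> \<le> 1"
    using assms(3) unfolding on_lattice_def by blast
  show ?thesis
    by (rule LE_step[OF assms(1,2) q(3,4) _ _ q(2) _ assms(4), where q = "of_int q"])
      (use q in auto)
qed

lemma GE_step_lattice:
  assumes "valid (Suc d)" "GE d \<tau> (\<lambda>j. x j - (t - \<tau>) * c (Suc d) j)"
    and "on_lattice (Suc d) \<phi> (x (Suc d) - (t - \<phi>) * \<gamma> (Suc d))"
    and "t = \<mu> (Suc d) * \<tau> + (1 - \<mu> (Suc d)) * \<phi>"
  shows "GE (Suc d) t x"
proof -
  obtain q :: int where q: "q \<in> {\<lfloor>\<gamma> (Suc d)\<rfloor>, \<lfloor>\<gamma> (Suc d)\<rfloor> + 1}"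
    "x (Suc d) - (t - \<phi>) * \<gamma> (Suc d) - \<phi> * of_int q \<in> \<int>" "0 \<le> \<phi>" "\<phi> \<le> 1"
    using assms(3) unfolding on_lattice_def by blast
  have z: "- (x (Suc d) - (t - \<phi>) * \<gamma> (Suc d) - \<phi> * of_int q) - of_int q \<in> \<int>"
    by (intro Ints_diff[OF Ints_minus[OF q(2)]]) simp
  have "LE d (1 - \<tau>) (\<lambda>j. - x j - ((1 - t) - (1 - \<tau>)) * c (Suc d) j)"
    using assms(2) by (simp add: algebra_simps)
  then show ?thesis
    by (rule LE_step[OF assms(1) _ _ _ _ _ z, where \<phi> = "1 - \<phi>" and q = "of_int q"])
      (use q assms(4) in \<open>auto simp: algebra_simps\<close>)
qed

section \<open>The value of the interval problem and the decision at one parameter\<close>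

lemma on_lattice_iff:
  "on_lattice d \<phi> (\<delta> + \<phi> * \<gamma> d) \<longleftrightarrow> 0 \<le> \<phi> \<and> \<phi> \<le> 1 \<and>
    (\<delta> + \<phi> * frac (\<gamma> d) \<in> \<int> \<or> \<delta> - \<phi> * (1 - frac (\<gamma> d)) \<in> \<int>)"
proof -
  have "\<delta> + \<phi> * \<gamma> d - \<phi> * of_int \<lfloor>\<gamma> d\<rfloor> = \<delta> + \<phi> * frac (\<gamma> d)"
    "\<delta> + \<phi> * \<gamma> d - \<phi> * of_int (\<lfloor>\<gamma> d\<rfloor> + 1) = \<delta> - \<phi> * (1 - frac (\<gamma> d))"
    by (simp_all add: frac_def algebra_simps)
  moreover have "(\<exists>q\<in>{q1, q2}. P q) \<longleftrightarrow> P q1 \<or> P q2" for P and q1 q2 :: int by blast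
  ultimately show ?thesis unfolding on_lattice_def by (simp only:)
qed

text \<open>A wave of period 1 in \<open>\<delta>\<close>: 0 at the integers, rising with slope
  \<open>1 / (1 - g)\<close> to 1 at \<open>i + 1 - g\<close>, falling with slope
  \<open>- 1 / g\<close>. For integral \<open>\<gamma>\<close> it becomes the sawtooth
  \<open>frac \<delta>\<close>.\<close>

definition height_value :: "nat \<Rightarrow> real \<Rightarrow> real"
  where "height_value d \<delta> = (let g = frac (\<gamma> d); w = frac (\<delta> + g) in
    if w < g then 1 - w / g else (w - g) / (1 - g))"

lemma on_lattice_height_value:
  "on_lattice d (height_value d \<delta>) (\<delta> + height_value d \<delta> * \<gamma> d)"
proof -
  let ?g = "frac (\<gamma> d)" and ?w = "frac (\<delta> + frac (\<gamma> d))"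
  define g w where "g = ?g" and "w = ?w"
  have g: "0 \<le> g" "g < 1" "0 \<le> w" "w < 1" by (auto simp: frac_lt_1 g_def w_def)
  have w: "\<delta> + g - w \<in> \<int>" by (simp add: frac_def g_def w_def)
  note iff = on_lattice_iff[of d "height_value d \<delta>" \<delta>, folded g_def]
  show ?thesis
  proof (cases "w < g")
    case True
    then have h: "height_value d \<delta> = 1 - w / g" by (simp add: height_value_def Let_def g_def w_def)
    have "(1 - w / g) * g = g - w" using True g(3) by (simp add: field_simps)
    then have "\<delta> + height_value d \<delta> * g = \<delta> + g - w" unfolding h by linarith
    then have "\<delta> + height_value d \<delta> * g \<in> \<int>" using w by (simp only:)
    moreover have "0 \<le> height_value d \<delta>" "height_value d \<delta> \<le> 1"
      unfolding h using True g by (simp_all add: divide_le_eq)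
    ultimately show ?thesis unfolding iff by blast
  next
    case False
    then have h: "height_value d \<delta> = (w - g) / (1 - g)" by (simp add: height_value_def Let_def g_def w_def)
    have "(w - g) / (1 - g) * (1 - g) = w - g" using g(2) by simp
    then have "\<delta> - height_value d \<delta> * (1 - g) = \<delta> + g - w" unfolding h by linarith
    then have "\<delta> - height_value d \<delta> * (1 - g) \<in> \<int>" using w by (simp only:)
    moreover have "0 \<le> height_value d \<delta>" "height_value d \<delta> \<le> 1"
      unfolding h using False g by (simp_all add: divide_le_eq)
    ultimately show ?thesis unfolding iff by blast
  qed
qed

text \<open>At a fixed \<open>t\<close> the height determines \<open>\<phi>\<close>, and
  \<open>\<tau>\<close> is then forced by \<open>t = \<mu> * \<tau> + (1 - \<mu>) * \<phi>\<close>;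
  so one recursive call suffices.\<close>

primrec dec :: "nat \<Rightarrow> (nat \<Rightarrow> real) \<Rightarrow> real \<Rightarrow> bool"
  where
    "dec 0 x t \<longleftrightarrow> frac (x 0 - t * of_int a) \<le> t"
  | "dec (Suc d) x t \<longleftrightarrow>
      (let \<tau> = (t - (1 - \<mu> (Suc d)) * height_value (Suc d) (x (Suc d) - t * \<gamma> (Suc d))) / \<mu> (Suc d)
       in dec d (\<lambda>j. x j - (t - \<tau>) * c (Suc d) j) \<tau>)"

lemma dec_cong: "(\<And>j. j \<le> d \<Longrightarrow> x j = y j) \<Longrightarrow> dec d x t \<longleftrightarrow> dec d y t"
proof (induction d arbitrary: x y t)
  case (Suc d)
  have "x (Suc d) = y (Suc d)" using Suc.prems by simp
  then show ?case
    unfolding dec.simps Let_def by (simp only:) (rule Suc.IH, simp add: Suc.prems)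
qed simp

text \<open>Either verdict passes upward through \<open>LE_step_lattice\<close> or
  \<open>GE_step_lattice\<close>, so the one-dimensional test settles it. Only implications can be
  claimed, since at the solution both \<open>LE\<close> and \<open>GE\<close> hold.\<close>

lemma dec_correct:
  assumes "valid d"
  shows "if dec d x t then LE d t x else GE d t x"
  using assms
proof (induction d arbitrary: x t)
  case 0
  define w where "w = frac (x 0 - t * of_int a)"
  define i where "i = \<lfloor>x 0 - t * of_int a\<rfloor>"
  have w: "0 \<le> w" "w < 1" "x 0 = w + t * of_int a + of_int i"
    by (simp_all add: frac_lt_1 w_def) (simp add: frac_def i_def)
  show ?case
  proof (cases "w \<le> t")
    case True
    have "low 0 t x"
    proof (cases "t = 0")
      case t: True
      then show ?thesis
        using True w by (intro lowI[where q = "\<lambda>_. of_int a" and z = "\<lambda>_. of_int i"]) auto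
    next
      case t: False
      then have "0 < t" using True w by simp
      then show ?thesis
        using True w
        by (intro lowI[where q = "\<lambda>_. of_int a + w / t" and z = "\<lambda>_. of_int i"])
          (auto simp: distrib_left)
    qed
    then show ?thesis using True w(1) unfolding dec.simps w_def[symmetric] by (simp add: LE_def)
  next
    case False
    \<comment> \<open>Here \<open>t < w < 1\<close>, so the divisor \<open>1 - t\<close> is positive
      even if \<open>t\<close> is negative.\<close>
    then have "low 0 (1 - t) (\<lambda>j. - x j)"
      using w
      by (intro lowI[where q = "\<lambda>_. of_int a + (1 - w) / (1 - t)" and z = "\<lambda>_. of_int (- i - a - 1)"])
        (auto simp: distrib_left, simp add: algebra_simps)
    then show ?thesis using False w(2) unfolding dec.simps w_def[symmetric] by (simp add: LE_def)
  qed
next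
  case (Suc d)
  note v = valid_Suc[OF \<open>valid (Suc d)\<close>]
  let ?\<phi> = "height_value (Suc d) (x (Suc d) - t * \<gamma> (Suc d))"
  define \<tau> where "\<tau> = (t - (1 - \<mu> (Suc d)) * ?\<phi>) / \<mu> (Suc d)"
  have t: "t = \<mu> (Suc d) * \<tau> + (1 - \<mu> (Suc d)) * ?\<phi>"
    using v by (simp add: \<tau>_def)
  have h: "on_lattice (Suc d) ?\<phi> (x (Suc d) - (t - ?\<phi>) * \<gamma> (Suc d))"
    using on_lattice_height_value[of "Suc d" "x (Suc d) - t * \<gamma> (Suc d)"] by (simp add: algebra_simps)
  have dec: "dec (Suc d) x t \<longleftrightarrow> dec d (\<lambda>j. x j - (t - \<tau>) * c (Suc d) j) \<tau>"
    by (simp add: \<tau>_def Let_def)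
  show ?case
    using Suc.IH[OF v(1), of "\<lambda>j. x j - (t - \<tau>) * c (Suc d) j" \<tau>]
      LE_step_lattice[where x = x and t = t, OF Suc.prems _ h t]
      GE_step_lattice[where x = x and t = t, OF Suc.prems _ h t]
    unfolding dec by presburger
qed

section \<open>The recursive solution\<close>

text \<open>
  As a function of the height, \<open>\<phi>\<close> vanishes at the integers \<open>i\<close> and equals \<open>1\<close> at
  \<open>i + 1 - frac (\<gamma> d)\<close>; the latter height is reached at parameter \<open>switch d g f i\<close>. The solution
  lies in the cell \<open>[i, i + 1]\<close> that is entered at \<open>start_cell\<close> when the parameter increases.
  If \<open>\<gamma> d\<close> is an integer, then \<open>lower_ratio\<close> is \<open>0\<close>: the second piece is a single jump,
  and the result of the second recursive call is irrelevant.
\<close>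

definition start_cell :: "real \<Rightarrow> real \<Rightarrow> int"
  where "start_cell s \<delta> = (if s < 0 then \<lceil>\<delta>\<rceil> - 1 else \<lfloor>\<delta>\<rfloor>)"

definition cell :: "nat \<Rightarrow> (nat \<Rightarrow> real) \<Rightarrow> (nat \<Rightarrow> real) \<Rightarrow> real \<Rightarrow> int"
  where "cell d g f t = start_cell (f d - \<gamma> d) (g d + t * (f d - \<gamma> d))"

definition switch :: "nat \<Rightarrow> (nat \<Rightarrow> real) \<Rightarrow> (nat \<Rightarrow> real) \<Rightarrow> int \<Rightarrow> real"
  where "switch d g f i = (of_int i + 1 - frac (\<gamma> d) - g d) / (f d - \<gamma> d)"

text \<open>At the switch \<open>\<phi> = 1\<close>, which fixes \<open>\<tau>\<close>. This is not
  \<open>height_value\<close> at that height: for integral \<open>\<gamma>\<close> the latter is 0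
  there, and 1 is only its limit from lower heights.\<close>

definition before_switch :: "nat \<Rightarrow> (nat \<Rightarrow> real) \<Rightarrow> (nat \<Rightarrow> real) \<Rightarrow> int \<Rightarrow> bool"
  where "before_switch d g f i \<longleftrightarrow>
    (let t = switch (Suc d) g f i; \<tau> = (t - (1 - \<mu> (Suc d))) / \<mu> (Suc d)
     in dec d (\<lambda>j. g j + t * (f j - c (Suc d) j) + \<tau> * c (Suc d) j) \<tau>)"

text \<open>Selects the piece on which \<open>\<phi>\<close> rises, with heights from
  \<open>i\<close> to \<open>i + 1 - frac \<gamma>\<close>. When the height decreases, this piece
  comes after the switch; when the height is constant, there is no switch and the height is compared
  directly.\<close>

definition upper :: "nat \<Rightarrow> (nat \<Rightarrow> real) \<Rightarrow> (nat \<Rightarrow> real) \<Rightarrow> real \<Rightarrow> int \<Rightarrow> bool"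
  where "upper d g f t i \<longleftrightarrow>
    (if 0 < f (Suc d) - \<gamma> (Suc d) then before_switch d g f i
     else if f (Suc d) - \<gamma> (Suc d) < 0 then \<not> before_switch d g f i
     else g (Suc d) + t * (f (Suc d) - \<gamma> (Suc d)) \<le> of_int i + 1 - frac (\<gamma> (Suc d)))"

definition ratio :: "nat \<Rightarrow> bool \<Rightarrow> real \<Rightarrow> real"
  where "ratio d u h = (if u then upper_ratio d h else lower_ratio d h)"

text \<open>On a piece \<open>\<phi>\<close> is affine in the height and the height is affine in
  \<open>t\<close>. Eliminating both from \<open>t = \<mu> * \<tau> + (1 - \<mu>) * \<phi>\<close>
  gives \<open>t = \<rho> * \<tau> + \<kappa>\<close> with \<open>ratio\<close> as
  \<open>\<rho>\<close> and this value as \<open>\<kappa>\<close>.\<close>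

definition offset :: "nat \<Rightarrow> bool \<Rightarrow> int \<Rightarrow> real \<Rightarrow> real \<Rightarrow> real"
  where "offset d u i y h =
    (if u then (1 - \<mu> d) * (y - of_int i) / (1 - frac (\<gamma> d) - (1 - \<mu> d) * (h - \<gamma> d))
     else (1 - \<mu> d) * (of_int i + 1 - y) / (frac (\<gamma> d) + (1 - \<mu> d) * (h - \<gamma> d)))"

text \<open>In dimension one, the quotients are the least \<open>t \<ge> 0\<close> for which
  \<open>g + t f - t a\<close>, respectively \<open>g + t f - t (a + 1)\<close>, is an integer; the
  former increases with \<open>t\<close>, the latter decreases. In higher dimension, the inner call
  with ratio \<open>\<mu>\<close> and no offset is the line \<open>\<phi> = 0\<close>.\<close>

primrec solve :: "nat \<Rightarrow> (nat \<Rightarrow> real) \<Rightarrow> (nat \<Rightarrow> real) \<Rightarrow> real"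
  where
    "solve 0 g f = min ((of_int \<lceil>g 0\<rceil> - g 0) / (f 0 - of_int a)) (frac (g 0) / (of_int a + 1 - f 0))"
  | "solve (Suc d) g f =
      (let t = \<mu> (Suc d) * solve d g (\<lambda>j. c (Suc d) j + \<mu> (Suc d) * (f j - c (Suc d) j));
           i = cell (Suc d) g f t; u = upper d g f t i;
           \<rho> = ratio (Suc d) u (f (Suc d)); \<kappa> = offset (Suc d) u i (g (Suc d)) (f (Suc d))
       in \<rho> * solve d (\<lambda>j. g j + \<kappa> * (f j - c (Suc d) j)) (\<lambda>j. c (Suc d) j + \<rho> * (f j - c (Suc d) j))
          + \<kappa>)"

lemma solve_cong:
  "(\<And>j. j \<le> d \<Longrightarrow> g j = g' j) \<Longrightarrow> (\<And>j. j \<le> d \<Longrightarrow> f j = f' j) \<Longrightarrow> solve d g f = solve d g' f'"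
proof (induction d arbitrary: g g' f f')
  case (Suc d)
  have IH: "solve d (\<lambda>j. g j + \<kappa> * (f j - c (Suc d) j)) (\<lambda>j. c (Suc d) j + \<rho> * (f j - c (Suc d) j))
      = solve d (\<lambda>j. g' j + \<kappa> * (f' j - c (Suc d) j)) (\<lambda>j. c (Suc d) j + \<rho> * (f' j - c (Suc d) j))"
    for \<rho> \<kappa> by (rule Suc.IH) (simp_all add: Suc.prems)
  have IH0: "solve d g (\<lambda>j. c (Suc d) j + \<rho> * (f j - c (Suc d) j))
      = solve d g' (\<lambda>j. c (Suc d) j + \<rho> * (f' j - c (Suc d) j))" for \<rho>
    by (rule Suc.IH) (simp_all add: Suc.prems)
  have eq: "g (Suc d) = g' (Suc d)" "f (Suc d) = f' (Suc d)" using Suc.prems by simp_all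
  have cell: "cell (Suc d) g f = cell (Suc d) g' f'" by (simp add: cell_def fun_eq_iff eq)
  have switch: "switch (Suc d) g f = switch (Suc d) g' f'" by (simp add: switch_def fun_eq_iff eq)
  have "before_switch d g f i \<longleftrightarrow> before_switch d g' f' i" for i
    unfolding before_switch_def Let_def switch by (rule dec_cong) (simp add: Suc.prems)
  then have upper: "upper d g f = upper d g' f'" by (simp add: upper_def fun_eq_iff eq)
  show ?case unfolding solve.simps Let_def IH IH0 cell upper eq ..
qed simp

definition solution :: "nat \<Rightarrow> (nat \<Rightarrow> real) \<Rightarrow> (nat \<Rightarrow> real) \<Rightarrow> real \<Rightarrow> bool"
  where "solution d g f t \<longleftrightarrow> 0 \<le> t \<and> t \<le> 1 \<and> LE d t (\<lambda>j. g j + t * f j) \<and> GE d t (\<lambda>j. g j + t * f j)"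

lemma solution_step:
  assumes "valid (Suc d)" "0 \<le> \<tau>" "\<tau> \<le> 1"
    and "LE d \<tau> (\<lambda>j. g j + t * (f j - c (Suc d) j) + \<tau> * c (Suc d) j)"
    and "GE d \<tau> (\<lambda>j. g j + t * (f j - c (Suc d) j) + \<tau> * c (Suc d) j)"
    and "on_lattice (Suc d) \<phi> (g (Suc d) + t * (f (Suc d) - \<gamma> (Suc d)) + \<phi> * \<gamma> (Suc d))"
    and t: "t = \<mu> (Suc d) * \<tau> + (1 - \<mu> (Suc d)) * \<phi>"
  shows "solution (Suc d) g f t"
proof -
  note v = valid_Suc[OF assms(1)]
  let ?x = "\<lambda>j. g j + t * f j"
  have x: "(\<lambda>j. g j + t * (f j - c (Suc d) j) + \<tau> * c (Suc d) j) = (\<lambda>j. ?x j - (t - \<tau>) * c (Suc d) j)"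
    by (simp add: algebra_simps)
  have y: "g (Suc d) + t * (f (Suc d) - \<gamma> (Suc d)) + \<phi> * \<gamma> (Suc d)
      = ?x (Suc d) - (t - \<phi>) * \<gamma> (Suc d)"
    by (simp add: algebra_simps)
  have \<phi>: "0 \<le> \<phi>" "\<phi> \<le> 1" using assms(6) by (auto simp: on_lattice_def)
  have "LE (Suc d) t ?x"
    by (rule LE_step_lattice[where x = ?x and t = t, OF assms(1) assms(4)[unfolded x] assms(6)[unfolded y] t])
  moreover have "GE (Suc d) t ?x"
    by (rule GE_step_lattice[where x = ?x and t = t, OF assms(1) _ assms(6)[unfolded y] t])
      (use assms(5) in \<open>simp add: algebra_simps\<close>)
  moreover have "0 \<le> t" unfolding t using v \<phi> assms by simp
  moreover have "t \<le> 1"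
    unfolding t using v \<phi> assms by (intro convex_bound_le) auto
  ultimately show ?thesis by (simp add: solution_def)
qed

text \<open>With \<open>p = f 0 - a\<close> and \<open>r = frac (g 0)\<close>, the second quotient
  is the smaller one when \<open>r \<le> 1 - p\<close>. At the minimum the point sits on a
  translated end of the dilated interval, and an integer end represents it from both sides.\<close>

lemma solve_0:
  assumes "core 0 f"
  shows "solution 0 g f (solve 0 g f)"
proof -
  obtain e where e: "e > 0" "inX 0 (\<lambda>j. f j + e * 1)"
    using assms[unfolded core_def, rule_format, of "\<lambda>_. 1"] by blast
  obtain e' where e': "e' > 0" "inX 0 (\<lambda>j. f j + e' * -1)"
    using assms[unfolded core_def, rule_format, of "\<lambda>_. -1"] by blast
  define r where "r = frac (g 0)"
  define i where "i = \<lfloor>g 0\<rfloor>"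
  have r: "0 \<le> r" "r < 1" "g 0 = of_int i + r" by (simp_all add: r_def i_def frac_lt_1) (simp add: frac_def)
  define p where "p = f 0 - of_int a"
  have f: "0 < p" "p < 1" "f 0 = of_int a + p" using e e' by (auto simp: p_def)
  show ?thesis
  proof (cases "r = 0 \<or> r \<le> 1 - p")
    case True
    \<comment> \<open>For \<open>r = 0\<close> the ceiling is \<open>i\<close> and not
      \<open>i + 1\<close>, so this case is separate; both quotients are 0.\<close>
    have s: "solve 0 g f = r / (1 - p)"
    proof (cases "r = 0")
      case r0: True
      then have "g 0 = of_int i" using r by simp
      then show ?thesis using r0 f by (simp add: r_def)
    next
      case False
      then have "\<lceil>g 0\<rceil> = i + 1" using r by (intro ceiling_unique) auto
      then have "of_int \<lceil>g 0\<rceil> - g 0 = 1 - r" using r by simp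
      moreover have "r / (1 - p) \<le> (1 - r) / p" using True r f False by (simp add: field_simps)
      ultimately show ?thesis by (simp add: f(3) r_def[symmetric])
    qed
    define t where "t = r / (1 - p)"
    have t: "0 \<le> t" "t \<le> 1" "r = t * (1 - p)" using True r f by (auto simp: t_def)
    have x: "g 0 + t * f 0 = t * (of_int a + 1) + of_int i"
      using r f t(3) by (simp add: algebra_simps)
    have "low 0 t (\<lambda>j. g j + t * f j)"
      using x by (intro lowI[where q = "\<lambda>_. of_int a + 1" and z = "\<lambda>_. of_int i"]) auto
    moreover have "low 0 (1 - t) (\<lambda>j. - (g j + t * f j))"
      using x
      by (intro lowI[where q = "\<lambda>_. of_int a + 1" and z = "\<lambda>_. of_int (- i - a - 1)"])
        (auto simp: algebra_simps)
    ultimately show ?thesis unfolding s t_def[symmetric] solution_def LE_def using t by auto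
  next
    case False
    then have rp: "0 < r" "1 - r < p" using r by auto
    then have "\<lceil>g 0\<rceil> = i + 1" using r by (intro ceiling_unique) auto
      then have "of_int \<lceil>g 0\<rceil> - g 0 = 1 - r" using r by simp
    moreover have "(1 - r) / p \<le> r / (1 - p)" using rp r f by (simp add: field_simps)
    ultimately have s: "solve 0 g f = (1 - r) / p" by (simp add: f(3) r_def[symmetric])
    define t where "t = (1 - r) / p"
    have t: "0 \<le> t" "t \<le> 1" "1 - r = t * p" using rp r f by (auto simp: t_def)
    have x: "g 0 + t * f 0 = t * of_int a + of_int (i + 1)"
      using r f t(3) by (simp add: algebra_simps)
    have "low 0 t (\<lambda>j. g j + t * f j)"
      using x by (intro lowI[where q = "\<lambda>_. of_int a" and z = "\<lambda>_. of_int (i + 1)"]) auto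
    moreover have "low 0 (1 - t) (\<lambda>j. - (g j + t * f j))"
      using x
      by (intro lowI[where q = "\<lambda>_. of_int a" and z = "\<lambda>_. of_int (- i - 1 - a)"])
        (auto simp: algebra_simps)
    ultimately show ?thesis unfolding s t_def[symmetric] solution_def LE_def using t by auto
  qed
qed

text \<open>The second call returns the solution on the full line extending the chosen piece. The
  point is that its height lies within the piece, so that the \<open>\<phi>\<close> used in the
  elimination is in \<open>[0, 1]\<close> and \<open>step\<close> applies. Both ends of the piece
  belong to that line, and a verdict known there is compared with the solution by
  \<open>LE_GE_separation\<close>.\<close>

lemma solve_Suc:
  assumes valid: "valid (Suc d)" and core: "core (Suc d) f"
    and IH: "\<And>g f. core d f \<Longrightarrow> solution d g f (solve d g f)"
  shows "solution (Suc d) g f (solve (Suc d) g f)"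
proof -
  note v = valid_Suc[OF valid]
  define m G lam y where "m = \<mu> (Suc d)" and "G = frac (\<gamma> (Suc d))"
    and "lam = f (Suc d) - \<gamma> (Suc d)" and "y = g (Suc d)"
  define C where "C = c (Suc d)"
  define xx where "xx t \<tau> = (\<lambda>j. g j + t * (f j - C j) + \<tau> * C j)" for t \<tau>
  have m: "0 < m" "m < 1" using v by (auto simp: m_def)
  have G: "0 \<le> G" "G < 1" by (auto simp: G_def frac_lt_1)
  have h: "(1 - m) * lam < 1 - G" "- G < (1 - m) * lam"
    using core_height[OF valid core] by (auto simp: m_def lam_def G_def)
  have step: "solution (Suc d) g f t"
    if "0 \<le> \<tau>" "\<tau> \<le> 1" "LE d \<tau> (xx t \<tau>)" "GE d \<tau> (xx t \<tau>)"
      "0 \<le> \<phi>" "\<phi> \<le> 1" "y + t * lam + \<phi> * G \<in> \<int> \<or> y + t * lam - \<phi> * (1 - G) \<in> \<int>"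
      "t = m * \<tau> + (1 - m) * \<phi>" for t \<tau> \<phi>
    using that unfolding xx_def C_def G_def lam_def m_def y_def
    by (intro solution_step[OF valid, where \<tau> = \<tau> and \<phi> = \<phi>]) (simp_all add: on_lattice_iff)

  define f0 where "f0 = (\<lambda>j. C j + m * (f j - C j))"
  define \<tau>0 where "\<tau>0 = solve d g f0"
  define t0 where "t0 = m * \<tau>0"
  define i where "i = cell (Suc d) g f t0"
  define u where "u = upper d g f t0 i"
  define \<rho> where "\<rho> = ratio (Suc d) u (f (Suc d))"
  define \<kappa> where "\<kappa> = offset (Suc d) u i y (f (Suc d))"
  define f2 where "f2 = (\<lambda>j. C j + \<rho> * (f j - C j))"
  define g2 where "g2 = (\<lambda>j. g j + \<kappa> * (f j - C j))"
  define \<tau>2 where "\<tau>2 = solve d g2 f2"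
  define t2 where "t2 = \<rho> * \<tau>2 + \<kappa>"
  have solve: "solve (Suc d) g f = t2"
    unfolding t2_def \<tau>2_def g2_def f2_def \<kappa>_def \<rho>_def u_def i_def t0_def \<tau>0_def f0_def C_def m_def y_def
    by (simp add: Let_def)

  have line: "xx (\<rho> * \<tau> + \<kappa>) \<tau> = (\<lambda>j. g2 j + \<tau> * f2 j)" for \<tau>
    by (simp add: xx_def g2_def f2_def algebra_simps)
  have line0: "xx (m * \<tau>) \<tau> = (\<lambda>j. g j + \<tau> * f0 j)" for \<tau>
    by (simp add: xx_def f0_def algebra_simps)

  have core0: "core d f0"
    using core_slices(1)[OF valid core] by (simp add: f0_def C_def m_def)
  have sol0: "0 \<le> \<tau>0" "\<tau>0 \<le> 1" "LE d \<tau>0 (\<lambda>j. g j + \<tau>0 * f0 j)" "GE d \<tau>0 (\<lambda>j. g j + \<tau>0 * f0 j)"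
    using IH[OF core0, of g] by (auto simp: solution_def \<tau>0_def)
  have t0: "0 \<le> t0" "\<tau>0 = t0 / m" using sol0 m by (auto simp: t0_def)
  \<comment> \<open>On the line \<open>\<phi> = 0\<close>, where \<open>\<tau> = t / m\<close>,
    monotonicity extends the verdicts at \<open>t0\<close> to all larger, respectively smaller,
    parameters.\<close>
  have LE0: "LE d (t / m) (xx t (t / m))" if "t0 \<le> t" for t
  proof -
    have "\<tau>0 \<le> t / m" using that t0 m by (simp add: divide_right_mono)
    from LE_mono[OF sol0(3) core_inX[OF core0] this] show ?thesis
      using line0[of "t / m"] m by simp
  qed
  have GE0: "GE d (t / m) (xx t (t / m))" if "t \<le> t0" for t
  proof -
    have "t / m \<le> \<tau>0" using that t0 m by (simp add: divide_right_mono)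
    from GE_mono[OF sol0(4) core_inX[OF core0] this] show ?thesis
      using line0[of "t / m"] m by simp
  qed

  define tb where "tb = switch (Suc d) g f i"
  define \<tau>b where "\<tau>b = (tb - (1 - m)) / m"
  define ts where "ts k = (k - y) / lam" for k :: real
  have tb: "lam \<noteq> 0 \<Longrightarrow> lam * tb = of_int i + 1 - G - y" "m * \<tau>b = tb - (1 - m)"
    using m by (auto simp: tb_def switch_def \<tau>b_def G_def lam_def y_def)
  have ts: "lam \<noteq> 0 \<Longrightarrow> lam * ts k = k - y" for k by (simp add: ts_def)
  have bs: "if before_switch d g f i then LE d \<tau>b (xx tb \<tau>b) else GE d \<tau>b (xx tb \<tau>b)"
  proof -
    have "before_switch d g f i = dec d (xx tb \<tau>b) \<tau>b"
      by (simp add: before_switch_def Let_def xx_def tb_def \<tau>b_def C_def m_def)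
    with dec_correct[OF v(1), of "xx tb \<tau>b" \<tau>b] show ?thesis by simp
  qed

  have \<rho>u: "\<rho> = m * (1 - G) / (1 - G - (1 - m) * lam)"
    "\<kappa> = (1 - m) * (y - of_int i) / (1 - G - (1 - m) * lam)" if u
    using that by (auto simp: \<rho>_def \<kappa>_def ratio_def offset_def upper_ratio_def m_def G_def lam_def)
  have \<rho>l: "\<rho> = m * G / (G + (1 - m) * lam)"
    "\<kappa> = (1 - m) * (of_int i + 1 - y) / (G + (1 - m) * lam)" if "\<not> u"
    using that by (auto simp: \<rho>_def \<kappa>_def ratio_def offset_def lower_ratio_def m_def G_def lam_def)

  have i_pos: "ts (of_int i) \<le> t0" "t0 \<le> ts (of_int i + 1)" if "lam > 0"
  proof -
    have "i = \<lfloor>y + t0 * lam\<rfloor>" using that by (simp add: i_def cell_def start_cell_def lam_def y_def)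
    then have "of_int i \<le> y + t0 * lam" "y + t0 * lam \<le> of_int i + 1" by linarith+
    then show "ts (of_int i) \<le> t0" "t0 \<le> ts (of_int i + 1)"
      using that by (simp_all add: ts_def field_simps)
  qed
  have i_neg: "t0 \<le> ts (of_int i)" "ts (of_int i + 1) \<le> t0" if "lam < 0"
  proof -
    have "i = \<lceil>y + t0 * lam\<rceil> - 1" using that by (simp add: i_def cell_def start_cell_def lam_def y_def)
    then have "of_int i \<le> y + t0 * lam" "y + t0 * lam \<le> of_int i + 1" by linarith+
    then show "t0 \<le> ts (of_int i)" "ts (of_int i + 1) \<le> t0"
      using that by (simp_all add: ts_def field_simps)
  qed

  show ?thesis
  proof (cases "u \<or> 0 < G")
    case True
    have \<rho>: "0 < \<rho>" "core d f2"
      using core_slices(2-5)[OF valid core] True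
      by (cases u; force simp: \<rho>_def ratio_def f2_def C_def G_def)+
    have sol2: "0 \<le> \<tau>2" "\<tau>2 \<le> 1" "LE d \<tau>2 (\<lambda>j. g2 j + \<tau>2 * f2 j)" "GE d \<tau>2 (\<lambda>j. g2 j + \<tau>2 * f2 j)"
      using IH[OF \<rho>(2), of g2] by (auto simp: solution_def \<tau>2_def)
    \<comment> \<open>A verdict at any point of the line of the piece places \<open>t2\<close> on
      one side of it; \<open>\<rho> > 0\<close> transfers the order from \<open>\<tau>\<close> to
      \<open>t\<close>.\<close>
    have below: "t2 \<le> t" if "LE d \<tau> (xx t \<tau>)" "t = \<rho> * \<tau> + \<kappa>" for t \<tau>
    proof -
      have "0 \<le> \<tau>" using that(1) by (auto simp: LE_def)
      with LE_GE_separation[OF v(1) \<rho>(2) that(1)[unfolded that(2) line] sol2(4)] sol2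
      have "\<tau>2 \<le> \<tau>" by simp
      then show ?thesis unfolding t2_def that(2) using \<rho> by simp
    qed
    have above: "t \<le> t2" if "GE d \<tau> (xx t \<tau>)" "t = \<rho> * \<tau> + \<kappa>" for t \<tau>
    proof -
      have "\<tau> \<le> 1" using that(1) by (auto simp: LE_def)
      with LE_GE_separation[OF v(1) \<rho>(2) sol2(3) that(1)[unfolded that(2) line]] sol2
      have "\<tau> \<le> \<tau>2" by simp
      then show ?thesis unfolding t2_def that(2) using \<rho> by simp
    qed
    have xx2: "LE d \<tau>2 (xx t2 \<tau>2)" "GE d \<tau>2 (xx t2 \<tau>2)"
      using sol2 unfolding t2_def line by blast+
    show ?thesis
    proof (cases u)
      case u: True
      define D where "D = 1 - G - (1 - m) * lam"
      have D: "0 < D" "D * \<rho> = m * (1 - G)" "D * \<kappa> = (1 - m) * (y - of_int i)"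
        using h \<rho>u[OF u] by (auto simp: D_def)
      have on_line: "t = \<rho> * \<tau> + \<kappa>"
        if "(1 - G) * (m * \<tau>) + (1 - m) * (y - of_int i) = D * t" for t \<tau>
      proof -
        have "D * (\<rho> * \<tau> + \<kappa>) = (D * \<rho>) * \<tau> + D * \<kappa>" by (simp add: algebra_simps)
        also have "\<dots> = D * t" unfolding D(2,3) that[symmetric] by (simp add: algebra_simps)
        finally have "D * (\<rho> * \<tau> + \<kappa>) = D * t" .
        then show ?thesis using D(1) by simp
      qed
      \<comment> \<open>The point decided by \<open>before_switch\<close> belongs to the line of
        either piece, since both pieces have \<open>\<phi> = 1\<close> there.\<close>
      have line_b: "tb = \<rho> * \<tau>b + \<kappa>" if "lam \<noteq> 0"
      proof (rule on_line)
        have y: "y = of_int i + 1 - G - lam * tb" using tb(1)[OF that] by simp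
        show "(1 - G) * (m * \<tau>b) + (1 - m) * (y - of_int i) = D * tb"
          unfolding tb(2) D_def y by (simp add: algebra_simps)
      qed
      \<comment> \<open>At height \<open>i\<close> the rising piece has \<open>\<phi> = 0\<close>,
        so its line meets the line \<open>\<phi> = 0\<close>; this is how \<open>t0\<close> bounds
        \<open>t2\<close>.\<close>
      have line_i: "ts (of_int i) = \<rho> * (ts (of_int i) / m) + \<kappa>" if "lam \<noteq> 0"
      proof (rule on_line)
        define t where "t = ts (of_int i)"
        have y: "y = of_int i - lam * t" using ts[OF that, of "of_int i"] by (simp add: t_def)
        have "m * (t / m) = t" using m by simp
        then show "(1 - G) * (m * (ts (of_int i) / m)) + (1 - m) * (y - of_int i) = D * ts (of_int i)"
          unfolding t_def[symmetric] D_def y by (simp add: algebra_simps)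
      qed
      define \<phi> where "\<phi> = (y + t2 * lam - of_int i) / (1 - G)"
      have \<phi>: "\<phi> * (1 - G) = y + t2 * lam - of_int i" using G by (simp add: \<phi>_def)
      have "of_int i \<le> y + t2 * lam \<and> y + t2 * lam \<le> of_int i + 1 - G"
      proof (cases lam "0 :: real" rule: linorder_cases)
        case greater
        then have "before_switch d g f i" using u by (simp add: u_def upper_def lam_def)
        then have "t2 \<le> tb" using bs line_b greater by (intro below) auto
        moreover have "ts (of_int i) \<le> t2"
          using greater by (intro above[OF GE0[OF i_pos(1)]] line_i) auto
        ultimately have "lam * ts (of_int i) \<le> lam * t2" "lam * t2 \<le> lam * tb" using greater by auto
        then show ?thesis using greater tb(1) ts[of "of_int i"] by (simp add: mult.commute)
      next
        case less
        then have "\<not> before_switch d g f i" using u by (simp add: u_def upper_def lam_def)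
        then have "tb \<le> t2" using bs line_b less by (intro above) auto
        moreover have "t2 \<le> ts (of_int i)"
          using less by (intro below[OF LE0[OF i_neg(1)]] line_i) auto
        ultimately have "lam * ts (of_int i) \<le> lam * t2" "lam * t2 \<le> lam * tb" using less by auto
        then show ?thesis using less tb(1) ts[of "of_int i"] by (simp add: mult.commute)
      next
        case equal
        then have "i = \<lfloor>y\<rfloor>" by (simp add: i_def cell_def start_cell_def lam_def y_def)
        moreover have "y \<le> of_int i + 1 - G"
          using u equal by (simp add: u_def upper_def lam_def y_def G_def)
        ultimately show ?thesis using equal by auto
      qed
      then have \<phi>01: "0 \<le> \<phi>" "\<phi> \<le> 1" using G unfolding \<phi>_def by auto
      have "(1 - G) * t2 = (1 - G) * (m * \<tau>2 + (1 - m) * \<phi>)"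
      proof -
        have "D * t2 = m * (1 - G) * \<tau>2 + (1 - m) * (y - of_int i)"
          unfolding t2_def distrib_left D(3)[symmetric] D(2)[symmetric] by simp
        then have "(1 - G) * t2 = m * (1 - G) * \<tau>2 + (1 - m) * (\<phi> * (1 - G))"
          unfolding \<phi> D_def by (simp add: algebra_simps)
        then show ?thesis by (simp add: algebra_simps)
      qed
      then have "t2 = m * \<tau>2 + (1 - m) * \<phi>" using G by simp
      moreover have "y + t2 * lam - \<phi> * (1 - G) \<in> \<int>" unfolding \<phi> by simp
      ultimately show ?thesis
        unfolding solve using step[OF sol2(1,2) xx2 \<phi>01] by blast
    next
      case u: False
      then have G0: "0 < G" using True by simp
      define D where "D = G + (1 - m) * lam"
      have D: "0 < D" "D * \<rho> = m * G" "D * \<kappa> = (1 - m) * (of_int i + 1 - y)"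
        using h \<rho>l[OF u] by (auto simp: D_def)
      have on_line: "t = \<rho> * \<tau> + \<kappa>"
        if "G * (m * \<tau>) + (1 - m) * (of_int i + 1 - y) = D * t" for t \<tau>
      proof -
        have "D * (\<rho> * \<tau> + \<kappa>) = (D * \<rho>) * \<tau> + D * \<kappa>" by (simp add: algebra_simps)
        also have "\<dots> = D * t" unfolding D(2,3) that[symmetric] by (simp add: algebra_simps)
        finally have "D * (\<rho> * \<tau> + \<kappa>) = D * t" .
        then show ?thesis using D(1) by simp
      qed
      have line_b: "tb = \<rho> * \<tau>b + \<kappa>" if "lam \<noteq> 0"
      proof (rule on_line)
        have y: "y = of_int i + 1 - G - lam * tb" using tb(1)[OF that] by simp
        show "G * (m * \<tau>b) + (1 - m) * (of_int i + 1 - y) = D * tb"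
          unfolding tb(2) D_def y by (simp add: algebra_simps)
      qed
      \<comment> \<open>The falling piece has \<open>\<phi> = 0\<close> at its other end, height
        \<open>i + 1\<close>.\<close>
      have line_i: "ts (of_int i + 1) = \<rho> * (ts (of_int i + 1) / m) + \<kappa>" if "lam \<noteq> 0"
      proof (rule on_line)
        define t where "t = ts (of_int i + 1)"
        have y: "y = of_int i + 1 - lam * t" using ts[OF that, of "of_int i + 1"] by (simp add: t_def)
        have "m * (t / m) = t" using m by simp
        then show "G * (m * (ts (of_int i + 1) / m)) + (1 - m) * (of_int i + 1 - y) = D * ts (of_int i + 1)"
          unfolding t_def[symmetric] D_def y by (simp add: algebra_simps)
      qed
      define \<phi> where "\<phi> = (of_int i + 1 - (y + t2 * lam)) / G"
      have \<phi>: "\<phi> * G = of_int i + 1 - (y + t2 * lam)" using G0 by (simp add: \<phi>_def)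
      have "of_int i + 1 - G \<le> y + t2 * lam \<and> y + t2 * lam \<le> of_int i + 1"
      proof (cases lam "0 :: real" rule: linorder_cases)
        case greater
        then have "\<not> before_switch d g f i" using u by (simp add: u_def upper_def lam_def)
        then have "tb \<le> t2" using bs line_b greater by (intro above) auto
        moreover have "t2 \<le> ts (of_int i + 1)"
          using greater by (intro below[OF LE0[OF i_pos(2)]] line_i) auto
        ultimately have "lam * tb \<le> lam * t2" "lam * t2 \<le> lam * ts (of_int i + 1)" using greater by auto
        then show ?thesis using greater tb(1) ts[of "of_int i + 1"] by (simp add: mult.commute)
      next
        case less
        then have "before_switch d g f i" using u by (simp add: u_def upper_def lam_def)
        then have "t2 \<le> tb" using bs line_b less by (intro below) auto
        moreover have "ts (of_int i + 1) \<le> t2"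
          using less by (intro above[OF GE0[OF i_neg(2)]] line_i) auto
        ultimately have "lam * tb \<le> lam * t2" "lam * t2 \<le> lam * ts (of_int i + 1)" using less by auto
        then show ?thesis using less tb(1) ts[of "of_int i + 1"] by (simp add: mult.commute)
      next
        case equal
        then have "i = \<lfloor>y\<rfloor>" by (simp add: i_def cell_def start_cell_def lam_def y_def)
        moreover have "of_int i + 1 - G < y"
          using u equal by (simp add: u_def upper_def lam_def y_def G_def)
        ultimately show ?thesis using equal by auto
      qed
      then have \<phi>01: "0 \<le> \<phi>" "\<phi> \<le> 1" using G0 unfolding \<phi>_def by auto
      have "G * t2 = G * (m * \<tau>2 + (1 - m) * \<phi>)"
      proof -
        have "D * t2 = m * G * \<tau>2 + (1 - m) * (of_int i + 1 - y)"
          unfolding t2_def distrib_left D(3)[symmetric] D(2)[symmetric] by simp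
        then have "G * t2 = m * G * \<tau>2 + (1 - m) * (\<phi> * G)"
          unfolding \<phi> D_def by (simp add: algebra_simps)
        then show ?thesis by (simp add: algebra_simps)
      qed
      then have "t2 = m * \<tau>2 + (1 - m) * \<phi>" using G0 by simp
      moreover have "y + t2 * lam + \<phi> * G = of_int (i + 1)" unfolding \<phi> by simp
      then have "y + t2 * lam + \<phi> * G \<in> \<int>" by (simp only: Ints_of_int)
      ultimately show ?thesis
        unfolding solve using step[OF sol2(1,2) xx2 \<phi>01] by blast
    qed
  next
    case False
    \<comment> \<open>The falling piece has shrunk to a jump at the integral height
      \<open>i + 1\<close>, where \<open>\<phi> = 0\<close> and \<open>\<phi> = 1\<close> are both
      on the lattice. The comparison with \<open>t0\<close> uses \<open>\<phi> = 0\<close> and gives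
      \<open>LE\<close>; the decision at the switch uses \<open>\<phi> = 1\<close> and gives
      \<open>GE\<close>.\<close>
    then have u: "\<not> u" and G0: "G = 0" using G by auto
    have lam: "0 < lam" using h(2) m G0 by (simp add: zero_less_mult_iff)
    have "t2 = ts (of_int i + 1)" using \<rho>l[OF u] G0 m lam by (simp add: t2_def ts_def)
    moreover have "lam * tb = lam * ts (of_int i + 1)" using tb(1) ts lam G0 by simp
    then have "tb = ts (of_int i + 1)" using lam by simp
    moreover have "\<not> before_switch d g f i" using u lam by (simp add: u_def upper_def lam_def)
    ultimately have tb2: "t2 = tb" and gb: "GE d \<tau>b (xx t2 \<tau>b)" and t02: "t0 \<le> t2"
      using bs i_pos(2)[OF lam] by auto
    have int: "y + t2 * lam = of_int (i + 1)" using tb(1) lam G0 tb2 by (simp add: algebra_simps)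
    have "LE (Suc d) t2 (\<lambda>j. g j + t2 * f j)"
    proof (rule LE_step_lattice[OF valid, of "t2 / m" _ _ 0])
      have "xx t2 (t2 / m) = (\<lambda>j. g j + t2 * f j - (t2 - t2 / m) * c (Suc d) j)"
        by (simp add: xx_def C_def algebra_simps)
      then show "LE d (t2 / m) (\<lambda>j. g j + t2 * f j - (t2 - t2 / m) * c (Suc d) j)"
        using LE0[OF t02] by simp
      show "on_lattice (Suc d) 0 (g (Suc d) + t2 * f (Suc d) - (t2 - 0) * \<gamma> (Suc d))"
        using int on_lattice_iff[of "Suc d" 0 "y + t2 * lam"]
        by (simp add: y_def lam_def algebra_simps)
    qed (use m in \<open>simp add: m_def\<close>)
    moreover have "GE (Suc d) t2 (\<lambda>j. g j + t2 * f j)"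
    proof (rule GE_step_lattice[OF valid, of \<tau>b _ _ 1])
      show "GE d \<tau>b (\<lambda>j. g j + t2 * f j - (t2 - \<tau>b) * c (Suc d) j)"
        using gb by (simp add: xx_def C_def algebra_simps)
      show "on_lattice (Suc d) 1 (g (Suc d) + t2 * f (Suc d) - (t2 - 1) * \<gamma> (Suc d))"
        using int on_lattice_iff[of "Suc d" 1 "y + t2 * lam"] G0
        by (simp add: y_def lam_def G_def algebra_simps)
      show "t2 = \<mu> (Suc d) * \<tau>b + (1 - \<mu> (Suc d)) * 1" using tb(2) tb2 by (simp add: m_def)
    qed
    moreover have "t2 \<le> 1"
    proof -
      have "\<tau>b \<le> 1" using gb by (auto simp: LE_def)
      then have "m * \<tau>b \<le> m" using m by simp
      then show ?thesis using tb(2) tb2 by simp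
    qed
    ultimately show ?thesis unfolding solve solution_def using t0 t02 by auto
  qed
qed

lemma solve_correct: "valid d \<Longrightarrow> core d f \<Longrightarrow> solution d g f (solve d g f)"
proof (induction d arbitrary: g f)
  case 0
  from 0(2) show ?case by (rule solve_0)
next
  case (Suc d)
  show ?case
    by (rule solve_Suc[OF Suc.prems Suc.IH[OF valid_Suc(1)[OF Suc.prems(1)]]])
qed

section \<open>Trivial liftings\<close>

lemma convex_inX: "convex {x \<in> Rn (Suc d). inX d x}"
proof (rule convexI)
  fix x y :: "nat \<Rightarrow> real" and u v :: real
  assume *: "x \<in> {x \<in> Rn (Suc d). inX d x}" "y \<in> {x \<in> Rn (Suc d). inX d x}"
    "0 \<le> u" "0 \<le> v" "u + v = 1"
  then have "inX d (\<lambda>j. u * x j + v * y j)" by (intro inX_convex) auto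
  moreover have "u *\<^sub>R x + v *\<^sub>R y = (\<lambda>j. u * x j + v * y j)" by (simp add: fun_eq_iff)
  ultimately show "u *\<^sub>R x + v *\<^sub>R y \<in> {x \<in> Rn (Suc d). inX d x}"
    using * by (simp add: topspace_Euclidean_space)
qed

text \<open>Both generating sets are convex, so a point of the hull needs only one point from each;
  \<open>inX\<close> is written in this form.\<close>

lemma cross_step_eq:
  assumes "c (Suc d) \<in> Rn (Suc d)" "inX d (c (Suc d))"
  shows "cross_step (Suc d) {x \<in> Rn (Suc d). inX d x} (c (Suc d)) (\<gamma> (Suc d)) (\<mu> (Suc d))
    = {x \<in> Rn (Suc (Suc d)). inX (Suc d) x}"
proof
  let ?C = "c (Suc d)" and ?g = "\<gamma> (Suc d)" and ?m = "\<mu> (Suc d)"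
  let ?k = "real_of_int \<lfloor>?g\<rfloor>"
  let ?P = "\<lambda>b. ((1 / ?m) *\<^sub>R (b - ?C) + ?C)(Suc d := ?g)"
  let ?Q = "\<lambda>i. ?C(Suc d := (1 / (1 - ?m)) * (i - ?g) + ?g)"
  let ?S = "?P ` {x \<in> Rn (Suc d). inX d x} \<union> ?Q ` {?k .. ?k + 1}"
  have eq: "cross_step (Suc d) {x \<in> Rn (Suc d). inX d x} ?C ?g ?m = convex hull ?S"
    by (simp add: cross_step_def)
  have C: "?C j = 0" if "Suc d \<le> j" for j
    using assms(1) that by (simp add: topspace_Euclidean_space)
  have "?P b \<in> Rn (Suc (Suc d)) \<and> inX (Suc d) (?P b)" if "b \<in> Rn (Suc d)" "inX d b" for b
    unfolding inX.simps(2) using that C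
    by (intro conjI exI[of _ "1::real"] exI[of _ b] exI[of _ ?k]) (auto simp: topspace_Euclidean_space)
  moreover have "?Q i \<in> Rn (Suc (Suc d)) \<and> inX (Suc d) (?Q i)" if "?k \<le> i" "i \<le> ?k + 1" for i
    unfolding inX.simps(2) using that C assms(2)
    by (intro conjI exI[of _ "0::real"] exI[of _ ?C] exI[of _ i]) (auto simp: topspace_Euclidean_space)
  ultimately have "?S \<subseteq> {x \<in> Rn (Suc (Suc d)). inX (Suc d) x}" by auto
  with convex_inX show "cross_step (Suc d) {x \<in> Rn (Suc d). inX d x} ?C ?g ?m
    \<subseteq> {x \<in> Rn (Suc (Suc d)). inX (Suc d) x}"
    unfolding eq by (simp add: hull_minimal)
  show "{x \<in> Rn (Suc (Suc d)). inX (Suc d) x}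
    \<subseteq> cross_step (Suc d) {x \<in> Rn (Suc d). inX d x} ?C ?g ?m"
    unfolding eq
  proof
    fix x assume "x \<in> {x \<in> Rn (Suc (Suc d)). inX (Suc d) x}"
    then obtain t b i where 1: "0 \<le> t" "t \<le> 1" "inX d b" "?k \<le> i" "i \<le> ?k + 1"
      "\<And>j. j \<le> d \<Longrightarrow> x j = ?C j + t / ?m * (b j - ?C j)"
      "x (Suc d) = ?g + (1 - t) / (1 - ?m) * (i - ?g)" "x \<in> Rn (Suc (Suc d))"
      unfolding inX.simps(2) by blast
    \<comment> \<open>\<open>inX\<close> ignores the coordinates beyond \<open>d\<close>, whereas a
      member of \<open>Rn (Suc d)\<close> must vanish there.\<close>
    define b' where "b' j = (if j \<le> d then b j else 0)" for j
    have "inX d b'" using 1(3) inX_cong[of d b' b] by (simp add: b'_def)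
    moreover have "b' \<in> Rn (Suc d)" by (simp add: b'_def topspace_Euclidean_space)
    ultimately have "?P b' \<in> convex hull ?S" by (intro hull_inc) blast
    moreover have "?Q i \<in> convex hull ?S" using 1 by (intro hull_inc) auto
    ultimately have "t *\<^sub>R ?P b' + (1 - t) *\<^sub>R ?Q i \<in> convex hull ?S"
      using 1 by (intro convexD[OF convex_convex_hull]) auto
    moreover have "x j = (t *\<^sub>R ?P b' + (1 - t) *\<^sub>R ?Q i) j" for j
    proof -
      consider "j \<le> d" | "j = Suc d" | "Suc (Suc d) \<le> j" by linarith
      then show ?thesis
      proof cases
        case 1
        then show ?thesis using \<open>\<And>j. j \<le> d \<Longrightarrow> x j = _ j\<close>
          by (simp add: b'_def algebra_simps add_divide_distrib diff_divide_distrib)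
      next
        case 2
        then show ?thesis using \<open>x (Suc d) = _\<close>
          by (simp add: algebra_simps add_divide_distrib diff_divide_distrib)
      next
        case 3
        then show ?thesis using \<open>x \<in> Rn (Suc (Suc d))\<close> C
          by (auto simp: b'_def topspace_Euclidean_space)
      qed
    qed
    then have "x = t *\<^sub>R ?P b' + (1 - t) *\<^sub>R ?Q i" by (rule ext)
    ultimately show "x \<in> convex hull ?S" by (simp only:)
  qed
qed

lemma gen_cross_polytope_inX:
  assumes "gen_cross_polytope a c \<gamma> \<mu> n X"
  obtains d where "n = Suc d" "valid d" "X = {x \<in> Rn (Suc d). inX d x}"
proof -
  have "\<exists>d. n = Suc d \<and> valid d \<and> X = {x \<in> Rn (Suc d). inX d x}"
    using assms
  proof induction
    case base
    show ?case by (intro exI[of _ 0]) (auto simp: valid_def)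
  next
    case (step n B)
    then obtain d where d: "n = Suc d" "valid d" "B = {x \<in> Rn (Suc d). inX d x}" by blast
    then have "valid (Suc d)" using step.hyps by (auto simp: valid_def less_Suc_eq)
    then show ?case using cross_step_eq[of d] d step.hyps by auto
  qed
  with that show thesis by blast
qed

lemma trivial_lifting_eq_solution:
  assumes "valid d" "core d f" and sol: "solution d p f t"
    and d: "d < n" and p: "p \<in> Rn n"
    and B: "\<And>x. x \<in> Rn n \<Longrightarrow> x \<in> B \<longleftrightarrow> inX d (\<lambda>j. x j + f j)"
  shows "trivial_lifting n B p = t"
proof -
  have sol: "0 \<le> t" "t \<le> 1" "LE d t (\<lambda>j. p j + t * f j)" "GE d t (\<lambda>j. p j + t * f j)"
    using sol by (auto simp: solution_def)
  define S where "S z = {r. r > 0 \<and> (1 / r) *\<^sub>R (p + z) \<in> B}" for z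
  have S: "r \<in> S z \<longleftrightarrow> r > 0 \<and> inX d (\<lambda>j. (p j + z j) / r + f j)" if "z \<in> Zn n" for r z
  proof -
    have "(1 / r) *\<^sub>R (p + z) \<in> Rn n" using p that by (auto simp: Zn_def topspace_Euclidean_space)
    from B[OF this] show ?thesis by (simp add: S_def)
  qed
  have lower: "t \<le> r" if "z \<in> Zn n" "r \<in> S z" for r z
  proof -
    have r: "r > 0" "inX d (\<lambda>j. (p j + z j) / r + f j)" using S that by blast+
    have "low d r (\<lambda>j. p j + r * f j)"
      by (rule lowI[OF r(2), where z = "\<lambda>j. - z j"])
        (use that(1) d r in \<open>auto simp: Zn_def field_simps\<close>)
    then have "LE d r (\<lambda>j. p j + r * f j)" using r by (simp add: LE_def)
    from LE_GE_separation[OF assms(1,2) this sol(4)] r sol show ?thesis by simp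
  qed
  have bdd: "bdd_below (S z)" if "z \<in> Zn n" for z using lower[OF that] by (rule bdd_belowI)
  have gauge: "t \<le> gauge_function B (p + z)" if z: "z \<in> Zn n" for z
  proof -
    obtain e where "e > 0" "inX d (\<lambda>j. f j + e * (p j + z j))"
      using assms(2)[unfolded core_def, rule_format, of "\<lambda>j. p j + z j"] by blast
    then have "1 / e \<in> S z" by (subst S[OF z]) (simp add: algebra_simps)
    then have "S z \<noteq> {}" by blast
    from cInf_greatest[OF this lower[OF z]] show ?thesis by (simp add: gauge_function_def S_def)
  qed
  have "(\<lambda>_. 0) \<in> Zn n" by (simp add: Zn_def topspace_Euclidean_space)
  then have Zn: "Zn n \<noteq> {}" by blast
  have INF: "t \<le> (INF z\<in>Zn n. gauge_function B (p + z))"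
    using gauge by (intro cINF_greatest[OF Zn])
  show ?thesis
  proof (cases "t = 1")
    case True
    then show ?thesis using INF by (simp add: trivial_lifting_def)
  next
    case False
    then have "low d t (\<lambda>j. p j + t * f j)" using sol by (simp add: LE_def)
    then obtain q z where q: "inX d q" "\<And>j. j \<le> d \<Longrightarrow> z j \<in> \<int>"
      "\<And>j. j \<le> d \<Longrightarrow> p j + t * f j = t * q j + z j"
      unfolding low_def by blast
    define w where "w j = (if j \<le> d then - z j else 0)" for j
    have w: "w \<in> Zn n" using q d by (auto simp: w_def Zn_def topspace_Euclidean_space)
    \<comment> \<open>As \<open>t\<close> may be 0, the gauge is bounded through all
      \<open>r > t\<close>; the missing weight \<open>1 - t / r\<close> goes to
      \<open>f\<close>.\<close>
    have "gauge_function B (p + w) \<le> r" if "t < r" for r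
    proof -
      have r: "r > 0" using that sol by simp
      have "inX d (\<lambda>j. (t / r) * q j + (1 - t / r) * f j)"
        using that r sol by (intro inX_convex[OF q(1) core_inX[OF assms(2)]]) auto
      moreover have "(t / r) * q j + (1 - t / r) * f j = (p j + w j) / r + f j" if "j \<le> d" for j
        using q(3)[OF that] r that by (simp add: w_def field_simps)
      ultimately have "r \<in> S w"
        using r unfolding S[OF w] by (auto intro: inX_cong[THEN iffD1, rotated])
      from cInf_lower[OF this bdd[OF w]] show ?thesis by (simp add: gauge_function_def S_def)
    qed
    then have "gauge_function B (p + w) \<le> t" by (rule dense_ge)
    moreover have "(INF z\<in>Zn n. gauge_function B (p + z)) \<le> gauge_function B (p + w)"
      using gauge w by (intro cINF_lower bdd_belowI2[where m = t]) auto
    ultimately show ?thesis using INF sol by (simp add: trivial_lifting_def)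
  qed
qed

text \<open>All right-hand sides are 1, so the origin satisfies the inequalities with slack, and so
  does every sufficiently short vector; translated by \<open>- b\<close>, this is
  interiority.\<close>

lemma core_of_inequalities:
  fixes A :: "nat \<Rightarrow> nat \<Rightarrow> real" and N :: nat
  assumes d: "d < n" and b: "b \<in> Rn n"
    and B: "(+) b ` cylinder (Suc d) n {x \<in> Rn (Suc d). inX d x}
      = {x \<in> Rn n. \<forall>i<N. (\<Sum>j<Suc d. A i j * x j) \<le> (1 :: real)}" (is "?B = _")
  shows "x \<in> Rn n \<Longrightarrow> x \<in> ?B \<longleftrightarrow> inX d (\<lambda>j. x j + (- b) j)" and "core d (- b)"
proof -
  show mem: "x \<in> ?B \<longleftrightarrow> inX d (\<lambda>j. x j + (- b) j)" if "x \<in> Rn n" for x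
  proof -
    have "x \<in> ?B \<longleftrightarrow> x - b \<in> cylinder (Suc d) n {x \<in> Rn (Suc d). inX d x}"
    proof
      assume "x - b \<in> cylinder (Suc d) n {x \<in> Rn (Suc d). inX d x}"
      then show "x \<in> ?B" by (intro image_eqI[of _ _ "x - b"]) auto
    qed auto
    also have "\<dots> \<longleftrightarrow> inX d (\<lambda>j. if j < Suc d then (x - b) j else 0)"
      using that b by (auto simp: cylinder_def topspace_Euclidean_space)
    also have "\<dots> \<longleftrightarrow> inX d (\<lambda>j. x j + (- b) j)" by (rule inX_cong) simp
    finally show ?thesis .
  qed
  show "core d (- b)"
    unfolding core_def
  proof
    fix v :: "nat \<Rightarrow> real"
    define w where "w j = (if j \<le> d then v j else 0)" for j
    define s where "s i = (\<Sum>j<Suc d. A i j * w j)" for i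
    \<comment> \<open>Small enough for all inequalities at once; the summand 1 keeps the denominator
      positive.\<close>
    define e where "e = 1 / (1 + (\<Sum>i<N. \<bar>s i\<bar>))"
    have pos: "0 < 1 + (\<Sum>i<N. \<bar>s i\<bar>)" by (intro add_pos_nonneg sum_nonneg) auto
    then have e: "e > 0" by (simp add: e_def)
    have Rn: "(\<lambda>j. e * w j) \<in> Rn n" using d by (auto simp: w_def topspace_Euclidean_space)
    have "(\<Sum>j<Suc d. A i j * (e * w j)) \<le> 1" if "i < N" for i
    proof -
      have "\<bar>s i\<bar> \<le> (\<Sum>i<N. \<bar>s i\<bar>)" using that by (intro member_le_sum) auto
      then have "s i \<le> 1 + (\<Sum>i<N. \<bar>s i\<bar>)" by linarith
      then have "e * s i \<le> 1" using pos by (simp add: e_def)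
      moreover have "(\<Sum>j<Suc d. A i j * (e * w j)) = e * s i"
        unfolding s_def sum_distrib_left by (rule sum.cong) auto
      ultimately show ?thesis by simp
    qed
    then have "(\<lambda>j. e * w j) \<in> ?B" unfolding B using Rn by blast
    then have "inX d (\<lambda>j. e * w j + (- b) j)" using mem[OF Rn] by blast
    moreover have "inX d (\<lambda>j. e * w j + (- b) j) \<longleftrightarrow> inX d (\<lambda>j. (- b) j + e * v j)"
      by (rule inX_cong) (simp add: w_def)
    ultimately show "\<exists>\<epsilon>>0. inX d (\<lambda>j. (- b) j + \<epsilon> * v j)" using e by blast
  qed
qed

end

section \<open>Termination with bounded cost\<close>

text \<open>Total correctness with a cost bound. As postconditions are arbitrary predicates, the
  rest of a computation can be nested as the postcondition of its beginning.\<close>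

definition terminates :: "program \<Rightarrow> memory \<Rightarrow> nat \<Rightarrow> (memory \<Rightarrow> bool) \<Rightarrow> bool"
  where "terminates P s n Q \<longleftrightarrow> (\<exists>k t. run P s k t \<and> k \<le> n \<and> Q t)"

text \<open>Loop-free code is evaluated by rewriting with \<open>exec\<close>, and
  \<open>cost\<close> charges the more expensive branch; so only loops need invariants.\<close>

primrec loop_free :: "program \<Rightarrow> bool"
  where
    "loop_free Skip \<longleftrightarrow> True"
  | "loop_free (Write k e f) \<longleftrightarrow> True"
  | "loop_free (Seq P Q) \<longleftrightarrow> loop_free P \<and> loop_free Q"
  | "loop_free (Cond b P Q) \<longleftrightarrow> loop_free P \<and> loop_free Q"
  | "loop_free (While b P) \<longleftrightarrow> False"

primrec exec :: "program \<Rightarrow> memory \<Rightarrow> memory"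
  where
    "exec Skip s = s"
  | "exec (Write k e f) s = s(k := (s k)(index (val s e) := val s f))"
  | "exec (Seq P Q) s = exec Q (exec P s)"
  | "exec (Cond b P Q) s = (if holds s b then exec P s else exec Q s)"
  | "exec (While b P) s = s"

primrec cost :: "program \<Rightarrow> nat"
  where
    "cost Skip = 0"
  | "cost (Write k e f) = expr_cost e + expr_cost f + 1"
  | "cost (Seq P Q) = cost P + cost Q"
  | "cost (Cond b P Q) = test_cost b + max (cost P) (cost Q)"
  | "cost (While b P) = 0"

lemma run_exec: "loop_free P \<Longrightarrow> \<exists>k\<le>cost P. run P s k (exec P s)"
proof (induction P arbitrary: s)
  case (Seq P Q)
  then obtain k l where "k \<le> cost P" "run P s k (exec P s)"
    "l \<le> cost Q" "run Q (exec P s) l (exec Q (exec P s))"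
    by (meson loop_free.simps(3))
  then show ?case by (auto intro!: exI[of _ "k + l"] run.Seq)
next
  case (Cond b P Q)
  then obtain k l where "k \<le> cost P" "run P s k (exec P s)" "l \<le> cost Q" "run Q s l (exec Q s)"
    by (meson loop_free.simps(4))
  then show ?case
    by (cases "holds s b")
      (auto intro: exI[of _ "test_cost b + k"] exI[of _ "test_cost b + l"] run.CondTrue run.CondFalse)
next
  case (Write k e f)
  have "run (Write k e f) s (cost (Write k e f)) (exec (Write k e f) s)"
    unfolding exec.simps cost.simps by (rule run.Write)
  then show ?case by blast
qed (auto intro: run.Skip)

lemma terminates_exec:
  "loop_free P \<Longrightarrow> cost P \<le> n \<Longrightarrow> Q (exec P s) \<Longrightarrow> terminates P s n Q"
  unfolding terminates_def using run_exec[of P s] le_trans by blast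

lemma terminates_mono:
  "terminates P s n Q \<Longrightarrow> n \<le> n' \<Longrightarrow> (\<And>t. Q t \<Longrightarrow> Q' t) \<Longrightarrow> terminates P s n' Q'"
  unfolding terminates_def using le_trans by blast

lemma terminates_Seq:
  assumes "terminates P s k (\<lambda>t. terminates P' t l Q)" "k + l \<le> n"
  shows "terminates (Seq P P') s n Q"
proof -
  obtain i t j u where "run P s i t" "i \<le> k" "run P' t j u" "j \<le> l" "Q u"
    using assms(1) unfolding terminates_def by blast
  then show ?thesis
    unfolding terminates_def using assms(2) by (intro exI[of _ "i + j"] exI[of _ u]) (auto intro: run.Seq)
qed

lemma terminates_Seq_post:
  assumes "terminates P s k R" "\<And>t. R t \<Longrightarrow> terminates P' t l Q" "k + l \<le> n"
  shows "terminates (Seq P P') s n Q"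
  by (rule terminates_Seq[OF terminates_mono[OF assms(1) le_refl assms(2)] assms(3)])

lemma terminates_exec_Seq:
  assumes "loop_free P" "terminates P' (exec P s) k Q" "cost P + k \<le> n"
  shows "terminates (Seq P P') s n Q"
  using terminates_exec[where Q = "\<lambda>t. terminates P' t k Q", OF assms(1) le_refl assms(2)] assms(3)
  by (rule terminates_Seq)

lemma terminates_Cond:
  assumes "holds s b \<Longrightarrow> terminates P s k Q" "\<not> holds s b \<Longrightarrow> terminates P' s k Q"
    and "test_cost b + k \<le> n"
  shows "terminates (Cond b P P') s n Q"
proof (cases "holds s b")
  case True
  then obtain i t where "run P s i t" "i \<le> k" "Q t" using assms(1) unfolding terminates_def by blast
  with True assms(3) show ?thesis
    unfolding terminates_def by (intro exI[of _ "test_cost b + i"] exI[of _ t]) (auto intro: run.CondTrue)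
next
  case False
  then obtain i t where "run P' s i t" "i \<le> k" "Q t" using assms(2) unfolding terminates_def by blast
  with False assms(3) show ?thesis
    unfolding terminates_def by (intro exI[of _ "test_cost b + i"] exI[of _ t]) (auto intro: run.CondFalse)
qed

lemma terminates_While_exit: "\<not> holds s b \<Longrightarrow> Q s \<Longrightarrow> test_cost b \<le> n \<Longrightarrow> terminates (While b P) s n Q"
  unfolding terminates_def by (auto intro: run.WhileFalse)

lemma terminates_While_step:
  assumes "holds s b" "terminates P s k (\<lambda>t. terminates (While b P) t l Q)" "test_cost b + k + l \<le> n"
  shows "terminates (While b P) s n Q"
proof -
  obtain i t j u where "run P s i t" "i \<le> k" "run (While b P) t j u" "j \<le> l" "Q u"
    using assms(2) unfolding terminates_def by blast
  then show ?thesis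
    unfolding terminates_def using assms(1,3)
    by (intro exI[of _ "test_cost b + i + j"] exI[of _ u]) (auto intro: run.WhileTrue)
qed

lemma terminates_For:
  assumes step: "\<And>j t. j < N \<Longrightarrow> I j t \<Longrightarrow> holds t b \<and> terminates P t k (I (Suc j))"
    and exit: "\<And>t. I N t \<Longrightarrow> \<not> holds t b"
    and init: "I 0 s" and n: "N * (k + test_cost b) + test_cost b \<le> n"
  shows "terminates (While b P) s n (I N)"
proof -
  have "terminates (While b P) s ((N - j) * (k + test_cost b) + test_cost b) (I N)"
    if "j \<le> N" "I j s" for j s
    using that
  proof (induction "N - j" arbitrary: j s)
    case 0
    then show ?case using exit by (intro terminates_While_exit) auto
  next
    case (Suc l)
    then have j: "j < N" by simp
    have l: "l = N - Suc j" using Suc.hyps(2) by simp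
    show ?case
    proof (rule terminates_While_step[where k = k])
      show "terminates P s k (\<lambda>t. terminates (While b P) t (l * (k + test_cost b) + test_cost b) (I N))"
        using step[OF j Suc.prems(2)] Suc.hyps(1)[OF l] j unfolding l
        by (auto elim!: terminates_mono)
    qed (use step[OF j Suc.prems(2)] Suc.hyps(2)[symmetric] in auto)
  qed
  from this[of 0 s] init n show ?thesis by (auto elim: terminates_mono)
qed

section \<open>Addresses of matrix cells\<close>

lemma index_of_nat [simp]: "index (real n) = n" "index 0 = 0" "index 1 = 1"
  by (simp_all add: index_def)

lemma index_Suc [simp]: "index (1 + real n) = Suc n" "index (real n + 1) = Suc n"
  using index_of_nat(1)[of "Suc n"] by (simp_all add: add.commute)

lemma index_numeral [simp]: "index (numeral n) = numeral n"
  by (simp add: index_def)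

lemma index_cell [simp]: "index (real d * real m + real j) = d * m + j"
proof -
  have "real d * real m + real j = real (d * m + j)" by simp
  then show ?thesis by (simp only: index_of_nat)
qed

lemma index_cell_Suc [simp]:
  "index (real m + real d * real m + real j) = m + d * m + j"
  "index ((1 + real d) * real m + real j) = Suc d * m + j"
proof -
  have "real m + real d * real m + real j = real (m + d * m + j)"
    "(1 + real d) * real m + real j = real (Suc d * m + j)" by (simp_all add: distrib_right)
  then show "index (real m + real d * real m + real j) = m + d * m + j"
    "index ((1 + real d) * real m + real j) = Suc d * m + j" by (simp_all only: index_of_nat)
qed

section \<open>The program\<close>

abbreviation Seq_infix :: "program \<Rightarrow> program \<Rightarrow> program"  (infixr ";;" 55)
  where "P ;; Q \<equiv> Seq P Q"

abbreviation var :: "nat \<Rightarrow> expr"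
  where "var k \<equiv> Read k (Const 0)"

abbreviation assign :: "nat \<Rightarrow> expr \<Rightarrow> program"
  where "assign k e \<equiv> Write k (Const 0) e"

text \<open>
  The recursion of \<open>solve\<close> runs on an explicit stack. The frame of level \<open>d\<close> consists of the
  vectors \<open>g\<close> and \<open>f\<close> in the cells \<open>d * m + j\<close> of \<open>aG\<close> and \<open>aF\<close>, of the slope and the offset by
  which the result of the pending call is to be transformed, and of the number of calls already
  made. The result of a finished call is in \<open>vR\<close>.
\<close>

abbreviation (input) "aG \<equiv> 8 :: nat"
abbreviation (input) "aF \<equiv> 9 :: nat"
abbreviation (input) "aSlope \<equiv> 10 :: nat"
abbreviation (input) "aOffset \<equiv> 11 :: nat"
abbreviation (input) "aStage \<equiv> 12 :: nat"
abbreviation (input) "aX \<equiv> 13 :: nat"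
abbreviation (input) "vR \<equiv> 7 :: nat"
abbreviation (input) "vd \<equiv> 14 :: nat"
abbreviation (input) "vj \<equiv> 15 :: nat"
abbreviation (input) "vq \<equiv> 16 :: nat"
abbreviation (input) "vt \<equiv> 17 :: nat"
abbreviation (input) "v\<tau> \<equiv> 18 :: nat"
abbreviation (input) "v\<delta> \<equiv> 19 :: nat"
abbreviation (input) "vs \<equiv> 20 :: nat"
abbreviation (input) "vi \<equiv> 21 :: nat"
abbreviation (input) "vg \<equiv> 22 :: nat"
abbreviation (input) "vu \<equiv> 23 :: nat"
abbreviation (input) "vh \<equiv> 24 :: nat"
abbreviation (input) "vw \<equiv> 25 :: nat"
abbreviation (input) "vb \<equiv> 26 :: nat"

abbreviation "expr_m \<equiv> Read 0 (Const 0)"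
abbreviation "expr_a \<equiv> Read 0 (Const 2)"
abbreviation "expr_cell e \<equiv> Add (Mul e expr_m) (var vj)"
abbreviation "expr_c e \<equiv> Read 3 (expr_cell e)"
abbreviation "expr_1minus e \<equiv> Sub (Const 1) e"
abbreviation "expr_frac e \<equiv> Sub e (Floor e)"

text \<open>Both calls in \<open>solve\<close> receive the same kind of affine image of the frame,
  with slope and offset \<open>\<mu>\<close>, 0 in the first and \<open>\<rho>\<close>,
  \<open>\<kappa>\<close> in the second, so a single routine pushes either.\<close>

definition push_body :: program
  where "push_body =
    (let F = Read aF (expr_cell (var vd)); C = expr_c (var vd);
         child = expr_cell (Sub (var vd) (Const 1)) in
      Write aG child (Add (Read aG (expr_cell (var vd))) (Mul (Read aOffset (var vd)) (Sub F C))) ;;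
      Write aF child (Add C (Mul (Read aSlope (var vd)) (Sub F C))) ;;
      assign vj (Add (var vj) (Const 1)))"

definition push :: program
  where "push =
    assign vj (Const 0) ;;
    While (Less (var vj) (var vd)) push_body ;;
    assign vd (Sub (var vd) (Const 1)) ;;
    Write aStage (var vd) (Const 0)"

context cross_parameters
begin

definition input_ok :: "nat \<Rightarrow> memory \<Rightarrow> bool"
  where "input_ok m s \<longleftrightarrow> s 0 0 = real m \<and> s 0 2 = of_int a \<and>
    (\<forall>d. Suc d < m \<longrightarrow> s 1 (Suc d) = \<gamma> (Suc d) \<and> s 2 (Suc d) = \<mu> (Suc d) \<and>
      (\<forall>j\<le>d. s 3 (Suc d * m + j) = c (Suc d) j))"

lemma input_ok_cong:
  "(\<And>k. k < 4 \<Longrightarrow> t k = s k) \<Longrightarrow> input_ok m s \<Longrightarrow> input_ok m t"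
  by (simp add: input_ok_def)

lemma input_okD:
  assumes "input_ok m s"
  shows "s 0 0 = real m" "s 0 2 = of_int a"
    "Suc d < m \<Longrightarrow> s (Suc 0) (Suc d) = \<gamma> (Suc d)" "Suc d < m \<Longrightarrow> s 2 (Suc d) = \<mu> (Suc d)"
    "Suc d < m \<Longrightarrow> j \<le> d \<Longrightarrow> s 3 (m + d * m + j) = c (Suc d) j"
  using assms by (auto simp: input_ok_def)

lemma push:
  assumes ok: "input_ok m s" and d: "Suc d < m" "s vd 0 = real (Suc d)"
    and n: "80 * d + 100 \<le> n"
  shows "terminates push s n (\<lambda>t. t vd 0 = real d \<and> t aStage = (s aStage)(d := 0) \<and>
    (\<forall>j\<le>d. t aG (d * m + j) = s aG (Suc d * m + j)
        + s aOffset (Suc d) * (s aF (Suc d * m + j) - c (Suc d) j) \<and>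
      t aF (d * m + j) = c (Suc d) j + s aSlope (Suc d) * (s aF (Suc d * m + j) - c (Suc d) j)) \<and>
    (\<forall>i\<ge>Suc d * m. t aG i = s aG i \<and> t aF i = s aF i) \<and>
    (\<forall>k. k \<notin> {aG, aF, aStage, vd, vj} \<longrightarrow> t k = s k))" (is "terminates _ _ _ ?Q")
proof -
  let ?I = "\<lambda>j t. t vj 0 = real j \<and>
    (\<forall>i<j. t aG (d * m + i) = s aG (Suc d * m + i)
        + s aOffset (Suc d) * (s aF (Suc d * m + i) - c (Suc d) i) \<and>
      t aF (d * m + i) = c (Suc d) i + s aSlope (Suc d) * (s aF (Suc d * m + i) - c (Suc d) i)) \<and>
    (\<forall>i\<ge>Suc d * m. t aG i = s aG i \<and> t aF i = s aF i) \<and>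
    (\<forall>k. k \<notin> {aG, aF, vj} \<longrightarrow> t k = s k)"
  have loop: "terminates (While (Less (var vj) (var vd)) push_body) (s(vj := (s vj)(0 := 0)))
      (Suc d * 75 + 5) (?I (Suc d))"
  proof (rule terminates_For[where k = 70 and I = ?I and N = "Suc d"])
    fix j t assume j: "j < Suc d" and I: "?I j t"
    have frame: "\<And>k. k \<notin> {aG, aF, vj} \<Longrightarrow> t k = s k"
      and above: "\<And>i. i \<ge> Suc d * m \<Longrightarrow> t aG i = s aG i \<and> t aF i = s aF i"
      using I by blast+
    have t: "t 0 = s 0" "t 3 = s 3" "t vd = s vd" "t aOffset = s aOffset" "t aSlope = s aSlope"
      by (simp_all add: frame)
    note ok' = input_okD[OF ok]
    have eqs: "t aG (m + d * m + j) = s aG (m + d * m + j)" "t aF (m + d * m + j) = s aF (m + d * m + j)"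
      using above[of "m + d * m + j"] by simp_all
    have vj: "t vj 0 = real j" using I by simp
    have vd: "t vd 0 = 1 + real d" using t(3) d by simp
    have exec: "exec push_body t = t(
      aG := (t aG)(d * m + j := s aG (m + d * m + j)
        + s aOffset (Suc d) * (s aF (m + d * m + j) - c (Suc d) j)),
      aF := (t aF)(d * m + j := c (Suc d) j + s aSlope (Suc d) * (s aF (m + d * m + j) - c (Suc d) j)),
      vj := (t vj)(0 := real j + 1))" (is "_ = ?t")
      using d j by (simp add: push_body_def Let_def t ok' eqs vj vd)
    have "?I (Suc j) (exec push_body t)"
      unfolding exec
    proof (intro conjI allI impI)
      fix i assume "i < Suc j"
      then show "?t aG (d * m + i) = s aG (Suc d * m + i)
          + s aOffset (Suc d) * (s aF (Suc d * m + i) - c (Suc d) i)"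
        "?t aF (d * m + i)
          = c (Suc d) i + s aSlope (Suc d) * (s aF (Suc d * m + i) - c (Suc d) i)"
        using I by (auto simp: less_Suc_eq)
    next
      fix i assume i: "i \<ge> Suc d * m"
      then have "i \<noteq> d * m + j" using j d by auto
      then show "?t aG i = s aG i" "?t aF i = s aF i" using above[OF i] by simp_all
    qed (use frame in simp_all)
    then have "terminates push_body t 70 (?I (Suc j))"
      by (rule terminates_exec[where Q = "?I (Suc j)", rotated 2]) (simp_all add: push_body_def Let_def)
    then show "holds t (Less (var vj) (var vd)) \<and> terminates push_body t 70 (?I (Suc j))"
      using j vj vd by simp
  next
    fix t assume "?I (Suc d) t"
    then show "\<not> holds t (Less (var vj) (var vd))" using d by simp
  qed simp_all
  show ?thesis
    unfolding push_def
  proof (rule terminates_exec_Seq)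
    show "terminates (While (Less (var vj) (var vd)) push_body ;;
      assign vd (Sub (var vd) (Const 1)) ;; Write aStage (var vd) (Const 0))
      (exec (assign vj (Const 0)) s) (Suc d * 75 + 5 + 8) ?Q"
      unfolding exec.simps val.simps index_of_nat of_int_0
    proof (rule terminates_Seq_post[OF loop])
      fix t assume I: "?I (Suc d) t"
      then have "t vd = s vd" "t aStage = s aStage" by auto
      then show "terminates (assign vd (Sub (var vd) (Const 1)) ;; Write aStage (var vd) (Const 0)) t 8 ?Q"
        using I d by (intro terminates_exec[where Q = ?Q]) (auto simp: less_Suc_eq_le)
    qed simp
  qed (use n in simp_all)
qed

end

section \<open>The decision and the choice of the piece as programs\<close>

definition dec_head :: program
  where "dec_head =
    (let \<gamma> = Read 1 (var vq); \<mu> = Read 2 (var vq) in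
      assign vh (expr_frac \<gamma>) ;;
      assign vw (Add (Sub (Read aX (var vq)) (Mul (var vt) \<gamma>)) (var vh)) ;;
      assign vw (expr_frac (var vw)) ;;
      Cond (Less (var vw) (var vh))
        (assign vw (expr_1minus (Div (var vw) (var vh))))
        (assign vw (Div (Sub (var vw) (var vh)) (expr_1minus (var vh)))) ;;
      assign v\<tau> (Div (Sub (var vt) (Mul (expr_1minus \<mu>) (var vw))) \<mu>) ;;
      assign vj (Const 0))"

definition shift_body :: program
  where "shift_body =
    Write aX (var vj) (Sub (Read aX (var vj)) (Mul (Sub (var vt) (var v\<tau>)) (expr_c (var vq)))) ;;
    assign vj (Add (var vj) (Const 1))"

definition dec_tail :: program
  where "dec_tail = assign vt (var v\<tau>) ;; assign vq (Sub (var vq) (Const 1))"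

text \<open>\<open>dec\<close> is tail recursive, so it runs as a loop that overwrites
  \<open>aX\<close> and \<open>vt\<close>. The test of level 0 is left to
  \<open>piece_tail\<close>.\<close>

definition decide :: program
  where "decide =
    While (Less (Const 0) (var vq))
      (dec_head ;; While (Less (var vj) (var vq)) shift_body ;; dec_tail)"

text \<open>If the height is constant, the division by \<open>vs\<close> yields 0 and the decision
  that follows concerns a meaningless point; \<open>piece_tail\<close> replaces its outcome by a
  direct comparison of heights.\<close>

definition piece_head :: program
  where "piece_head =
    (let \<gamma> = Read 1 (var vd); \<mu> = Read 2 (var vd); top = Add (Mul (var vd) expr_m) (var vd) in
      assign vs (Sub (Read aF top) \<gamma>) ;;
      assign vg (expr_frac \<gamma>) ;;
      assign v\<delta> (Add (Read aG top) (Mul (Mul \<mu> (var vR)) (var vs))) ;;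
      Cond (Less (var vs) (Const 0))
        (assign vi (Sub (Ceiling (var v\<delta>)) (Const 1)))
        (assign vi (Floor (var v\<delta>))) ;;
      assign vb (Div (Sub (Sub (Add (var vi) (Const 1)) (var vg)) (Read aG top)) (var vs)) ;;
      assign vt (Div (Sub (var vb) (expr_1minus \<mu>)) \<mu>) ;;
      assign vj (Const 0))"

definition line_body :: program
  where "line_body =
    (let F = Read aF (expr_cell (var vd)); C = expr_c (var vd) in
      Write aX (var vj) (Add (Add (Read aG (expr_cell (var vd))) (Mul (var vb) (Sub F C)))
        (Mul (var vt) C)) ;;
      assign vj (Add (var vj) (Const 1)))"

definition piece_tail :: program
  where "piece_tail =
    (let \<gamma> = Read 1 (var vd); \<mu> = Read 2 (var vd); top = Add (Mul (var vd) expr_m) (var vd) in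
      Cond (LessEq (expr_frac (Sub (Read aX (Const 0)) (Mul (var vt) expr_a))) (var vt))
        (assign vu (Const 1)) (assign vu (Const 0)) ;;
      Cond (Less (Const 0) (var vs)) Skip
        (Cond (Less (var vs) (Const 0))
          (assign vu (expr_1minus (var vu)))
          (Cond (LessEq (var v\<delta>) (Sub (Add (var vi) (Const 1)) (var vg)))
            (assign vu (Const 1)) (assign vu (Const 0)))) ;;
      Cond (LessEq (Const 1) (var vu))
        (assign vw (Sub (expr_1minus (var vg)) (Mul (expr_1minus \<mu>) (var vs))) ;;
         Write aSlope (var vd) (Div (Mul \<mu> (expr_1minus (var vg))) (var vw)) ;;
         Write aOffset (var vd) (Div (Mul (expr_1minus \<mu>) (Sub (Read aG top) (var vi))) (var vw)))
        (assign vw (Add (var vg) (Mul (expr_1minus \<mu>) (var vs))) ;;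
         Write aSlope (var vd) (Div (Mul \<mu> (var vg)) (var vw)) ;;
         Write aOffset (var vd)
           (Div (Mul (expr_1minus \<mu>) (Sub (Add (var vi) (Const 1)) (Read aG top))) (var vw))) ;;
      Write aStage (var vd) (Const 2))"

definition piece :: program
  where "piece =
    piece_head ;;
    While (Less (var vj) (var vd)) line_body ;;
    assign vq (Sub (var vd) (Const 1)) ;;
    decide ;;
    piece_tail"

lemma index_top [simp]:
  "index ((1 + real d) * real m + (1 + real d)) = Suc d * m + Suc d"
proof -
  have "(1 + real d) * real m + (1 + real d) = real (Suc d * m + Suc d)" by (simp add: distrib_right)
  then show ?thesis by (simp only: index_of_nat)
qed

context cross_parameters
begin

lemma dec_head:
  assumes ok: "input_ok m s" and d: "Suc d < m" "s vq 0 = real (Suc d)"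
  shows "exec dec_head s v\<tau> 0 = (s vt 0 - (1 - \<mu> (Suc d)) *
      height_value (Suc d) (s aX (Suc d) - s vt 0 * \<gamma> (Suc d))) / \<mu> (Suc d)"
    and "exec dec_head s vj 0 = 0"
    and "k \<notin> {vh, vw, v\<tau>, vj} \<Longrightarrow> exec dec_head s k = s k"
  using d input_okD(3,4)[OF ok d(1)]
  by (auto simp: dec_head_def Let_def height_value_def frac_def)

lemma shift_loop:
  assumes ok: "input_ok m s" and d: "Suc d < m" "s vq 0 = real (Suc d)" "s vj 0 = 0"
  shows "terminates (While (Less (var vj) (var vq)) shift_body) s (40 * d + 50) (\<lambda>t.
    (\<forall>j\<le>d. t aX j = s aX j - (s vt 0 - s v\<tau> 0) * c (Suc d) j) \<and>
    (\<forall>k. k \<notin> {aX, vj} \<longrightarrow> t k = s k))"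
proof -
  let ?I = "\<lambda>j t. t vj 0 = real j \<and>
    (\<forall>i<j. t aX i = s aX i - (s vt 0 - s v\<tau> 0) * c (Suc d) i) \<and>
    (\<forall>i\<ge>j. t aX i = s aX i) \<and> (\<forall>k. k \<notin> {aX, vj} \<longrightarrow> t k = s k)"
  have "terminates (While (Less (var vj) (var vq)) shift_body) s (40 * d + 50) (?I (Suc d))"
  proof (rule terminates_For[where k = 25 and I = ?I and N = "Suc d"])
    fix j t assume j: "j < Suc d" and I: "?I j t"
    have frame: "\<And>k. k \<notin> {aX, vj} \<Longrightarrow> t k = s k" using I by blast
    have t: "t 0 = s 0" "t 3 = s 3" "t vq = s vq" "t vt = s vt" "t v\<tau> = s v\<tau>"
      by (simp_all add: frame)
    have vj: "t vj 0 = real j" and X: "t aX j = s aX j" using I by simp_all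
    have vq: "t vq 0 = 1 + real d" using t(3) d by simp
    have exec: "exec shift_body t = t(
      aX := (t aX)(j := s aX j - (s vt 0 - s v\<tau> 0) * c (Suc d) j),
      vj := (t vj)(0 := real j + 1))" (is "_ = ?t")
      using d j by (simp add: shift_body_def t input_okD[OF ok] vj vq X)
    have "?I (Suc j) (exec shift_body t)"
      unfolding exec
    proof (intro conjI allI impI)
      fix i assume "i < Suc j"
      then show "?t aX i = s aX i - (s vt 0 - s v\<tau> 0) * c (Suc d) i"
        using I by (auto simp: less_Suc_eq)
    next
      fix i assume "i \<ge> Suc j"
      then show "?t aX i = s aX i" using I by simp
    qed (use frame in simp_all)
    then have "terminates shift_body t 25 (?I (Suc j))"
      by (rule terminates_exec[where Q = "?I (Suc j)", rotated 2]) (simp_all add: shift_body_def)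
    then show "holds t (Less (var vj) (var vq)) \<and> terminates shift_body t 25 (?I (Suc j))"
      using j vj vq by simp
  next
    fix t assume "?I (Suc d) t"
    then show "\<not> holds t (Less (var vj) (var vq))" using d by simp
  qed (use d in simp_all)
  then show ?thesis by (rule terminates_mono) (auto simp: less_Suc_eq_le)
qed

lemma decide:
  assumes "input_ok m s" "d < m" "s vq 0 = real d" "100 * (d + 2)\<^sup>2 \<le> n"
  shows "terminates decide s n (\<lambda>t.
    (frac (t aX 0 - t vt 0 * of_int a) \<le> t vt 0 \<longleftrightarrow> dec d (s aX) (s vt 0)) \<and>
    (\<forall>k. k \<notin> {aX, vj, vq, vt, v\<tau>, vh, vw} \<longrightarrow> t k = s k))"
  using assms
proof (induction d arbitrary: s n)
  case 0
  then show ?case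
    unfolding decide_def by (intro terminates_While_exit) (auto simp: power2_eq_square)
next
  case (Suc d)
  let ?Q = "\<lambda>t. (frac (t aX 0 - t vt 0 * of_int a) \<le> t vt 0 \<longleftrightarrow> dec (Suc d) (s aX) (s vt 0)) \<and>
    (\<forall>k. k \<notin> {aX, vj, vq, vt, v\<tau>, vh, vw} \<longrightarrow> t k = s k)"
  note head = dec_head[OF Suc.prems(1-3)]
  let ?s = "exec dec_head s"
  have ok: "input_ok m ?s" by (rule input_ok_cong[OF _ Suc.prems(1)]) (simp add: head(3))
  have s: "?s vq 0 = real (Suc d)" "?s vj 0 = 0" "?s aX = s aX" "?s vt = s vt"
    using head Suc.prems by simp_all
  show ?case
    unfolding decide_def
  proof (rule terminates_While_step[where k = "40 * d + 150" and l = "100 * (d + 2)\<^sup>2"])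
    show "terminates (dec_head ;; While (Less (var vj) (var vq)) shift_body ;; dec_tail) s
      (40 * d + 150) (\<lambda>t. terminates (While (Less (Const 0) (var vq))
        (dec_head ;; While (Less (var vj) (var vq)) shift_body ;; dec_tail)) t (100 * (d + 2)\<^sup>2) ?Q)"
      (is "terminates _ _ _ ?R")
    proof (rule terminates_exec_Seq[where k = "40 * d + 60"])
      show "terminates (While (Less (var vj) (var vq)) shift_body ;; dec_tail) ?s (40 * d + 60) ?R"
      proof (rule terminates_Seq_post[where l = 10, OF shift_loop[OF ok Suc.prems(2) s(1,2)]])
        fix t assume t: "(\<forall>j\<le>d. t aX j = ?s aX j - (?s vt 0 - ?s v\<tau> 0) * c (Suc d) j) \<and>
          (\<forall>k. k \<notin> {aX, vj} \<longrightarrow> t k = ?s k)"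
        let ?t = "exec dec_tail t"
        have frame: "t k = ?s k" if "k \<notin> {aX, vj}" for k using t that by blast
        have ok': "input_ok m ?t"
          by (rule input_ok_cong[OF _ ok]) (auto simp: dec_tail_def frame)
        have vq: "?t vq 0 = real d" using frame[of vq] s(1) by (simp add: dec_tail_def)
        have dec: "dec d (?t aX) (?t vt 0) \<longleftrightarrow> dec (Suc d) (s aX) (s vt 0)"
        proof -
          have "?t aX = t aX" "?t vt 0 = ?s v\<tau> 0" using frame[of v\<tau>] by (simp_all add: dec_tail_def)
          moreover have "dec d (t aX) (?s v\<tau> 0)
              \<longleftrightarrow> dec d (\<lambda>j. s aX j - (s vt 0 - ?s v\<tau> 0) * c (Suc d) j) (?s v\<tau> 0)"
            using t by (intro dec_cong) (simp add: s)
          ultimately show ?thesis unfolding dec.simps Let_def head(1) by simp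
        qed
        have "?R ?t"
          unfolding decide_def[symmetric]
        proof (rule terminates_mono[OF Suc.IH[OF ok' _ vq le_refl] le_refl])
          fix u assume u: "(frac (u aX 0 - u vt 0 * of_int a) \<le> u vt 0
              \<longleftrightarrow> dec d (?t aX) (?t vt 0)) \<and>
            (\<forall>k. k \<notin> {aX, vj, vq, vt, v\<tau>, vh, vw} \<longrightarrow> u k = ?t k)"
          have "?t k = s k" if "k \<notin> {aX, vj, vq, vt, v\<tau>, vh, vw}" for k
            using that frame[of k] head(3)[of k] by (simp add: dec_tail_def)
          then show "?Q u" using u dec by simp
        qed (use Suc.prems in simp)
        then show "terminates dec_tail t 10 ?R"
          by (rule terminates_exec[where Q = ?R, rotated 2]) (simp_all add: dec_tail_def)
      qed simp
    qed (simp_all add: dec_head_def Let_def)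
    \<comment> \<open>\<open>100 * (d + 3)\<^sup>2\<close> exceeds
      \<open>100 * (d + 2)\<^sup>2\<close> by \<open>200 * d + 500\<close>, which is more than one
      round costs.\<close>
    show "test_cost (Less (Const 0) (var vq)) + (40 * d + 150) + 100 * (d + 2)\<^sup>2 \<le> n"
      using Suc.prems(4) by (simp add: power2_eq_square algebra_simps)
  qed (use Suc.prems in simp)
qed

lemma piece_head:
  assumes ok: "input_ok m s" and d: "Suc d < m" "s vd 0 = real (Suc d)"
  defines "g \<equiv> \<lambda>j. s aG (Suc d * m + j)" and "f \<equiv> \<lambda>j. s aF (Suc d * m + j)"
  defines "i \<equiv> cell (Suc d) g f (\<mu> (Suc d) * s vR 0)"
  shows "exec piece_head s vs 0 = f (Suc d) - \<gamma> (Suc d)"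
    and "exec piece_head s vg 0 = frac (\<gamma> (Suc d))"
    and "exec piece_head s v\<delta> 0 = g (Suc d) + \<mu> (Suc d) * s vR 0 * (f (Suc d) - \<gamma> (Suc d))"
    and "exec piece_head s vi 0 = of_int i"
    and "exec piece_head s vb 0 = switch (Suc d) g f i"
    and "exec piece_head s vt 0 = (switch (Suc d) g f i - (1 - \<mu> (Suc d))) / \<mu> (Suc d)"
    and "exec piece_head s vj 0 = 0"
    and "k \<notin> {vs, vg, v\<delta>, vi, vb, vt, vj} \<Longrightarrow> exec piece_head s k = s k"
proof -
  note ok' = input_okD(1)[OF ok] input_okD(3,4)[OF ok d(1)]
  have i: "of_int i = (if f (Suc d) - \<gamma> (Suc d) < 0
      then of_int \<lceil>g (Suc d) + \<mu> (Suc d) * s vR 0 * (f (Suc d) - \<gamma> (Suc d))\<rceil> - (1 :: real)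
      else of_int \<lfloor>g (Suc d) + \<mu> (Suc d) * s vR 0 * (f (Suc d) - \<gamma> (Suc d))\<rfloor>)"
    by (simp add: i_def cell_def start_cell_def)
  show "exec piece_head s vs 0 = f (Suc d) - \<gamma> (Suc d)"
    "exec piece_head s vg 0 = frac (\<gamma> (Suc d))"
    "exec piece_head s v\<delta> 0 = g (Suc d) + \<mu> (Suc d) * s vR 0 * (f (Suc d) - \<gamma> (Suc d))"
    "exec piece_head s vi 0 = of_int i"
    "exec piece_head s vb 0 = switch (Suc d) g f i"
    "exec piece_head s vt 0 = (switch (Suc d) g f i - (1 - \<mu> (Suc d))) / \<mu> (Suc d)"
    "exec piece_head s vj 0 = 0"
    "k \<notin> {vs, vg, v\<delta>, vi, vb, vt, vj} \<Longrightarrow> exec piece_head s k = s k"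
    unfolding switch_def i
    by (cases "f (Suc d) - \<gamma> (Suc d) < 0";
      simp add: piece_head_def Let_def d(2) ok' g_def f_def frac_def del: diff_less_0_iff_less)+
qed

lemma line_loop:
  assumes ok: "input_ok m s" and d: "Suc d < m" "s vd 0 = real (Suc d)" "s vj 0 = 0"
  defines "g \<equiv> \<lambda>j. s aG (Suc d * m + j)" and "f \<equiv> \<lambda>j. s aF (Suc d * m + j)"
  shows "terminates (While (Less (var vj) (var vd)) line_body) s (70 * d + 80) (\<lambda>t.
    (\<forall>j\<le>d. t aX j = g j + s vb 0 * (f j - c (Suc d) j) + s vt 0 * c (Suc d) j) \<and>
    (\<forall>k. k \<notin> {aX, vj} \<longrightarrow> t k = s k))"
proof -
  let ?x = "\<lambda>j. g j + s vb 0 * (f j - c (Suc d) j) + s vt 0 * c (Suc d) j"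
  let ?I = "\<lambda>j t. t vj 0 = real j \<and> (\<forall>i<j. t aX i = ?x i) \<and> (\<forall>k. k \<notin> {aX, vj} \<longrightarrow> t k = s k)"
  have "terminates (While (Less (var vj) (var vd)) line_body) s (70 * d + 80) (?I (Suc d))"
  proof (rule terminates_For[where k = 55 and I = ?I and N = "Suc d"])
    fix j t assume j: "j < Suc d" and I: "?I j t"
    have frame: "\<And>k. k \<notin> {aX, vj} \<Longrightarrow> t k = s k" using I by blast
    have t: "t 0 = s 0" "t 3 = s 3" "t vd = s vd" "t vt = s vt" "t vb = s vb" "t aG = s aG" "t aF = s aF"
      by (simp_all add: frame)
    have vj: "t vj 0 = real j" using I by simp
    have vd: "t vd 0 = 1 + real d" using t(3) d by simp
    have exec: "exec line_body t = t(aX := (t aX)(j := ?x j), vj := (t vj)(0 := real j + 1))" (is "_ = ?t")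
      using d j by (simp add: line_body_def Let_def t input_okD[OF ok] vj vd g_def f_def)
    have "?I (Suc j) (exec line_body t)"
      unfolding exec
    proof (intro conjI allI impI)
      fix i assume "i < Suc j"
      then show "?t aX i = ?x i" using I by (auto simp: less_Suc_eq)
    qed (use frame in simp_all)
    then have "terminates line_body t 55 (?I (Suc j))"
      by (rule terminates_exec[where Q = "?I (Suc j)", rotated 2]) (simp_all add: line_body_def Let_def)
    then show "holds t (Less (var vj) (var vd)) \<and> terminates line_body t 55 (?I (Suc j))"
      using j vj vd by simp
  next
    fix t assume "?I (Suc d) t"
    then show "\<not> holds t (Less (var vj) (var vd))" using d by simp
  qed (use d in simp_all)
  then show ?thesis by (rule terminates_mono) (auto simp: less_Suc_eq_le)
qed

lemma piece_tail:
  assumes ok: "input_ok m s" and d: "Suc d < m" "s vd 0 = real (Suc d)"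
    and s: "s vs 0 = h - \<gamma> (Suc d)" "s vg 0 = frac (\<gamma> (Suc d))" "s vi 0 = of_int i"
  defines "u \<equiv> (if 0 < h - \<gamma> (Suc d) then frac (s aX 0 - s vt 0 * of_int a) \<le> s vt 0
    else if h - \<gamma> (Suc d) < 0 then \<not> frac (s aX 0 - s vt 0 * of_int a) \<le> s vt 0
    else s v\<delta> 0 \<le> of_int i + 1 - frac (\<gamma> (Suc d)))"
  shows "exec piece_tail s aSlope = (s aSlope)(Suc d := ratio (Suc d) u h)"
    and "exec piece_tail s aOffset = (s aOffset)(Suc d := offset (Suc d) u i (s aG (Suc d * m + Suc d)) h)"
    and "exec piece_tail s aStage = (s aStage)(Suc d := 2)"
    and "k \<notin> {vu, vw, aSlope, aOffset, aStage} \<Longrightarrow> exec piece_tail s k = s k"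
proof -
  note ok' = input_okD(1,2)[OF ok] input_okD(3,4)[OF ok d(1)]
  define b where "b \<longleftrightarrow> frac (s aX 0 - s vt 0 * of_int a) \<le> s vt 0"
  have b: "s aX 0 - s vt 0 * of_int a - of_int \<lfloor>s aX 0 - s vt 0 * of_int a\<rfloor> \<le> s vt 0 \<longleftrightarrow> b"
    by (simp add: b_def frac_def)
  show "exec piece_tail s aSlope = (s aSlope)(Suc d := ratio (Suc d) u h)"
    "exec piece_tail s aOffset = (s aOffset)(Suc d := offset (Suc d) u i (s aG (Suc d * m + Suc d)) h)"
    "exec piece_tail s aStage = (s aStage)(Suc d := 2)"
    "k \<notin> {vu, vw, aSlope, aOffset, aStage} \<Longrightarrow> exec piece_tail s k = s k"
    unfolding u_def b_def[symmetric]
    by (cases b; cases "0 < h - \<gamma> (Suc d)"; cases "h - \<gamma> (Suc d) < 0";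
      cases "s v\<delta> 0 \<le> of_int i + 1 - frac (\<gamma> (Suc d))";
      simp add: piece_tail_def Let_def d(2) ok' s b ratio_def offset_def upper_ratio_def lower_ratio_def
        del: diff_less_0_iff_less diff_gt_0_iff_gt)+
qed

end

section \<open>The recursion as a loop over frames\<close>

definition first_call :: program
  where "first_call =
    Write aSlope (var vd) (Read 2 (var vd)) ;;
    Write aOffset (var vd) (Const 0) ;;
    Write aStage (var vd) (Const 1)"

definition return :: program
  where "return =
    assign vR (Add (Mul (Read aSlope (var vd)) (var vR)) (Read aOffset (var vd))) ;;
    assign vd (Add (var vd) (Const 1))"

definition base_case :: program
  where "base_case =
    (let G = Read aG (Const 0); F = Read aF (Const 0) in
      assign vh (Div (Sub (Ceiling G) G) (Sub F expr_a)) ;;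
      assign vw (Div (expr_frac G) (Sub (Add expr_a (Const 1)) F)) ;;
      Cond (LessEq (var vh) (var vw)) (assign vR (var vh)) (assign vR (var vw)) ;;
      assign vd (Add (var vd) (Const 1)))"

text \<open>One iteration advances the active frame \<open>vd\<close> according to its stage: 0
  starts the first call, 1 uses its result to set up the second call, 2 returns.\<close>

definition solve_body :: program
  where "solve_body =
    Cond (LessEq (var vd) (Const 0)) base_case
      (Cond (LessEq (Const 2) (Read aStage (var vd))) return
        (Cond (LessEq (Const 1) (Read aStage (var vd))) piece first_call ;; push))"

text \<open>\<open>vd = m\<close> means that the outermost frame, of level \<open>m - 1\<close>, has
  returned.\<close>

definition solve_loop :: program
  where "solve_loop = While (Less (var vd) expr_m) solve_body"

definition setup_body :: program
  where "setup_body =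
    Write aG (expr_cell (var vd)) (Read 6 (var vj)) ;;
    Write aF (expr_cell (var vd)) (Sub (Const 0) (Read 4 (var vj))) ;;
    assign vj (Add (var vj) (Const 1))"

definition main_program :: program
  where "main_program =
    (assign vd (Sub expr_m (Const 1)) ;; assign vj (Const 0)) ;;
    While (Less (var vj) expr_m) setup_body ;;
    solve_loop"

context cross_parameters
begin

lemma piece:
  assumes ok: "input_ok m s" and d: "Suc d < m" "s vd 0 = real (Suc d)"
    and n: "100 * (d + 2)\<^sup>2 + 70 * d + 400 \<le> n"
  defines "g \<equiv> \<lambda>j. s aG (Suc d * m + j)" and "f \<equiv> \<lambda>j. s aF (Suc d * m + j)"
  defines "i \<equiv> cell (Suc d) g f (\<mu> (Suc d) * s vR 0)"
  defines "u \<equiv> upper d g f (\<mu> (Suc d) * s vR 0) i"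
  shows "terminates piece s n (\<lambda>t.
    t aSlope = (s aSlope)(Suc d := ratio (Suc d) u (f (Suc d))) \<and>
    t aOffset = (s aOffset)(Suc d := offset (Suc d) u i (g (Suc d)) (f (Suc d))) \<and>
    t aStage = (s aStage)(Suc d := 2) \<and>
    (\<forall>k. k \<notin> {aSlope, aOffset, aStage, aX} \<union> {vj..vb} \<longrightarrow> t k = s k))" (is "terminates _ _ _ ?Q")
proof -
  note head = piece_head[OF ok d, folded g_def f_def, folded i_def]
  let ?s = "exec piece_head s"
  let ?t = "switch (Suc d) g f i" and ?\<tau> = "(switch (Suc d) g f i - (1 - \<mu> (Suc d))) / \<mu> (Suc d)"
  have ok1: "input_ok m ?s" by (rule input_ok_cong[OF _ ok]) (simp add: head(8))
  have s1: "?s vd 0 = real (Suc d)" "?s aG = s aG" "?s aF = s aF"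
    using d by (simp_all add: head(8))
  let ?P = "assign vq (Sub (var vd) (Const 1))"
  show ?thesis
    unfolding piece_def
  proof (rule terminates_exec_Seq[where k = "100 * (d + 2)\<^sup>2 + 70 * d + 250"])
    show "terminates (While (Less (var vj) (var vd)) line_body ;; ?P ;; decide ;; piece_tail) ?s
      (100 * (d + 2)\<^sup>2 + 70 * d + 250) ?Q"
    proof (rule terminates_Seq_post[where l = "100 * (d + 2)\<^sup>2 + 150",
          OF line_loop[OF ok1 d(1) s1(1) head(7)]])
      fix t1
      assume t1: "(\<forall>j\<le>d. t1 aX j = ?s aG (Suc d * m + j)
          + ?s vb 0 * (?s aF (Suc d * m + j) - c (Suc d) j) + ?s vt 0 * c (Suc d) j) \<and>
        (\<forall>k. k \<notin> {aX, vj} \<longrightarrow> t1 k = ?s k)"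
      have frame1: "t1 k = ?s k" if "k \<notin> {aX, vj}" for k using t1 that by blast
      let ?t1 = "exec ?P t1"
      have t1': "?t1 vq 0 = real d" "?t1 aX = t1 aX" "?t1 vt = ?s vt"
        using frame1[of vd] frame1[of vt] s1(1) by simp_all
      have frame2: "?t1 k = ?s k" if "k \<notin> {aX, vj, vq}" for k using frame1 that by simp
      have ok2: "input_ok m ?t1" by (rule input_ok_cong[OF _ ok1]) (simp add: frame1)
      have "dec d (?t1 aX) (?t1 vt 0)
          \<longleftrightarrow> dec d (\<lambda>j. g j + ?t * (f j - c (Suc d) j) + ?\<tau> * c (Suc d) j) ?\<tau>"
        unfolding t1'(2,3) head(6)
        by (rule dec_cong) (use t1 in \<open>simp add: s1 head(5,6) g_def f_def\<close>)
      then have before: "dec d (?t1 aX) (?t1 vt 0) \<longleftrightarrow> before_switch d g f i"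
        by (simp add: before_switch_def Let_def)
      show "terminates (?P ;; decide ;; piece_tail) t1 (100 * (d + 2)\<^sup>2 + 150) ?Q"
      proof (rule terminates_exec_Seq[where k = "100 * (d + 2)\<^sup>2 + 120"])
        show "terminates (decide ;; piece_tail) ?t1 (100 * (d + 2)\<^sup>2 + 120) ?Q"
        proof (rule terminates_Seq_post[where l = 120, OF decide[OF ok2 _ t1'(1) le_refl]])
          fix t2
          assume t2: "(frac (t2 aX 0 - t2 vt 0 * of_int a) \<le> t2 vt 0 \<longleftrightarrow> dec d (?t1 aX) (?t1 vt 0)) \<and>
            (\<forall>k. k \<notin> {aX, vj, vq, vt, v\<tau>, vh, vw} \<longrightarrow> t2 k = ?t1 k)"
          have frame3: "t2 k = ?s k" if "k \<notin> {aX, vj, vq, vt, v\<tau>, vh, vw}" for k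
            using t2 that frame2 by (metis insert_iff)
          have ok3: "input_ok m t2" by (rule input_ok_cong[OF _ ok1]) (simp add: frame3)
          have s2: "t2 vd 0 = real (Suc d)" "t2 vs 0 = f (Suc d) - \<gamma> (Suc d)"
            "t2 vg 0 = frac (\<gamma> (Suc d))" "t2 vi 0 = of_int i"
            using s1(1) head by (simp_all add: frame3 f_def)
          have u: "(if 0 < f (Suc d) - \<gamma> (Suc d) then frac (t2 aX 0 - t2 vt 0 * of_int a) \<le> t2 vt 0
              else if f (Suc d) - \<gamma> (Suc d) < 0 then \<not> frac (t2 aX 0 - t2 vt 0 * of_int a) \<le> t2 vt 0
              else t2 v\<delta> 0 \<le> of_int i + 1 - frac (\<gamma> (Suc d))) = u"
            using t2 before head(3) by (simp add: u_def upper_def frame3 f_def g_def)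
          note tail = piece_tail[OF ok3 d(1) s2(1) s2(2-4), unfolded u]
          have same: "t2 aG = s aG" "t2 aSlope = s aSlope" "t2 aOffset = s aOffset" "t2 aStage = s aStage"
            by (simp_all add: frame3 head(8))
          have "?Q (exec piece_tail t2)"
          proof (intro conjI allI impI)
            fix k assume "k \<notin> {aSlope, aOffset, aStage, aX} \<union> {vj..vb}"
            then have k: "k \<notin> {vu, vw, aSlope, aOffset, aStage}" "k \<notin> {aX, vj, vq, vt, v\<tau>, vh, vw}"
              "k \<notin> {vs, vg, v\<delta>, vi, vb, vt, vj}" by auto
            show "exec piece_tail t2 k = s k" using tail(4)[OF k(1)] frame3[OF k(2)] head(8)[OF k(3)] by simp
          qed (simp_all add: tail(1-3) same g_def)
          then show "terminates piece_tail t2 120 ?Q"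
            by (rule terminates_exec[where Q = ?Q, rotated 2]) (simp_all add: piece_tail_def Let_def)
        qed (use d in simp_all)
      qed simp_all
    qed simp
  qed (use n in \<open>simp_all add: piece_head_def Let_def\<close>)
qed

text \<open>The rows from \<open>Suc d * m\<close> on are recorded as unchanged because the parent
  frame is read again for the second call.\<close>

definition called :: "nat \<Rightarrow> nat \<Rightarrow> real \<Rightarrow> real \<Rightarrow> real \<Rightarrow> memory \<Rightarrow> memory \<Rightarrow> bool"
  where "called m d \<rho> \<kappa> r s t \<longleftrightarrow> t vd 0 = real d \<and> t aStage d = 0 \<and>
    t aSlope (Suc d) = \<rho> \<and> t aOffset (Suc d) = \<kappa> \<and> t aStage (Suc d) = r \<and>
    (\<forall>l>Suc d. t aSlope l = s aSlope l \<and> t aOffset l = s aOffset l \<and> t aStage l = s aStage l) \<and>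
    (\<forall>j\<le>d. t aG (d * m + j) = s aG (Suc d * m + j) + \<kappa> * (s aF (Suc d * m + j) - c (Suc d) j) \<and>
      t aF (d * m + j) = c (Suc d) j + \<rho> * (s aF (Suc d * m + j) - c (Suc d) j)) \<and>
    (\<forall>i\<ge>Suc d * m. t aG i = s aG i \<and> t aF i = s aF i) \<and>
    (\<forall>k<8. t k = s k)"

lemma push_called:
  assumes ok: "input_ok m t" and d: "Suc d < m" "s vd 0 = real (Suc d)"
    and t: "t aSlope = (s aSlope)(Suc d := \<rho>)" "t aOffset = (s aOffset)(Suc d := \<kappa>)"
      "t aStage = (s aStage)(Suc d := r)"
      "\<And>k. k \<notin> {aSlope, aOffset, aStage, aX} \<union> {vj..vb} \<Longrightarrow> t k = s k"
  shows "terminates push t (80 * d + 100) (called m d \<rho> \<kappa> r s)"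
proof -
  have "t vd 0 = real (Suc d)" using d t(4)[of vd] by simp
  then have "terminates push t (80 * d + 100) (\<lambda>u. u vd 0 = real d \<and> u aStage = (t aStage)(d := 0) \<and>
    (\<forall>j\<le>d. u aG (d * m + j) = t aG (Suc d * m + j)
        + t aOffset (Suc d) * (t aF (Suc d * m + j) - c (Suc d) j) \<and>
      u aF (d * m + j) = c (Suc d) j + t aSlope (Suc d) * (t aF (Suc d * m + j) - c (Suc d) j)) \<and>
    (\<forall>i\<ge>Suc d * m. u aG i = t aG i \<and> u aF i = t aF i) \<and>
    (\<forall>k. k \<notin> {aG, aF, aStage, vd, vj} \<longrightarrow> u k = t k))" (is "terminates _ _ _ ?R")
    by (rule push[OF ok d(1) _ le_refl])
  then show ?thesis
  proof (rule terminates_mono[OF _ le_refl])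
    fix u assume u: "?R u"
    then have frame: "u k = t k" if "k \<notin> {aG, aF, aStage, vd, vj}" for k using that by blast
    have same: "t aG = s aG" "t aF = s aF" "u aSlope = t aSlope" "u aOffset = t aOffset"
      by (simp_all add: t(4) frame)
    have "u k = s k" if "k < 8" for k using that frame[of k] t(4)[of k] by auto
    then show "called m d \<rho> \<kappa> r s u"
      using u unfolding called_def same t by auto
  qed
qed

lemma solve_body_first:
  assumes ok: "input_ok m s" and d: "Suc d < m" "s vd 0 = real (Suc d)" and "s aStage (Suc d) = 0"
  shows "terminates solve_body s (80 * d + 150) (called m d (\<mu> (Suc d)) 0 1 s)" (is "terminates _ _ _ ?Q")
proof -
  let ?s = "exec first_call s"
  have s: "?s = s(aSlope := (s aSlope)(Suc d := \<mu> (Suc d)), aOffset := (s aOffset)(Suc d := 0),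
      aStage := (s aStage)(Suc d := 1))"
    using d input_okD(4)[OF ok d(1)] by (simp add: first_call_def)
  have ok': "input_ok m ?s" by (rule input_ok_cong[OF _ ok]) (simp add: s)
  have "terminates push ?s (80 * d + 100) ?Q"
    by (rule push_called[where d = d and s = s, OF ok' d]) (simp_all add: s)
  then have "terminates (Cond (LessEq (Const 1) (Read aStage (var vd))) piece first_call ;; push) s (80 * d + 120) ?Q"
    using assms
    by (intro terminates_Seq[where k = 20 and l = "80 * d + 100"] terminates_Cond[where k = 15]
        terminates_exec[where Q = "\<lambda>t. terminates push t (80 * d + 100) ?Q"])
      (simp_all add: first_call_def)
  then show ?thesis
    unfolding solve_body_def using assms
    by (intro terminates_Cond[where k = "80 * d + 130" and Q = ?Q]
        terminates_Cond[where k = "80 * d + 120" and Q = ?Q]) simp_all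
qed

lemma solve_body_second:
  assumes ok: "input_ok m s" and d: "Suc d < m" "s vd 0 = real (Suc d)" and stage: "s aStage (Suc d) = 1"
  defines "g \<equiv> \<lambda>j. s aG (Suc d * m + j)" and "f \<equiv> \<lambda>j. s aF (Suc d * m + j)"
  defines "i \<equiv> cell (Suc d) g f (\<mu> (Suc d) * s vR 0)"
  defines "u \<equiv> upper d g f (\<mu> (Suc d) * s vR 0) i"
  shows "terminates solve_body s (100 * (d + 2)\<^sup>2 + 150 * d + 600)
    (called m d (ratio (Suc d) u (f (Suc d))) (offset (Suc d) u i (g (Suc d)) (f (Suc d))) 2 s)"
    (is "terminates _ _ _ ?Q")
proof -
  have "terminates piece s (100 * (d + 2)\<^sup>2 + 70 * d + 400) (\<lambda>t.
      t aSlope = (s aSlope)(Suc d := ratio (Suc d) u (f (Suc d))) \<and>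
      t aOffset = (s aOffset)(Suc d := offset (Suc d) u i (g (Suc d)) (f (Suc d))) \<and>
      t aStage = (s aStage)(Suc d := 2) \<and>
      (\<forall>k. k \<notin> {aSlope, aOffset, aStage, aX} \<union> {vj..vb} \<longrightarrow> t k = s k))"
    unfolding g_def f_def i_def u_def by (rule piece[OF ok d le_refl])
  then have "terminates piece s (100 * (d + 2)\<^sup>2 + 70 * d + 400) (\<lambda>t. terminates push t (80 * d + 100) ?Q)"
  proof (rule terminates_mono[OF _ le_refl])
    fix t
    assume t: "t aSlope = (s aSlope)(Suc d := ratio (Suc d) u (f (Suc d))) \<and>
      t aOffset = (s aOffset)(Suc d := offset (Suc d) u i (g (Suc d)) (f (Suc d))) \<and>
      t aStage = (s aStage)(Suc d := 2) \<and>
      (\<forall>k. k \<notin> {aSlope, aOffset, aStage, aX} \<union> {vj..vb} \<longrightarrow> t k = s k)"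
    then have frame: "t k = s k" if "k \<notin> {aSlope, aOffset, aStage, aX} \<union> {vj..vb}" for k
      using that by blast
    have ok': "input_ok m t" by (rule input_ok_cong[OF _ ok]) (simp add: frame)
    show "terminates push t (80 * d + 100) ?Q"
      by (rule push_called[where d = d and s = s, OF ok' d]) (use t frame in blast)+
  qed
  then have "terminates (Cond (LessEq (Const 1) (Read aStage (var vd))) piece first_call ;; push) s
      (100 * (d + 2)\<^sup>2 + 150 * d + 550) ?Q"
    using d stage
    by (intro terminates_Seq[where k = "100 * (d + 2)\<^sup>2 + 70 * d + 410" and l = "80 * d + 100"]
        terminates_Cond[where k = "100 * (d + 2)\<^sup>2 + 70 * d + 400"]) simp_all
  then show ?thesis
    unfolding solve_body_def using d stage
    by (intro terminates_Cond[where k = "100 * (d + 2)\<^sup>2 + 150 * d + 570" and Q = ?Q]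
        terminates_Cond[where k = "100 * (d + 2)\<^sup>2 + 150 * d + 550" and Q = ?Q]) simp_all
qed

lemma solve_body_third:
  assumes d: "s vd 0 = real (Suc d)" and "s aStage (Suc d) = 2"
  shows "terminates solve_body s 50 (\<lambda>t. t = s(vR := (s vR)(0 := s aSlope (Suc d) * s vR 0 + s aOffset (Suc d)),
    vd := (s vd)(0 := real (Suc (Suc d)))))" (is "terminates _ _ _ ?Q")
proof -
  have "terminates return s 20 ?Q"
    using d by (intro terminates_exec[where Q = ?Q]) (simp_all add: return_def)
  then show ?thesis
    unfolding solve_body_def using assms
    by (intro terminates_Cond[where k = 30 and Q = ?Q] terminates_Cond[where k = 20 and Q = ?Q]) simp_all
qed

lemma solve_body_base:
  assumes ok: "input_ok m s" and d: "s vd 0 = 0"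
  shows "terminates solve_body s 60 (\<lambda>t. t vd 0 = 1 \<and>
    t vR 0 = solve 0 (s aG) (s aF) \<and> (\<forall>k. k \<notin> {vh, vw, vR, vd} \<longrightarrow> t k = s k))" (is "terminates _ _ _ ?Q")
proof -
  have "terminates base_case s 50 ?Q"
    using d input_okD(2)[OF ok]
    by (intro terminates_exec[where Q = ?Q]) (simp_all add: base_case_def Let_def frac_def min_def)
  then show ?thesis
    unfolding solve_body_def using d by (intro terminates_Cond[where k = 50 and Q = ?Q]) simp_all
qed

section \<open>Cost recurrence and correctness of the loop\<close>

primrec time :: "nat \<Rightarrow> nat"
  where
    "time 0 = 100"
  | "time (Suc d) = 2 * time d + (100 * d\<^sup>2 + 700 * d + 1400)"

text \<open>The quadratic is chosen so that adding it turns the recurrence into exact doubling; at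
  level 0 the sum is \<open>100 + 2400\<close>.\<close>

lemma time_le: "time d + (100 * d\<^sup>2 + 900 * d + 2400) \<le> 2500 * 2 ^ d"
  by (induction d) (simp_all add: power2_eq_square algebra_simps)

definition returned :: "nat \<Rightarrow> nat \<Rightarrow> memory \<Rightarrow> memory \<Rightarrow> bool"
  where "returned m d s t \<longleftrightarrow> t vd 0 = real (Suc d) \<and>
    t vR 0 = solve d (\<lambda>j. s aG (d * m + j)) (\<lambda>j. s aF (d * m + j)) \<and>
    (\<forall>i\<ge>d * m. t aG i = s aG i \<and> t aF i = s aF i) \<and>
    (\<forall>l>d. t aSlope l = s aSlope l \<and> t aOffset l = s aOffset l \<and> t aStage l = s aStage l) \<and>
    (\<forall>k<7. t k = s k)"

text \<open>All calls share one loop, so a call is specified by its continuation: if everything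
  after the return of frame \<open>d\<close> costs \<open>n\<close>, the call adds
  \<open>time d\<close>. Generality in \<open>n\<close> and \<open>Q\<close> lets the induction
  hypothesis serve both inner calls, each with the remaining work of the parent as
  continuation.\<close>

lemma solve_loop:
  assumes "input_ok m s" "d < m" "s vd 0 = real d" "s aStage d = 0"
    and "\<And>t. returned m d s t \<Longrightarrow> terminates solve_loop t n Q"
  shows "terminates solve_loop s (n + time d) Q"
  using assms
proof (induction d arbitrary: s n Q)
  case 0
  let ?R = "\<lambda>t. t vd 0 = 1 \<and> t vR 0 = solve 0 (s aG) (s aF) \<and> (\<forall>k. k \<notin> {vh, vw, vR, vd} \<longrightarrow> t k = s k)"
  have "terminates solve_body s 60 ?R" using 0 by (intro solve_body_base) auto
  then have "terminates solve_body s 60 (\<lambda>t. terminates solve_loop t n Q)"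
  proof (rule terminates_mono[OF _ le_refl])
    fix t assume t: "?R t"
    then have "t k = s k" if "k \<notin> {vh, vw, vR, vd}" for k using that by blast
    with t have "returned m 0 s t" by (simp add: returned_def)
    then show "terminates solve_loop t n Q" by (rule 0)
  qed
  then show ?case
    unfolding solve_loop_def using 0 input_okD(1)[OF 0(1)]
    by (intro terminates_While_step[where k = 60 and l = n and Q = Q]) simp_all
next
  case (Suc d)
  note ok = Suc.prems(1) and d = Suc.prems(2,3)
  define g f where "g = (\<lambda>j. s aG (Suc d * m + j))" and "f = (\<lambda>j. s aF (Suc d * m + j))"
  define f0 where "f0 = (\<lambda>j. c (Suc d) j + \<mu> (Suc d) * (f j - c (Suc d) j))"
  define t0 where "t0 = \<mu> (Suc d) * solve d g f0"
  define i where "i = cell (Suc d) g f t0"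
  define u where "u = upper d g f t0 i"
  define \<rho> \<kappa> where "\<rho> = ratio (Suc d) u (f (Suc d))" and "\<kappa> = offset (Suc d) u i (g (Suc d)) (f (Suc d))"
  define g2 f2 where "g2 = (\<lambda>j. g j + \<kappa> * (f j - c (Suc d) j))"
    and "f2 = (\<lambda>j. c (Suc d) j + \<rho> * (f j - c (Suc d) j))"
  have solve: "solve (Suc d) g f = \<rho> * solve d g2 f2 + \<kappa>"
    unfolding g2_def f2_def \<rho>_def \<kappa>_def u_def i_def t0_def f0_def by (simp add: Let_def)
  have step: "terminates solve_loop t n Q"
    if "terminates solve_body t k (\<lambda>t. terminates solve_loop t l Q)" "t vd 0 = real (Suc d)"
      "input_ok m t" "3 + k + l \<le> n" for t k l n
    unfolding solve_loop_def using that d input_okD(1)[OF that(3)]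
    by (intro terminates_While_step[where k = k and l = l and Q = Q]) (simp_all add: solve_loop_def)

  \<comment> \<open>The three visits to the parent frame are treated from the last to the first, as
    the later ones form the continuation of the call before them.\<close>
  have third: "terminates solve_loop t4 (n + 60) Q"
    if ok4: "input_ok m t4" and t4: "t4 vd 0 = real (Suc d)" "t4 aStage (Suc d) = 2" "t4 aSlope (Suc d) = \<rho>"
      "t4 aOffset (Suc d) = \<kappa>" "t4 vR 0 = solve d g2 f2"
      "\<And>i. i \<ge> Suc d * m \<Longrightarrow> t4 aG i = s aG i \<and> t4 aF i = s aF i"
      "\<And>l. l > Suc d \<Longrightarrow> t4 aSlope l = s aSlope l \<and> t4 aOffset l = s aOffset l \<and> t4 aStage l = s aStage l"
      "\<And>k. k < 7 \<Longrightarrow> t4 k = s k" for t4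
  proof (rule step[OF _ t4(1) ok4])
    let ?t = "t4(vR := (t4 vR)(0 := t4 aSlope (Suc d) * t4 vR 0 + t4 aOffset (Suc d)),
      vd := (t4 vd)(0 := real (Suc (Suc d))))"
    have "returned m (Suc d) s ?t"
      unfolding returned_def g_def[symmetric] f_def[symmetric] solve using t4 by auto
    then have "terminates solve_loop ?t n Q" by (rule Suc.prems)
    then show "terminates solve_body t4 50 (\<lambda>t. terminates solve_loop t n Q)"
      by (intro terminates_mono[OF solve_body_third[OF t4(1,2)] le_refl]) simp
  qed simp

  have second: "terminates solve_loop t2 (n + time d + (100 * (d + 2)\<^sup>2 + 150 * d + 700)) Q"
    if ok2: "input_ok m t2" and t2: "t2 vd 0 = real (Suc d)" "t2 aStage (Suc d) = 1" "t2 vR 0 = solve d g f0"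
      "\<And>i. i \<ge> Suc d * m \<Longrightarrow> t2 aG i = s aG i \<and> t2 aF i = s aF i"
      "\<And>l. l > Suc d \<Longrightarrow> t2 aSlope l = s aSlope l \<and> t2 aOffset l = s aOffset l \<and> t2 aStage l = s aStage l"
      "\<And>k. k < 7 \<Longrightarrow> t2 k = s k" for t2
  proof (rule step[OF _ t2(1) ok2])
    have gf: "(\<lambda>j. t2 aG (Suc d * m + j)) = g" "(\<lambda>j. t2 aF (Suc d * m + j)) = f"
      using t2(4) by (simp_all add: g_def f_def)
    have gf': "t2 aG (Suc d * m + j) = g j" "t2 aF (Suc d * m + j) = f j" for j
      using t2(4) by (simp_all add: g_def f_def)
    have "terminates solve_body t2 (100 * (d + 2)\<^sup>2 + 150 * d + 600) (called m d \<rho> \<kappa> 2 t2)"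
      using solve_body_second[OF ok2 d(1) t2(1,2)]
      unfolding gf gf' t2(3) t0_def[symmetric] i_def[symmetric] u_def[symmetric]
        \<rho>_def[symmetric] \<kappa>_def[symmetric] .
    then show "terminates solve_body t2 (100 * (d + 2)\<^sup>2 + 150 * d + 600)
      (\<lambda>t. terminates solve_loop t (n + 60 + time d) Q)"
    proof (rule terminates_mono[OF _ le_refl])
      fix t3 assume t3: "called m d \<rho> \<kappa> 2 t2 t3"
      have ok3: "input_ok m t3" by (rule input_ok_cong[OF _ ok2]) (use t3 in \<open>simp add: called_def\<close>)
      show "terminates solve_loop t3 (n + 60 + time d) Q"
      proof (rule Suc.IH[OF ok3])
        fix t4 assume t4: "returned m d t3 t4"
        have ok4: "input_ok m t4" by (rule input_ok_cong[OF _ ok3]) (use t4 in \<open>simp add: returned_def\<close>)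
        have "solve d (\<lambda>j. t3 aG (d * m + j)) (\<lambda>j. t3 aF (d * m + j)) = solve d g2 f2"
          using t3 by (intro solve_cong) (auto simp: called_def gf' g2_def f2_def simp del: mult_Suc)
        then have "t4 vR 0 = solve d g2 f2" using t4 by (simp add: returned_def)
        moreover have "t4 aG i = s aG i \<and> t4 aF i = s aF i" if "i \<ge> Suc d * m" for i
          using t2(4)[OF that] t3 t4 that by (simp add: called_def returned_def)
        moreover have "t4 aSlope l = s aSlope l \<and> t4 aOffset l = s aOffset l \<and> t4 aStage l = s aStage l"
          if "l > Suc d" for l
          using t2(5)[OF that] t3 t4 that by (simp add: called_def returned_def)
        moreover have "t4 k = s k" if "k < 7" for k
          using t2(6)[OF that] t3 t4 that by (simp add: called_def returned_def)
        ultimately show "terminates solve_loop t4 (n + 60) Q"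
          using t3 t4 by (intro third[OF ok4]) (simp_all add: called_def returned_def)
      qed (use t3 d in \<open>simp_all add: called_def\<close>)
    qed
  qed simp

  let ?n = "n + time d + (100 * (d + 2)\<^sup>2 + 150 * d + 700)"
  show ?case
  proof (rule step[OF _ d(2) ok])
    show "terminates solve_body s (80 * d + 150) (\<lambda>t. terminates solve_loop t (?n + time d) Q)"
    proof (rule terminates_mono[OF solve_body_first[OF ok d Suc.prems(4)] le_refl])
      fix t1 assume t1: "called m d (\<mu> (Suc d)) 0 1 s t1"
      have ok1: "input_ok m t1" by (rule input_ok_cong[OF _ ok]) (use t1 in \<open>simp add: called_def\<close>)
      show "terminates solve_loop t1 (?n + time d) Q"
      proof (rule Suc.IH[OF ok1])
        fix t2 assume t2: "returned m d t1 t2"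
        have ok2: "input_ok m t2" by (rule input_ok_cong[OF _ ok1]) (use t2 in \<open>simp add: returned_def\<close>)
        have "solve d (\<lambda>j. t1 aG (d * m + j)) (\<lambda>j. t1 aF (d * m + j)) = solve d g f0"
          using t1 by (intro solve_cong) (auto simp: called_def g_def f_def f0_def)
        then have "t2 vR 0 = solve d g f0" using t2 by (simp add: returned_def)
        moreover have "t2 aG i = s aG i \<and> t2 aF i = s aF i" if "i \<ge> Suc d * m" for i
          using t1 t2 that by (simp add: called_def returned_def)
        moreover have "t2 aSlope l = s aSlope l \<and> t2 aOffset l = s aOffset l \<and> t2 aStage l = s aStage l"
          if "l > Suc d" for l
          using t1 t2 that by (simp add: called_def returned_def)
        moreover have "t2 k = s k" if "k < 7" for k
          using t1 t2 that by (simp add: called_def returned_def)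
        ultimately show "terminates solve_loop t2 ?n Q"
          using t1 t2 by (intro second[OF ok2]) (simp_all add: called_def returned_def)
      qed (use t1 d in \<open>simp_all add: called_def\<close>)
    qed
    show "3 + (80 * d + 150) + (?n + time d) \<le> n + time (Suc d)"
      by (simp add: power2_eq_square algebra_simps)
  qed
qed

section \<open>Initial frame and total cost\<close>

lemma setup_loop:
  assumes "s 0 0 = real m" "s vd 0 = real d" "s vj 0 = 0" "m = Suc d"
  shows "terminates (While (Less (var vj) expr_m) setup_body) s (50 * m + 10) (\<lambda>t.
    (\<forall>j<m. t aG (d * m + j) = s 6 j \<and> t aF (d * m + j) = - s 4 j) \<and>
    (\<forall>k. k \<notin> {aG, aF, vj} \<longrightarrow> t k = s k))"
proof -
  let ?I = "\<lambda>j t. t vj 0 = real j \<and>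
    (\<forall>i<j. t aG (d * m + i) = s 6 i \<and> t aF (d * m + i) = - s 4 i) \<and>
    (\<forall>k. k \<notin> {aG, aF, vj} \<longrightarrow> t k = s k)"
  have "terminates (While (Less (var vj) expr_m) setup_body) s (50 * m + 10) (?I m)"
  proof (rule terminates_For[where k = 45 and I = ?I and N = m])
    fix j t assume j: "j < m" and I: "?I j t"
    have frame: "\<And>k. k \<notin> {aG, aF, vj} \<Longrightarrow> t k = s k" using I by blast
    have t: "t 0 = s 0" "t 4 = s 4" "t 6 = s 6" "t vd = s vd" by (simp_all add: frame)
    have vj: "t vj 0 = real j" using I by simp
    have exec: "exec setup_body t = t(aG := (t aG)(d * m + j := s 6 j),
      aF := (t aF)(d * m + j := - s 4 j), vj := (t vj)(0 := real j + 1))" (is "_ = ?t")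
      using assms(1,2) by (simp add: setup_body_def t vj)
    have "?I (Suc j) (exec setup_body t)"
      unfolding exec
    proof (intro conjI allI impI)
      fix i assume "i < Suc j"
      then show "?t aG (d * m + i) = s 6 i" "?t aF (d * m + i) = - s 4 i"
        using I by (auto simp: less_Suc_eq)
    qed (use frame in simp_all)
    then have "terminates setup_body t 45 (?I (Suc j))"
      by (rule terminates_exec[where Q = "?I (Suc j)", rotated 2]) (simp_all add: setup_body_def)
    then show "holds t (Less (var vj) expr_m) \<and> terminates setup_body t 45 (?I (Suc j))"
      using j vj t assms(1) by simp
  next
    fix t assume "?I m t"
    then show "\<not> holds t (Less (var vj) expr_m)" using assms(1) by simp
  qed (use assms in simp_all)
  then show ?thesis by (rule terminates_mono) auto
qed

lemma main_program:
  assumes ok: "input_ok (Suc d) s" and s: "s aStage d = 0"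
  shows "terminates main_program s (5000 * (Suc d * 2 ^ Suc d))
    (\<lambda>t. result t = solve d (s 6) (\<lambda>j. - s 4 j))" (is "terminates _ _ _ ?Q")
proof -
  let ?P = "assign vd (Sub expr_m (Const 1)) ;; assign vj (Const 0)"
  let ?s = "exec ?P s"
  have ok1: "input_ok (Suc d) ?s" by (rule input_ok_cong[OF _ ok]) simp
  have s1: "?s 0 0 = real (Suc d)" "?s vd 0 = real d" "?s vj 0 = 0" "?s 6 = s 6" "?s 4 = s 4"
    "?s aStage d = 0"
    using input_okD(1)[OF ok] s by simp_all
  have "terminates main_program s (20 + (50 * Suc d + 10 + (3 + time d))) ?Q"
    unfolding main_program_def
  proof (rule terminates_exec_Seq[where k = "50 * Suc d + 10 + (3 + time d)"])
    show "terminates (While (Less (var vj) expr_m) setup_body ;; solve_loop) ?s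
      (50 * Suc d + 10 + (3 + time d)) ?Q"
    proof (rule terminates_Seq_post[where l = "3 + time d", OF setup_loop[where s = ?s, OF s1(1-3) refl]])
      fix t
      assume t: "(\<forall>j<Suc d. t aG (d * Suc d + j) = ?s 6 j \<and> t aF (d * Suc d + j) = - ?s 4 j) \<and>
        (\<forall>k. k \<notin> {aG, aF, vj} \<longrightarrow> t k = ?s k)"
      then have frame: "t k = ?s k" if "k \<notin> {aG, aF, vj}" for k using that by blast
      have ok2: "input_ok (Suc d) t" by (rule input_ok_cong[OF _ ok1]) (simp add: frame)
      have t': "t vd 0 = real d" "t aStage d = 0" using s1 frame[of vd] frame[of aStage] by simp_all
      have solve: "solve d (\<lambda>j. t aG (d * Suc d + j)) (\<lambda>j. t aF (d * Suc d + j))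
          = solve d (s 6) (\<lambda>j. - s 4 j)"
        using t s1 by (intro solve_cong) (auto simp: less_Suc_eq_le)
      \<comment> \<open>The 3 pays for the last, failing loop test.\<close>
      show "terminates solve_loop t (3 + time d) ?Q"
      proof (rule solve_loop[OF ok2 lessI t'])
        fix u assume u: "returned (Suc d) d t u"
        have "input_ok (Suc d) u" by (rule input_ok_cong[OF _ ok2]) (use u in \<open>simp add: returned_def\<close>)
        from input_okD(1)[OF this] u show "terminates solve_loop u 3 ?Q"
          unfolding solve_loop_def
          by (intro terminates_While_exit) (simp_all add: returned_def result_def solve del: mult_Suc_right)
      qed
    qed simp
  qed simp_all
  moreover have "20 + (50 * Suc d + 10 + (3 + time d)) \<le> 5000 * (Suc d * 2 ^ Suc d)"
  proof -
    define N where "N = Suc d * 2 ^ Suc d"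
    have "time d \<le> 2500 * 2 ^ d" using time_le[of d] by simp
    also have "2500 * 2 ^ d \<le> 2500 * N" unfolding N_def by (intro mult_le_mono2) simp
    finally have "time d \<le> 2500 * N" .
    moreover have "Suc d * 1 \<le> N" unfolding N_def by (intro mult_le_mono2) simp
    then have "d + 1 \<le> N" by simp
    ultimately have "20 + (50 * Suc d + 10 + (3 + time d)) \<le> 5000 * N" by simp
    then show ?thesis by (simp only: N_def)
  qed
  ultimately show ?thesis by (auto elim: terminates_mono)
qed

lemma input_memory_ok: "input_ok m (input_memory m n a c \<gamma> \<mu> b A p)"
proof -
  \<comment> \<open>The last row in use has number \<open>m - 1\<close>, so the end
    \<open>Suc (Suc d) * m\<close> of a row is at most \<open>m * m\<close>.\<close>
  have lt: "m + d * m + j < m * m" if "Suc d < m" "j < m" for d j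
  proof -
    have "m + d * m + j < Suc (Suc d) * m" using that by simp
    also have "\<dots> \<le> m * m" using that by (intro mult_le_mono1) simp
    finally show ?thesis .
  qed
  have "(m + d * m + j) div m = Suc d" "(m + d * m + j) mod m = j" if "j < m" for d j
    using that div_mult_self3[of m "Suc d" j] mod_mult_self3[of "Suc d" m j] by simp_all
  with lt show ?thesis by (auto simp: input_ok_def input_memory_def)
qed

end

theorem mainTheorem3:
  shows "\<exists>(P :: program) (C :: nat).
    \<forall>(m :: nat) (n :: nat) (a :: int) (c :: nat \<Rightarrow> nat \<Rightarrow> real) (\<gamma> :: nat \<Rightarrow> real)
      (\<mu> :: nat \<Rightarrow> real) (X :: (nat \<Rightarrow> real) set) (b :: nat \<Rightarrow> real)
      (A :: nat \<Rightarrow> nat \<Rightarrow> real) (p :: nat \<Rightarrow> real).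
      1 \<le> m \<and> m \<le> n \<and>
      gen_cross_polytope a c \<gamma> \<mu> m X \<and>
      b \<in> Rn n - Zn n \<and>
      - b \<in> Euclidean_space n interior_of (cylinder m n X) \<and>
      (\<forall>i<2 ^ m. A i \<in> Rn m) \<and>
      (+) b ` cylinder m n X = {x \<in> Rn n. \<forall>i<2 ^ m. (\<Sum>j<m. A i j * x j) \<le> 1} \<and>
      p \<in> Rn n
      \<longrightarrow> (\<exists>k t. run P (input_memory m n a c \<gamma> \<mu> b A p) k t \<and>
            result t = trivial_lifting n ((+) b ` cylinder m n X) p \<and>
            k \<le> C * (m * 2 ^ m))"
proof (rule exI[of _ main_program], rule exI[of _ 5000], intro allI impI)
  fix m n a c \<gamma> \<mu> X b A p
  let ?s = "input_memory m n a c \<gamma> \<mu> b A p"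
  assume asm: "1 \<le> m \<and> m \<le> n \<and> gen_cross_polytope a c \<gamma> \<mu> m X \<and> b \<in> Rn n - Zn n \<and>
    - b \<in> Euclidean_space n interior_of (cylinder m n X) \<and> (\<forall>i<2 ^ m. A i \<in> Rn m) \<and>
    (+) b ` cylinder m n X = {x \<in> Rn n. \<forall>i<2 ^ m. (\<Sum>j<m. A i j * x j) \<le> 1} \<and> p \<in> Rn n"
  interpret cross_parameters a c \<gamma> \<mu> .
  from asm obtain d where d: "m = Suc d" "valid d" "X = {x \<in> Rn (Suc d). inX d x}"
    using gen_cross_polytope_inX by metis
  have n: "d < n" "b \<in> Rn n" "p \<in> Rn n" using asm d by auto
  note B = core_of_inequalities[OF n(1,2), of "2 ^ m" A, folded d(1) d(3)]
  have core: "core d (- b)" and mem: "\<And>x. x \<in> Rn n \<Longrightarrow>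
      x \<in> (+) b ` cylinder m n X \<longleftrightarrow> inX d (\<lambda>j. x j + (- b) j)"
    using B asm by blast+
  have lifting: "trivial_lifting n ((+) b ` cylinder m n X) p = solve d p (- b)"
    by (rule trivial_lifting_eq_solution[OF d(2) core solve_correct[OF d(2) core] n(1,3) mem])
  have "solve d (?s 6) (\<lambda>j. - ?s 4 j) = solve d p (- b)"
    using n(1) by (intro solve_cong) (auto simp: input_memory_def)
  moreover have "terminates main_program ?s (5000 * (m * 2 ^ m))
      (\<lambda>t. result t = solve d (?s 6) (\<lambda>j. - ?s 4 j))"
    unfolding d(1)
    by (rule main_program[OF input_memory_ok]) (simp add: input_memory_def)
  ultimately show "\<exists>k t. run main_program ?s k t \<and>
      result t = trivial_lifting n ((+) b ` cylinder m n X) p \<and> k \<le> 5000 * (m * 2 ^ m)"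
    unfolding lifting terminates_def by metis
qed

end
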